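(* Let $\{W_n\}_{n\ge1}\subset\mathcal T$, $W_n=\sum_{k\in\mathbb Z}\delta_{(x_k^n,y_k^n)}$, be trap environments such that $W_n\to W$ in the vague topology of point processes on $\mathbb R\times(0,\infty]$ with $W\in\mathcal T'$, and such that $$\lim_{\varepsilon\to0}\limsup_{n\to\infty}\iint_{[-L,L]\times(0,\varepsilon)}y\,W_n(dx\,dy)=0\qquad\text{for all }L<\infty.$$ Let $a_n\to\infty$ and let $u:\mathbb R\to[0,\infty)$ be continuous with compact support. Let the systems $\eta^n$ of independent directed trap particles in the trap environments $W_n$ be constructed on a common probability space with measure $\mathbf P$, so that for each $n$ the initial values $\{\eta_0^n(x_k^n)\}_{k\in\mathbb Z}$ are independent with $\eta_0^n(x_k^n)\sim\mathrm{Poisson}(a_nu(x_k^n)y_k^n)$. Then for every continuous compactly supported $\phi:\mathbb R_+\times\mathbb R\to\mathbb R$, $$\lim_{n\to\infty}\frac1{a_n}\int_0^\infty\sum_{k\in\mathbb Z}\eta_t^n(x_k^n)\phi(t,x_k^n)\,dt=\int_0^\infty\int_{\mathbb R}\phi(t,x)u_W(t,x)\,\sigma_W(dx)\,dt\qquad\text{in }\mathbf P\text{-probability}.$$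
   Context: Trap environments. $\mathcal T$ is the set of point processes $W=\sum_k\delta_{(x_k,y_k)}$ on $\mathbb R\times(0,\infty]$ (Radon point measures; sets $[-L,L]\times[\varepsilon,\infty]$ are compact) such that: (1) $W(\mathbb R\times\{\infty\})=0$; (2) $\sup_xW(\{x\}\times(0,\infty])=1$; (3) there is $\varepsilon_0>0$ with $W((-\infty,-L]\times[\varepsilon_0,\infty))=W([L,\infty)\times[\varepsilon_0,\infty))=\infty$ for all $L<\infty$; (4) $\iint_{[-L,L]\times(0,\varepsilon)}y\,W(dx\,dy)<\infty$ for all $\varepsilon>0$, $L<\infty$. Atoms are enumerated by $k\in\mathbb Z$, not necessarily in spatial order. $\mathcal J_W=\{x:W(\{x\}\times(0,\infty))>0\}$ is the set of trap locations, and $\mathcal T'$ is the set of $W\in\mathcal T$ with $\mathcal J_W$ dense in $\mathbb R$. The trap measure is $\sigma_W(A)=\iint_{A\times(0,\infty)}y\,W(dx\,dy)$. Directed trap processes. Given $W=\sum_k\delta_{(x_k,y_k)}\in\mathcal T$ let $\{\zeta_k\}$ be i.i.d. Exp(1) and $\tau_W=\sum_ky_k\zeta_k\delta_{x_k}$ (a.s. a Radon measure). Set $Z_W(t;x)=\sup\{x':\tau_W([x,x'))\le t\}$ (right-directed) and $Z_W^*(t;x)=\inf\{x':\tau_W((x',x])\le t\}$ (left-directed), and $u_W(t,x)=\mathbf E[u(Z_W^*(t;x))]$. Particle system in $W$. Let $\{Z_W^{k,j}\}_{k\in\mathbb Z,j\ge1}$ be independent processes, $Z_W^{k,j}$ having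 the law of $Z_W(\cdot\,;x_k)$, independent of the initial configuration $\{\eta_0^W(x_k)\}_k$, and put $\eta_t^W(x_k)=\sum_{\ell\in\mathbb Z}\sum_{j=1}^{\eta_0^W(x_\ell)}\mathbf 1\{Z_W^{\ell,j}(t)=x_k\}$. Write $\eta^n$ for $\eta^{W_n}$. *)

theory Defs
  imports "HOL-Probability.Probability"
begin

section \<open>Trap environments\<close>

text \<open>
  The half-open interval \<open>(0,\<infinity>]\<close> is rendered as \<open>{0<..}\<close> in \<open>ennreal\<close>, so that intervals
  \<open>[\<epsilon>,\<infinity>]\<close> of depths are compact. Environments are measures on \<open>\<real> \<times> (0,\<infinity>]\<close>.
\<close>

definition env_set :: "(real \<times> ennreal) set" where
  "env_set = UNIV \<times> {0<..}"

definition env_space :: "(real \<times> ennreal) measure" where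
  "env_space = restrict_space borel env_set"

text \<open>
  \<open>W = \<Sum>\<^sub>k \<delta>\<^bsub>(x\<^sub>k, y\<^sub>k)\<^esub>\<close>: the push-forward of counting measure maps \<open>A\<close> to the number of indices
  \<open>k\<close> with \<open>(x\<^sub>k, y\<^sub>k) \<in> A\<close>.
\<close>

definition enumerates :: "(int \<Rightarrow> real) \<Rightarrow> (int \<Rightarrow> ennreal) \<Rightarrow> (real \<times> ennreal) measure \<Rightarrow> bool" where
  "enumerates x y W \<longleftrightarrow>
     (\<forall>k. 0 < y k) \<and> W = distr (count_space UNIV) env_space (\<lambda>k. (x k, y k))"

definition truncated_depth :: "(real \<times> ennreal) measure \<Rightarrow> real \<Rightarrow> real \<Rightarrow> ennreal" where
  "truncated_depth W L \<epsilon> =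
     (\<integral>\<^sup>+ p. snd p * indicator ({-L..L} \<times> {0<..<ennreal \<epsilon>}) p \<partial>W)"

text \<open>
  The class \<open>\<T>\<close>. Enumerating by all of \<open>\<int>\<close> is no restriction, since the third condition
  forces infinitely many atoms.
\<close>

definition trap_envs :: "(real \<times> ennreal) measure set" where
  "trap_envs = {W.
     (\<exists>x y. enumerates x y W) \<and>
     (\<forall>K. compact K \<and> K \<subseteq> env_set \<longrightarrow> emeasure W K < \<infinity>) \<and>
     emeasure W (UNIV \<times> {\<infinity>}) = 0 \<and>
     (SUP x. emeasure W ({x} \<times> {0<..})) = 1 \<and>
     (\<exists>\<epsilon>\<^sub>0::real. 0 < \<epsilon>\<^sub>0 \<and> (\<forall>L::real.
        emeasure W ({..-L} \<times> {ennreal \<epsilon>\<^sub>0..<\<infinity>}) = \<infinity> \<and>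
        emeasure W ({L..} \<times> {ennreal \<epsilon>\<^sub>0..<\<infinity>}) = \<infinity>)) \<and>
     (\<forall>\<epsilon> L. 0 < \<epsilon> \<longrightarrow> truncated_depth W L \<epsilon> < \<infinity>)}"

definition trap_locations :: "(real \<times> ennreal) measure \<Rightarrow> real set" where
  "trap_locations W = {x. emeasure W ({x} \<times> {0<..<\<infinity>}) > 0}"

definition dense_trap_envs :: "(real \<times> ennreal) measure set" where
  "dense_trap_envs = {W \<in> trap_envs. closure (trap_locations W) = UNIV}"

definition trap_measure :: "(real \<times> ennreal) measure \<Rightarrow> real measure" where
  "trap_measure W = distr (density W (\<lambda>p. snd p * indicator (UNIV \<times> {0<..<\<infinity>}) p)) borel fst"

definition vague_conv ::
    "(nat \<Rightarrow> (real \<times> ennreal) measure) \<Rightarrow> (real \<times> ennreal) measure \<Rightarrow> bool" where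
  "vague_conv Ws W \<longleftrightarrow>
     (\<forall>f :: real \<times> ennreal \<Rightarrow> real.
        continuous_on env_set f \<and>
        (\<exists>K. compact K \<and> K \<subseteq> env_set \<and> (\<forall>p\<in>env_set - K. f p = 0)) \<longrightarrow>
        (\<lambda>n. LINT p|Ws n. f p) \<longlonglongrightarrow> (LINT p|W. f p))"


section \<open>Directed trap processes\<close>

text \<open>Canonical space carrying i.i.d. \<open>Exp(1)\<close> variables \<open>\<zeta>\<^sub>k\<close>, \<open>k \<in> \<int>\<close>.\<close>

definition exp_clocks :: "(int \<Rightarrow> real) measure" where
  "exp_clocks = PiM UNIV (\<lambda>_. density lborel (\<lambda>s. ennreal (exponential_density 1 s)))"

text \<open>The random measure \<open>\<tau>\<^sub>W = \<Sum>\<^sub>k y\<^sub>k \<zeta>\<^sub>k \<delta>\<^bsub>x\<^sub>k\<^esub>\<close>.\<close>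

definition holding_measure ::
    "(int \<Rightarrow> real) \<Rightarrow> (int \<Rightarrow> ennreal) \<Rightarrow> (int \<Rightarrow> real) \<Rightarrow> real measure" where
  "holding_measure x y \<zeta> = distr (density (count_space UNIV) (\<lambda>k. y k * ennreal (\<zeta> k))) borel x"

definition Z_right ::
    "(int \<Rightarrow> real) \<Rightarrow> (int \<Rightarrow> ennreal) \<Rightarrow> (int \<Rightarrow> real) \<Rightarrow> real \<Rightarrow> real \<Rightarrow> real" where
  "Z_right x y \<zeta> z t = Sup {z'. emeasure (holding_measure x y \<zeta>) {z..<z'} \<le> ennreal t}"

definition Z_left ::
    "(int \<Rightarrow> real) \<Rightarrow> (int \<Rightarrow> ennreal) \<Rightarrow> (int \<Rightarrow> real) \<Rightarrow> real \<Rightarrow> real \<Rightarrow> real" where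
  "Z_left x y \<zeta> z t = Inf {z'. emeasure (holding_measure x y \<zeta>) {z'<..z} \<le> ennreal t}"

definition u_env ::
    "(int \<Rightarrow> real) \<Rightarrow> (int \<Rightarrow> ennreal) \<Rightarrow> (real \<Rightarrow> real) \<Rightarrow> real \<Rightarrow> real \<Rightarrow> real" where
  "u_env x y u t z = (LINT \<zeta>|exp_clocks. u (Z_left x y \<zeta> z t))"


section \<open>Particle systems\<close>

text \<open>
  Laws of processes indexed by \<open>t \<in> [0,\<infinity>)\<close> are taken on the product \<open>\<sigma>\<close>-algebra; for right-continuous
  paths, which is what a particle system below is required to have, they determine the law on path
  space.
\<close>

definition path_space :: "(real \<Rightarrow> real) measure" where
  "path_space = PiM {0..} (\<lambda>_. borel)"

definition path :: "(real \<Rightarrow> 'w \<Rightarrow> real) \<Rightarrow> 'w \<Rightarrow> real \<Rightarrow> real" where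
  "path Z \<omega> = (\<lambda>t\<in>{0..}. Z t \<omega>)"

text \<open>
  \<open>Z k j t\<close> is the position at time \<open>t\<close> of the \<open>j\<close>-th particle (\<open>j \<ge> 1\<close>) started at \<open>x k\<close>.
  The last clause says that the \<open>\<sigma>\<close>-algebras generated by the initial configuration and by
  the whole family of trajectories are independent.
\<close>

definition directed_trap_particles ::
    "'w measure \<Rightarrow> (int \<Rightarrow> real) \<Rightarrow> (int \<Rightarrow> ennreal) \<Rightarrow> (int \<Rightarrow> 'w \<Rightarrow> nat) \<Rightarrow>
     (int \<Rightarrow> nat \<Rightarrow> real \<Rightarrow> 'w \<Rightarrow> real) \<Rightarrow> bool" where
  "directed_trap_particles M x y \<eta>\<^sub>0 Z \<longleftrightarrow>
     prob_space.indep_vars M (\<lambda>_. path_space) (\<lambda>(k, j). path (Z k j)) (UNIV \<times> {1..}) \<and>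
     (\<forall>k. \<forall>j\<ge>1. distr M path_space (path (Z k j)) =
        distr exp_clocks path_space (\<lambda>\<zeta>. path (\<lambda>t \<zeta>. Z_right x y \<zeta> (x k) t) \<zeta>)) \<and>
     (\<forall>k. \<forall>j\<ge>1. \<forall>\<omega>\<in>space M. \<forall>t\<ge>0. continuous (at_right t) (\<lambda>s. Z k j s \<omega>)) \<and>
     prob_space.indep_set M
       (sets (vimage_algebra (space M) (\<lambda>\<omega> k. \<eta>\<^sub>0 k \<omega>) (PiM UNIV (\<lambda>_. count_space UNIV))))
       (sets (vimage_algebra (space M) (\<lambda>\<omega>. \<lambda>(k, j)\<in>UNIV \<times> {1..}. path (Z k j) \<omega>)
                (PiM (UNIV \<times> {1..}) (\<lambda>_. path_space))))"

text \<open>The occupation number \<open>\<eta>\<^sub>t(x\<^sub>k)\<close>.\<close>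

definition eta ::
    "(int \<Rightarrow> real) \<Rightarrow> (int \<Rightarrow> 'w \<Rightarrow> nat) \<Rightarrow> (int \<Rightarrow> nat \<Rightarrow> real \<Rightarrow> 'w \<Rightarrow> real) \<Rightarrow>
     real \<Rightarrow> int \<Rightarrow> 'w \<Rightarrow> real" where
  "eta x \<eta>\<^sub>0 Z t k \<omega> = (\<Sum>\<^sub>\<infinity>l. \<Sum>j = 1..\<eta>\<^sub>0 l \<omega>. of_bool (Z l j t \<omega> = x k))"

text \<open>
  Spelled out rather than via \<open>poisson_pmf\<close>, which is only available for positive rates: rate 0
  (the point mass at 0) occurs wherever the initial density vanishes.
\<close>

definition poisson_distributed :: "'w measure \<Rightarrow> ('w \<Rightarrow> nat) \<Rightarrow> real \<Rightarrow> bool" where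
  "poisson_distributed M X r \<longleftrightarrow>
     0 \<le> r \<and> X \<in> measurable M (count_space UNIV) \<and>
     (\<forall>m. measure M {\<omega> \<in> space M. X \<omega> = m} = exp (- r) * r ^ m / fact m)"

definition conv_in_prob :: "'w measure \<Rightarrow> (nat \<Rightarrow> 'w \<Rightarrow> real) \<Rightarrow> real \<Rightarrow> bool" where
  "conv_in_prob M X c \<longleftrightarrow>
     (\<forall>n. X n \<in> borel_measurable M) \<and>
     (\<forall>\<epsilon>>0. (\<lambda>n. measure M {\<omega> \<in> space M. \<bar>X n \<omega> - c\<bar> > \<epsilon>}) \<longlonglongrightarrow> 0)"

end

theory Submission
  imports Defs
begin

text \<open>
  Given the initial configuration, the integrated particle density is a compound Poisson sum of
  bounded functionals of independent trajectories, so after division by \<open>a\<^sub>n\<close> its variance is of order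
  \<open>1 / a\<^sub>n\<close>, and it suffices that the means converge. Since a right-directed particle started in \<open>x\<^sub>l\<close>
  spends the time interval from \<open>\<tau>[x\<^sub>l, x\<^sub>k)\<close> to \<open>\<tau>[x\<^sub>l, x\<^sub>k]\<close> in \<open>x\<^sub>k\<close>, the mean is a double sum over the
  traps in a bounded window, weighted by the depths of both traps. Shallow traps contribute little to
  it, uniformly in \<open>n\<close>; the finitely many deep ones converge one by one by vague convergence.
  In the limit the mean is identified through the duality between right- and left-directed processes.
  It holds because an exponential clock has itself as its stationary excess distribution: the mean
  time integral of \<open>\<phi>\<close> over the stay in \<open>x\<^sub>k\<close> is \<open>y\<^sub>k\<close> times the expectation of \<open>\<phi>\<close> at the departure
  time \<open>\<tau>[x\<^sub>l, x\<^sub>k]\<close>, and that time is symmetric under reversal of space.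
\<close>

text \<open>The main obstacle is that a bounded window may hold infinitely many traps, and uniformly
  in \<open>n\<close> only the total depth of the shallow ones is controlled. The
  \<open>flux\<close> is therefore compared with a version in which starts, targets and travel times
  are all thinned to one finite index set. Removing traps of total depth \<delta> shortens a travel
  time by at most \<delta> on average, since clocks have mean 1; a modulus
  \<open>e + C * \<bar>s - t\<bar>\<close>, which uniform continuity supplies, is affine in this
  change and passes through the expectation. Window and depth cutoff avoid the countably many values
  attained by limit atoms, so that counts of deep traps stabilise; matched traps are relabelled to a
  common index set, so that all environments share one family of clocks. A second obstacle is that
  trajectories are known only through laws on a product \<sigma>-algebra, on which a time integral
  is not evidently measurable. It is computed from right limits along a countable grid of times,
  with a test function cut down to the trap locations so that it matches the occupation numbers for
  every outcome.\<close>

lemma integrable_count_space_real_iff: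
  fixes f :: "'a \<Rightarrow> real"
  shows "integrable (count_space A) f \<longleftrightarrow> f summable_on A"
  using abs_summable_equivalent[of f A] summable_on_iff_abs_summable_on_real[of f A]
  by (simp add: Infinite_Set_Sum.abs_summable_on_def)

text \<open>Summability need not be assumed, because outside the summable case \<open>infsum\<close>
  and the Bochner integral share the default value 0. Sums over traps thereby become integrals, open
  to Fubini and to measurability of parameter integrals.\<close>

lemma infsum_eq_lint_count_space:
  fixes f :: "'a \<Rightarrow> real"
  shows "infsum f A = (LINT k|count_space A. f k)"
proof (cases "f summable_on A")
  case True
  then have "Infinite_Set_Sum.abs_summable_on f A"
    by (simp add: integrable_count_space_real_iff Infinite_Set_Sum.abs_summable_on_def)
  then show ?thesis
    using infsetsum_infsum[of f A] by (simp add: infsetsum_def)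
next
  case False
  then show ?thesis
    by (simp add: infsum_not_exists not_integrable_integral_eq integrable_count_space_real_iff)
qed

section \<open>Exponential clocks\<close>

abbreviation exp_law :: "real measure" where
  "exp_law \<equiv> density lborel (\<lambda>s. ennreal (exponential_density 1 s))"

interpretation exp_law: prob_space exp_law
  by (rule prob_space_exponential_density) simp

interpretation clocks: product_prob_space "\<lambda>_::int. exp_law" UNIV
  by unfold_locales

interpretation exp_clocks: prob_space exp_clocks
  unfolding exp_clocks_def by (rule clocks.P.prob_space_axioms)

lemma space_exp_clocks [simp]: "space exp_clocks = UNIV"
  by (simp add: exp_clocks_def space_PiM)

lemma measurable_clock [measurable]: "(\<lambda>\<zeta>. \<zeta> k) \<in> borel_measurable exp_clocks"
proof -
  have "(\<lambda>\<zeta>. \<zeta> k) \<in> measurable exp_clocks exp_law"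
    unfolding exp_clocks_def by measurable
  then show ?thesis by (simp add: measurable_def)
qed

lemma distr_clock: "distr exp_clocks borel (\<lambda>\<zeta>. \<zeta> k) = exp_law"
proof -
  have "distr exp_clocks exp_law (\<lambda>\<zeta>. \<zeta> k) = exp_law"
    unfolding exp_clocks_def by (rule clocks.PiM_component) simp
  then show ?thesis
    using distr_cong[of exp_clocks exp_clocks borel exp_law "\<lambda>\<zeta>. \<zeta> k" "\<lambda>\<zeta>. \<zeta> k"] by simp
qed

text \<open>Independence of the clock \<open>i\<close> from all others in the form of resampling:
  overwriting it with a fresh copy keeps the law. It serves to integrate out a single clock.\<close>

lemma distr_exp_clocks_upd:
  "distr (exp_law \<Otimes>\<^sub>M exp_clocks) exp_clocks (\<lambda>(s, \<zeta>). \<zeta>(i := s)) = exp_clocks"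
  using distr_pair_PiM_eq_PiM[of UNIV "\<lambda>_. exp_law" i] exp_law.prob_space_axioms
  by (simp add: exp_clocks_def)

lemma measurable_exp_clocks_upd [measurable]:
  "(\<lambda>(s, \<zeta>). \<zeta>(i := s)) \<in> measurable (exp_law \<Otimes>\<^sub>M exp_clocks) exp_clocks"
  unfolding exp_clocks_def split_beta'
  by (rule measurable_fun_upd[where J=UNIV]) simp_all

lemma exp_law_mean: "(\<integral>\<^sup>+s. ennreal s \<partial>exp_law) = 1"
proof -
  have "(\<integral>\<^sup>+s. ennreal s \<partial>exp_law) = (\<integral>\<^sup>+s. ennreal (exponential_density 1 s * s ^ 1) \<partial>lborel)"
    by (subst nn_integral_density)
       (auto intro!: nn_integral_cong simp: ennreal_mult' exponential_density_def)
  also have "\<dots> = 1"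
    using nn_integral_erlang_ith_moment[of 1 0 1]
    by (simp add: exponential_density_def erlang_density_def mult_ac)
  finally show ?thesis .
qed

lemma exp_law_pos: "AE s in exp_law. 0 < s"
proof -
  have "AE s in lborel. s \<noteq> (0::real)"
    by (rule AE_lborel_singleton)
  then show ?thesis
    by (subst AE_density) (auto simp: exponential_density_def split: if_splits)
qed

lemma clock_pos: "AE \<zeta> in exp_clocks. \<forall>k. 0 < \<zeta> k"
proof (subst AE_all_countable, safe)
  fix k :: int
  have "AE s in distr exp_clocks borel (\<lambda>\<zeta>. \<zeta> k). 0 < s"
    using exp_law_pos by (simp only: distr_clock)
  then show "AE \<zeta> in exp_clocks. 0 < \<zeta> k"
    using AE_distr_iff[of "\<lambda>\<zeta>. \<zeta> k" exp_clocks borel "\<lambda>s. 0 < s"] by simp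
qed

lemma clock_nonneg: "AE \<zeta> in exp_clocks. 0 \<le> \<zeta> k"
  using clock_pos by eventually_elim (simp add: less_imp_le)

lemma nn_integral_clock: "(\<integral>\<^sup>+\<zeta>. ennreal (\<zeta> k) \<partial>exp_clocks) = 1"
proof -
  have "(\<integral>\<^sup>+\<zeta>. ennreal (\<zeta> k) \<partial>exp_clocks) = (\<integral>\<^sup>+s. ennreal s \<partial>distr exp_clocks borel (\<lambda>\<zeta>. \<zeta> k))"
    by (subst nn_integral_distr) simp_all
  then show ?thesis by (simp add: distr_clock exp_law_mean)
qed

lemma integrable_clock: "integrable exp_clocks (\<lambda>\<zeta>. \<zeta> k)"
  by (intro integrableI_nn_integral_finite[where x=1]) (simp_all add: nn_integral_clock clock_nonneg)

text \<open>For finite index sets the chance that all clocks stay below a level decays geometrically.\<close>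

lemma clocks_sum_infinite:
  assumes J: "infinite J" and c: "0 < c"
  shows "AE \<zeta> in exp_clocks. (\<integral>\<^sup>+k. ennreal (c * \<zeta> k) \<partial>count_space J) = \<infinity>"
proof -
  have small: "AE \<zeta> in exp_clocks. \<not> (\<forall>k\<in>J. \<zeta> k \<le> real N)" for N :: nat
  proof -
    define r where "r = 1 - exp (- real N)"
    have r: "0 \<le> r" "r < 1" by (auto simp: r_def)
    have r_eq: "emeasure exp_law {..real N} = ennreal r"
      using emeasure_erlang_density[of 1 0 "real N"] by (simp add: erlang_CDF_0 r_def)
    let ?A = "{\<zeta> \<in> space exp_clocks. \<forall>k\<in>J. \<zeta> k \<le> real N}"
    have A: "?A \<in> sets exp_clocks"
      by (rule sets.sets_Collect_countable_Ball) measurable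
    have bound: "emeasure exp_clocks ?A \<le> ennreal (r ^ n)" for n
    proof -
      obtain F where F: "finite F" "F \<subseteq> J" "card F = n"
        using infinite_arbitrarily_large[OF J] by blast
      let ?B = "prod_emb UNIV (\<lambda>_. exp_law) F (Pi\<^sub>E F (\<lambda>_. {..real N}))"
      have "?A \<subseteq> ?B" using subsetD[OF F(2)] by (auto simp: prod_emb_def)
      then have "emeasure exp_clocks ?A \<le> emeasure exp_clocks ?B"
        unfolding exp_clocks_def by (intro emeasure_mono sets_PiM_I) (use F in auto)
      also have "\<dots> = (\<Prod>k\<in>F. emeasure exp_law {..real N})"
        unfolding exp_clocks_def using F by (intro clocks.emeasure_PiM_emb) auto
      also have "\<dots> = ennreal (r ^ n)"
        using F r by (simp add: r_eq ennreal_power)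
      finally show ?thesis .
    qed
    have "(\<lambda>n. ennreal (r ^ n)) \<longlonglongrightarrow> ennreal 0"
      by (intro tendsto_ennrealI LIMSEQ_realpow_zero r)
    then have "emeasure exp_clocks ?A \<le> ennreal 0"
      by (rule LIMSEQ_le_const) (use bound in blast)
    then show ?thesis
      using A by (intro AE_I[where N="?A"]) simp_all
  qed
  have "AE \<zeta> in exp_clocks. \<forall>N::nat. \<not> (\<forall>k\<in>J. \<zeta> k \<le> real N)"
    unfolding AE_all_countable using small by blast
  then show ?thesis
  proof eventually_elim
    fix \<zeta> assume *: "\<forall>N::nat. \<not> (\<forall>k\<in>J. \<zeta> k \<le> real N)"
    show "(\<integral>\<^sup>+k. ennreal (c * \<zeta> k) \<partial>count_space J) = \<infinity>"
    proof (rule ccontr)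
      assume "(\<integral>\<^sup>+k. ennreal (c * \<zeta> k) \<partial>count_space J) \<noteq> \<infinity>"
      then obtain b where b: "0 \<le> b" "(\<integral>\<^sup>+k. ennreal (c * \<zeta> k) \<partial>count_space J) = ennreal b"
        by (metis ennreal_cases infinity_ennreal_def)
      \<comment> \<open>A finite sum \<open>b\<close> would bound every clock by
        \<open>b / c\<close>, but almost surely no integer bounds all clocks with index in
        \<open>J\<close>.\<close>
      obtain N :: nat where N: "b / c < real N" using reals_Archimedean2 by blast
      obtain k where k: "k \<in> J" "real N < \<zeta> k" using * by (meson not_le)
      have "ennreal (c * \<zeta> k) \<le> ennreal b"
        unfolding b(2)[symmetric] using k(1) by (rule nn_integral_ge_point)
      then have "c * \<zeta> k \<le> b" using b by (simp add: ennreal_le_iff)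
      moreover have "b < c * \<zeta> k"
      proof -
        have "b < c * real N" using N c by (simp add: pos_divide_less_eq mult.commute)
        also have "\<dots> < c * \<zeta> k" using k c by simp
        finally show ?thesis .
      qed
      ultimately show False by simp
    qed
  qed
qed

section \<open>Measurability of the directed processes\<close>

lemma measurable_split_countable:
  assumes "countable A" "\<And>k. k \<in> A \<Longrightarrow> f k \<in> measurable M N"
  shows "(\<lambda>(\<omega>, k). f k \<omega>) \<in> measurable (M \<Otimes>\<^sub>M count_space A) N"
  unfolding split_beta'
  by (rule measurable_compose_countable'[where f="\<lambda>k p. f k (fst p)" and g=snd and I=A])
     (use assms in \<open>auto intro: measurable_compose[OF measurable_fst]\<close>)

lemma borel_measurable_nn_integral_count_space:
  assumes "countable A" "\<And>k. k \<in> A \<Longrightarrow> f k \<in> borel_measurable M"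
  shows "(\<lambda>\<omega>. \<integral>\<^sup>+k. f k \<omega> \<partial>count_space A) \<in> borel_measurable M"
proof -
  interpret sigma_finite_measure "count_space A"
    using assms(1) by (rule sigma_finite_measure_count_space_countable)
  show ?thesis
    using measurable_split_countable[OF assms] by (intro borel_measurable_nn_integral)
qed

lemma borel_measurable_lint_count_space:
  fixes f :: "'a \<Rightarrow> 'b \<Rightarrow> real"
  assumes "countable A" "\<And>k. k \<in> A \<Longrightarrow> f k \<in> borel_measurable M"
  shows "(\<lambda>\<omega>. LINT k|count_space A. f k \<omega>) \<in> borel_measurable M"
proof -
  interpret sigma_finite_measure "count_space A"
    using assms(1) by (rule sigma_finite_measure_count_space_countable)
  show ?thesis
    using measurable_split_countable[OF assms] by (intro borel_measurable_lebesgue_integral)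
qed

lemma borel_measurable_infsum_real:
  fixes f :: "'a \<Rightarrow> 'b \<Rightarrow> real"
  assumes "countable A" "\<And>k. k \<in> A \<Longrightarrow> f k \<in> borel_measurable M"
  shows "(\<lambda>\<omega>. \<Sum>\<^sub>\<infinity>k\<in>A. f k \<omega>) \<in> borel_measurable M"
  unfolding infsum_eq_lint_count_space using assms by (rule borel_measurable_lint_count_space)

lemma emeasure_holding_measure:
  assumes [measurable]: "A \<in> sets borel"
  shows "emeasure (holding_measure x y \<zeta>) A =
    (\<integral>\<^sup>+k. y k * ennreal (\<zeta> k) * indicator A (x k) \<partial>count_space UNIV)"
  unfolding holding_measure_def
  by (subst emeasure_distr) (auto simp: emeasure_density intro!: nn_integral_cong split: split_indicator)

lemma sets_holding_measure [simp, measurable_cong]: "sets (holding_measure x y \<zeta>) = sets borel"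
  by (simp add: holding_measure_def)

lemma holding_measure_uminus:
  assumes "A \<in> sets borel"
  shows "emeasure (holding_measure (\<lambda>k. - x k) y \<zeta>) (uminus ` A) = emeasure (holding_measure x y \<zeta>) A"
proof -
  have "uminus -` A \<inter> space borel \<in> sets borel"
    using assms by (intro measurable_sets[where A=borel]) auto
  moreover have "uminus -` A = uminus ` A" by force
  ultimately have "uminus ` A \<in> sets borel" by simp
  then show ?thesis using assms
    by (auto simp: emeasure_holding_measure intro!: nn_integral_cong split: split_indicator)
qed

text \<open>Reflection of space swaps the two directions. It needs no boundedness of the sets
  involved, since \<open>Inf\<close> on the reals is defined as the negated \<open>Sup\<close> of
  the negated set. Measurability thus has to be shown for one direction only, and the duality later
  rests on the same identity.\<close>

lemma Z_right_eq_Z_left: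
  "Z_right x y \<zeta> z t = - Z_left (\<lambda>k. - x k) y \<zeta> (- z) t"
proof -
  have "{z'. emeasure (holding_measure x y \<zeta>) {z..<z'} \<le> ennreal t} =
      uminus ` {z'. emeasure (holding_measure (\<lambda>k. - x k) y \<zeta>) {z'<..- z} \<le> ennreal t}" (is "?A = _ ` ?B")
  proof -
    have *: "uminus ` {z..<z'} = {- z'<..- z}" for z' by simp
    have "z' \<in> ?A \<longleftrightarrow> - z' \<in> ?B" for z'
      using holding_measure_uminus[of "{z..<z'}" x y \<zeta>] by (simp add: *)
    then show ?thesis by (force simp: image_iff)
  qed
  then show ?thesis
    unfolding Z_right_def Z_left_def Inf_real_def by (simp add: image_image)
qed

text \<open>Either the set is all of the reals, where \<open>Inf\<close> is some fixed unspecified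
  number, or it is bounded below and contains its infimum. Both cases are detected by countably many
  membership tests, which is what makes \<open>Z_left\<close> measurable.\<close>

lemma Inf_upward_closed_le_iff:
  fixes S :: "real set"
  assumes up: "\<And>a b. a \<in> S \<Longrightarrow> a \<le> b \<Longrightarrow> b \<in> S"
    and closed: "\<And>a. (\<And>b. a < b \<Longrightarrow> b \<in> S) \<Longrightarrow> a \<in> S"
    and ne: "S \<noteq> {}"
  shows "Inf S \<le> c \<longleftrightarrow> (if \<forall>N::nat. - real N \<in> S then Inf (UNIV :: real set) \<le> c else c \<in> S)"
proof (cases "\<forall>N::nat. - real N \<in> S")
  case True
  have "a \<in> S" for a
  proof -
    obtain N :: nat where "- a \<le> real N" using real_arch_simple by blast
    then show ?thesis using True up[of "- real N" a] by simp
  qed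
  then have "S = UNIV" by blast
  with True show ?thesis by simp
next
  case False
  then obtain N :: nat where N: "- real N \<notin> S" by blast
  have bdd: "bdd_below S"
    by (rule bdd_belowI[of _ "- real N"]) (use N up in \<open>meson linear\<close>)
  have "Inf S \<in> S"
  proof (rule closed)
    fix b assume "Inf S < b"
    then obtain a where "a \<in> S" "a < b" using cInf_less_iff[OF ne bdd] by blast
    then show "b \<in> S" using up[of a b] by simp
  qed
  then show ?thesis using False up[of "Inf S" c] cInf_lower[OF _ bdd, of c] by auto
qed

lemma Z_left_set:
  fixes x y \<zeta> z t
  defines "S \<equiv> {z'. emeasure (holding_measure x y \<zeta>) {z'<..z} \<le> ennreal t}"
  shows Z_left_set_mono: "\<And>a b. a \<in> S \<Longrightarrow> a \<le> b \<Longrightarrow> b \<in> S"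
    and Z_left_set_closed: "\<And>a. (\<And>b. a < b \<Longrightarrow> b \<in> S) \<Longrightarrow> a \<in> S"
    and Z_left_set_self: "z \<in> S"
proof -
  let ?H = "\<lambda>a. emeasure (holding_measure x y \<zeta>) {a<..z}"
  show "b \<in> S" if "a \<in> S" "a \<le> b" for a b
  proof -
    have "?H b \<le> ?H a" using that by (intro emeasure_mono) auto
    then show ?thesis using that by (simp add: S_def)
  qed
  show "z \<in> S" by (simp add: S_def)
  show "a \<in> S" if a: "\<And>b. a < b \<Longrightarrow> b \<in> S" for a
  proof -
    \<comment> \<open>Closedness of the set is continuity of the holding measure from below along
      these increasing intervals.\<close>
    have "(\<Union>n::nat. {a + 1 / Suc n<..z}) = {a<..z}"
    proof (intro antisym subsetI)
      fix w assume "w \<in> {a<..z}"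
      moreover from this obtain n :: nat where "1 / Suc n < w - a"
        using nat_approx_posE[of "w - a"] by auto
      ultimately show "w \<in> (\<Union>n::nat. {a + 1 / Suc n<..z})" by (auto intro!: exI[of _ n])
    next
      fix w assume "w \<in> (\<Union>n::nat. {a + 1 / Suc n<..z})"
      then obtain n :: nat where n: "a + 1 / Suc n < w" "w \<le> z" by auto
      have "0 < 1 / real (Suc n)" by simp
      then have "a < w" using n(1) by linarith
      then show "w \<in> {a<..z}" using n by simp
    qed
    moreover have "incseq (\<lambda>n::nat. {a + 1 / Suc n<..z})"
    proof (rule incseq_SucI, rule subsetI)
      fix n w assume "w \<in> {a + 1 / Suc n<..z}"
      moreover have "1 / real (Suc (Suc n)) \<le> 1 / real (Suc n)" by (simp add: field_simps)
      ultimately show "w \<in> {a + 1 / Suc (Suc n)<..z}"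
        unfolding greaterThanAtMost_iff by (meson add_left_mono order.strict_trans1)
    qed
    ultimately have "(SUP n::nat. ?H (a + 1 / Suc n)) = ?H a"
      using SUP_emeasure_incseq[of "\<lambda>n::nat. {a + 1 / Suc n<..z}" "holding_measure x y \<zeta>"]
      by (simp add: image_subset_iff)
    moreover have "(SUP n::nat. ?H (a + 1 / Suc n)) \<le> ennreal t"
      using a by (intro SUP_least) (simp add: S_def)
    ultimately show ?thesis by (simp add: S_def)
  qed
qed

lemma borel_sets_half_open: "{a<..b::real} \<in> sets borel"
  by simp

text \<open>Measurability is joint in time, start and clocks because Fubini is later applied to time
  and clocks together. A sublevel set is expressed through the holding measures of half-open
  intervals with countably many left ends.\<close>

lemma borel_measurable_Z_left:
  "(\<lambda>(t, z, \<zeta>). Z_left x y \<zeta> z t) \<in> borel_measurable (borel \<Otimes>\<^sub>M borel \<Otimes>\<^sub>M exp_clocks)"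
proof (subst borel_measurable_iff_le, safe)
  fix c
  have [measurable]: "(\<lambda>p. emeasure (holding_measure x y (snd (snd p))) {c<..fst (snd p)}) \<in>
      borel_measurable (borel \<Otimes>\<^sub>M borel \<Otimes>\<^sub>M exp_clocks)" for c :: real
    unfolding emeasure_holding_measure[OF borel_sets_half_open]
  proof (intro borel_measurable_nn_integral_count_space)
    fix k :: int
    have [measurable]: "(\<lambda>p. snd (snd p) k) \<in> borel_measurable (borel \<Otimes>\<^sub>M borel \<Otimes>\<^sub>M exp_clocks)"
      by (rule measurable_compose[OF _ measurable_clock]) measurable
    show "(\<lambda>p. y k * ennreal (snd (snd p) k) * indicator {c<..fst (snd p)} (x k)) \<in>
        borel_measurable (borel \<Otimes>\<^sub>M borel \<Otimes>\<^sub>M exp_clocks)"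
      unfolding indicator_def greaterThanAtMost_iff by measurable
  qed simp
  define Q where "Q c p \<longleftrightarrow>
      emeasure (holding_measure x y (snd (snd p))) {c<..fst (snd p)} \<le> ennreal (fst p)"
    for c :: real and p :: "real \<times> real \<times> (int \<Rightarrow> real)"
  have [measurable]: "Measurable.pred (borel \<Otimes>\<^sub>M borel \<Otimes>\<^sub>M exp_clocks) (Q c)" for c
    unfolding Q_def by measurable
  have "(case p of (t, z, \<zeta>) \<Rightarrow> Z_left x y \<zeta> z t) \<le> c \<longleftrightarrow>
      (if \<forall>N::nat. Q (- real N) p then Inf (UNIV :: real set) \<le> c else Q c p)" for p
  proof -
    obtain t z \<zeta> where p: "p = (t, z, \<zeta>)" by (cases p) auto
    let ?S = "{z'. emeasure (holding_measure x y \<zeta>) {z'<..z} \<le> ennreal t}"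
    have "Inf ?S \<le> c \<longleftrightarrow> (if \<forall>N::nat. - real N \<in> ?S then Inf (UNIV :: real set) \<le> c else c \<in> ?S)"
      by (rule Inf_upward_closed_le_iff)
         (erule Z_left_set_mono, assumption, erule Z_left_set_closed, use Z_left_set_self in blast)
    then show ?thesis
      unfolding p Q_def Z_left_def by simp
  qed
  then show "{w \<in> space (borel \<Otimes>\<^sub>M borel \<Otimes>\<^sub>M exp_clocks). (case w of (t, z, \<zeta>) \<Rightarrow> Z_left x y \<zeta> z t) \<le> c}
      \<in> sets (borel \<Otimes>\<^sub>M borel \<Otimes>\<^sub>M exp_clocks)"
    by simp
qed

lemma measurable_Z_left [measurable (raw)]:
  assumes [measurable]: "f \<in> borel_measurable M" "g \<in> borel_measurable M" "c \<in> measurable M exp_clocks"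
  shows "(\<lambda>w. Z_left x y (c w) (g w) (f w)) \<in> borel_measurable M"
proof -
  have "(\<lambda>w. (f w, g w, c w)) \<in> measurable M (borel \<Otimes>\<^sub>M borel \<Otimes>\<^sub>M exp_clocks)" by measurable
  from measurable_compose[OF this borel_measurable_Z_left] show ?thesis by simp
qed

lemma measurable_Z_right [measurable (raw)]:
  assumes [measurable]: "f \<in> borel_measurable M" "g \<in> borel_measurable M" "c \<in> measurable M exp_clocks"
  shows "(\<lambda>w. Z_right x y (c w) (g w) (f w)) \<in> borel_measurable M"
  unfolding Z_right_eq_Z_left by measurable

section \<open>Enumerated trap environments\<close>

lemma env_sets: "A \<in> sets env_space \<longleftrightarrow> A \<in> sets borel \<and> A \<subseteq> env_set"
proof -
  have "open env_set" unfolding env_set_def by (intro open_Times) auto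
  then show ?thesis
    unfolding env_space_def by (subst sets_restrict_space_iff) auto
qed

lemma space_env_space [simp]: "space env_space = env_set"
  by (simp add: env_space_def space_restrict_space)

lemma atLeast_ennreal_pos: "0 < \<epsilon> \<Longrightarrow> ennreal \<epsilon> \<le> b \<Longrightarrow> 0 < b"
  by (metis ennreal_less_zero_iff order.strict_trans2)

locale enumerated_env =
  fixes x :: "int \<Rightarrow> real" and y :: "int \<Rightarrow> ennreal" and W :: "(real \<times> ennreal) measure"
  assumes enumerates: "enumerates x y W"
begin

lemma W_eq: "W = distr (count_space UNIV) env_space (\<lambda>k. (x k, y k))"
  using enumerates by (simp add: enumerates_def)

lemma y_pos: "0 < y k"
  using enumerates by (simp add: enumerates_def)

lemma measurable_atoms: "(\<lambda>k. (x k, y k)) \<in> measurable (count_space UNIV) env_space"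
  using y_pos by (auto simp: measurable_def env_set_def)

lemma sets_W [simp, measurable_cong]: "sets W = sets env_space"
  by (simp add: W_eq)

lemma nn_integral_env:
  assumes "f \<in> borel_measurable env_space"
  shows "(\<integral>\<^sup>+p. f p \<partial>W) = (\<integral>\<^sup>+k. f (x k, y k) \<partial>count_space UNIV)"
  unfolding W_eq by (subst nn_integral_distr[OF measurable_atoms]) (simp_all add: assms)

lemma lint_env:
  fixes f :: "real \<times> ennreal \<Rightarrow> real"
  assumes "f \<in> borel_measurable env_space"
  shows "(LINT p|W. f p) = (LINT k|count_space UNIV. f (x k, y k))"
  unfolding W_eq using measurable_atoms assms by (rule integral_distr)

lemma emeasure_env:
  assumes "A \<in> sets borel" "A \<subseteq> env_set"
  shows "emeasure W A = emeasure (count_space UNIV) {k. (x k, y k) \<in> A}"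
  unfolding W_eq using measurable_atoms env_sets[of A] assms
  by (subst emeasure_distr) (auto simp: vimage_def)

lemma truncated_depth_eq:
  "truncated_depth W L \<epsilon> =
    (\<integral>\<^sup>+k. y k * indicator ({-L..L} \<times> {0<..<ennreal \<epsilon>}) (x k, y k) \<partial>count_space UNIV)"
proof -
  have "{-L..L} \<times> {0<..<ennreal \<epsilon>} \<in> sets borel"
    by (simp add: borel_Times)
  then have "(\<lambda>p. snd p * indicator ({-L..L} \<times> {0<..<ennreal \<epsilon>}) p) \<in> borel_measurable borel"
    by (intro borel_measurable_times_ennreal borel_measurable_indicator
        borel_measurable_continuous_onI continuous_intros) auto
  then show ?thesis
    unfolding truncated_depth_def
    by (subst nn_integral_env) (simp_all only: env_space_def measurable_restrict_space1 fst_conv snd_conv)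
qed

end

text \<open>A closed half-line of depths is compact as a closed subset of the compact space
  \<open>ennreal\<close>. With the Radon property this leaves only finitely many deep traps in a
  window.\<close>

lemma compact_window: "compact ({-L..L::real} \<times> {c::ennreal..})"
  using compact_Times[OF compact_Icc, of "{c::ennreal..}"]
  by (metis closed_atLeast closed_Int_compact compact_UNIV inf_top_right)

text \<open>Only what the path analysis needs, in terms of real depths and without the point
  measure. The conditions are symmetric under reflection of space, so every result on right-directed
  processes can be instantiated for the reflected environment.\<close>

locale trap_data =
  fixes x :: "int \<Rightarrow> real" and d :: "int \<Rightarrow> real"
  assumes inj_x: "inj x"
    and d_pos: "0 < d k"
    and d_summable: "d summable_on {k. \<bar>x k\<bar> \<le> L}"
    and deep_right: "\<exists>\<epsilon>>0. \<forall>L. infinite {k. L \<le> x k \<and> \<epsilon> \<le> d k}"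
    and deep_left: "\<exists>\<epsilon>>0. \<forall>L. infinite {k. x k \<le> L \<and> \<epsilon> \<le> d k}"

locale trap_env = enumerated_env +
  assumes W_trap: "W \<in> trap_envs"
begin

lemma y_finite: "y k < \<infinity>"
proof -
  have "emeasure W (UNIV \<times> {\<infinity>}) = 0" using W_trap by (simp add: trap_envs_def)
  then have "emeasure (count_space UNIV) {k. y k = \<infinity>} = 0"
    by (subst (asm) emeasure_env) (auto simp: env_set_def borel_Times)
  then show ?thesis by (auto simp: emeasure_count_space_eq_0 less_top[symmetric])
qed

definition d where "d k = enn2real (y k)"

lemma y_eq: "y k = ennreal (d k)"
  using y_finite by (simp add: d_def)

lemma d_pos': "0 < d k"
  using y_pos[of k] y_finite[of k] by (simp add: d_def enn2real_positive_iff)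

lemma le_y_iff: "ennreal \<epsilon> \<le> y k \<longleftrightarrow> \<epsilon> \<le> d k"
  by (subst y_eq, rule ennreal_le_iff, rule less_imp_le, rule d_pos')

lemma finite_deep:
  assumes "0 < \<epsilon>"
  shows "finite {k. \<bar>x k\<bar> \<le> L \<and> \<epsilon> \<le> d k}"
proof -
  let ?K = "{-L..L} \<times> {ennreal \<epsilon>..}"
  have K: "compact ?K" "?K \<subseteq> env_set"
    using atLeast_ennreal_pos[OF assms] by (auto simp: env_set_def compact_window)
  then have "emeasure W ?K < \<infinity>" using W_trap by (simp add: trap_envs_def)
  then have "emeasure (count_space UNIV) {k. (x k, y k) \<in> ?K} < \<infinity>"
    using K by (subst (asm) emeasure_env) (auto intro: borel_compact)
  moreover have "{k. (x k, y k) \<in> ?K} = {k. \<bar>x k\<bar> \<le> L \<and> \<epsilon> \<le> d k}"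
    unfolding mem_Times_iff fst_conv snd_conv atLeast_iff le_y_iff atLeastAtMost_iff abs_le_iff by auto
  ultimately show ?thesis by (simp add: emeasure_count_space split: if_splits)
qed

lemma truncated_depth_d:
  "truncated_depth W L \<epsilon> = (\<integral>\<^sup>+k. ennreal (d k) \<partial>count_space {k. \<bar>x k\<bar> \<le> L \<and> d k < \<epsilon>})"
  unfolding truncated_depth_eq
  using d_pos'
  by (subst nn_integral_count_space_indicator)
     (auto intro!: nn_integral_cong simp: y_eq ennreal_less_iff less_imp_le abs_le_iff split: split_indicator)

sublocale trap_data x d
proof
  show "inj x"
  proof (rule injI, rule ccontr)
    fix i j assume ij: "x i = x j" "i \<noteq> j"
    have "emeasure W ({x i} \<times> {0<..}) \<le> (SUP x. emeasure W ({x} \<times> {0<..}))"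
      by (rule SUP_upper) simp
    also have "\<dots> = 1" using W_trap by (simp add: trap_envs_def)
    finally have le: "emeasure (count_space UNIV) {k. x k = x i} \<le> 1"
      by (subst (asm) emeasure_env) (auto simp: env_set_def borel_Times y_pos)
    have "2 = emeasure (count_space UNIV) {i, j}"
      using ij by (subst emeasure_count_space_finite) auto
    also have "\<dots> \<le> emeasure (count_space UNIV) {k. x k = x i}"
      using ij by (intro emeasure_mono) auto
    also note le
    finally show False by simp
  qed
  show "0 < d k" for k by (rule d_pos')
  show "d summable_on {k. \<bar>x k\<bar> \<le> L}" for L
  proof -
    \<comment> \<open>The split at depth 1 is arbitrary: the shallow part is summable by the
      truncated depth, the deep part is finite by the Radon property.\<close>
    let ?A = "{k. \<bar>x k\<bar> \<le> L \<and> d k < 1}" and ?B = "{k. \<bar>x k\<bar> \<le> L \<and> 1 \<le> d k}"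
    have eq: "{k. \<bar>x k\<bar> \<le> L} = ?A \<union> ?B"
      by auto
    have "integrable (count_space {k. \<bar>x k\<bar> \<le> L \<and> d k < 1}) d"
    proof (rule integrableI_nn_integral_finite)
      have "truncated_depth W L 1 < \<infinity>" using W_trap by (simp add: trap_envs_def)
      then show "(\<integral>\<^sup>+k. ennreal (d k) \<partial>count_space {k. \<bar>x k\<bar> \<le> L \<and> d k < 1})
          = ennreal (enn2real (truncated_depth W L 1))"
        by (simp add: truncated_depth_d)
    qed (simp_all add: AE_count_space d_pos' less_imp_le)
    then have "d summable_on ?A \<union> ?B"
      using finite_deep[of 1 L]
      by (intro summable_on_Un_disjoint) (auto simp: integrable_count_space_real_iff)
    then show ?thesis unfolding eq .
  qed
  have inf: "\<exists>\<epsilon>\<^sub>0::real. 0 < \<epsilon>\<^sub>0 \<and> (\<forall>L::real.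
        emeasure W ({..-L} \<times> {ennreal \<epsilon>\<^sub>0..<\<infinity>}) = \<infinity> \<and>
        emeasure W ({L..} \<times> {ennreal \<epsilon>\<^sub>0..<\<infinity>}) = \<infinity>)"
    using W_trap by (simp add: trap_envs_def)
  then obtain \<epsilon> where \<epsilon>: "0 < \<epsilon>" "\<And>L. emeasure W ({..-L} \<times> {ennreal \<epsilon>..<\<infinity>}) = \<infinity>"
    "\<And>L. emeasure W ({L..} \<times> {ennreal \<epsilon>..<\<infinity>}) = \<infinity>" by blast
  have *: "infinite {k. x k \<in> A \<and> \<epsilon> \<le> d k}"
    if A: "emeasure W (A \<times> {ennreal \<epsilon>..<\<infinity>}) = \<infinity>" "A \<in> sets borel" for A
  proof
    assume fin: "finite {k. x k \<in> A \<and> \<epsilon> \<le> d k}"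
    have "A \<times> {ennreal \<epsilon>..<\<infinity>} \<subseteq> env_set" using atLeast_ennreal_pos[OF \<epsilon>(1)] by (auto simp: env_set_def)
    then have "emeasure (count_space UNIV) {k. (x k, y k) \<in> A \<times> {ennreal \<epsilon>..<\<infinity>}} = \<infinity>"
      using A by (subst emeasure_env[symmetric]) (auto simp: borel_Times)
    moreover have "{k. (x k, y k) \<in> A \<times> {ennreal \<epsilon>..<\<infinity>}} = {k. x k \<in> A \<and> \<epsilon> \<le> d k}"
      unfolding mem_Times_iff fst_conv snd_conv atLeastLessThan_iff le_y_iff using y_finite by blast
    ultimately show False using fin by simp
  qed
  have "infinite {k. L \<le> x k \<and> \<epsilon> \<le> d k}" for L
    using *[OF \<epsilon>(3)[of L]] by simp
  then show "\<exists>\<epsilon>>0. \<forall>L. infinite {k. L \<le> x k \<and> \<epsilon> \<le> d k}"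
    using \<epsilon>(1) by blast
  have "infinite {k. x k \<le> L \<and> \<epsilon> \<le> d k}" for L
    using *[OF \<epsilon>(2)[of "- L"]] by simp
  then show "\<exists>\<epsilon>>0. \<forall>L. infinite {k. x k \<le> L \<and> \<epsilon> \<le> d k}"
    using \<epsilon>(1) by blast
qed

end

section \<open>Occupation of the traps\<close>

lemma nn_integral_count_space_infsum:
  fixes f :: "'a \<Rightarrow> real"
  assumes "f summable_on A" "\<And>k. k \<in> A \<Longrightarrow> 0 \<le> f k"
  shows "(\<integral>\<^sup>+k. ennreal (f k) \<partial>count_space A) = ennreal (infsum f A)"
  unfolding infsum_eq_lint_count_space
  by (rule nn_integral_eq_integral) (use assms in \<open>auto simp: integrable_count_space_real_iff AE_count_space\<close>)

text \<open>
  For a particle started in \<open>x\<^sub>l\<close> these are \<open>\<tau>[x\<^sub>l, x\<^sub>k)\<close> and the integral of \<open>h\<close> over the stay in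
  \<open>x\<^sub>k\<close>, rescaled to unit time.
\<close>

definition arrival :: "(int \<Rightarrow> real) \<Rightarrow> (int \<Rightarrow> real) \<Rightarrow> int \<Rightarrow> int \<Rightarrow> (int \<Rightarrow> real) \<Rightarrow> real" where
  "arrival x d l k \<zeta> = (\<Sum>\<^sub>\<infinity>j\<in>{j. x l \<le> x j \<and> x j < x k}. d j * \<zeta> j)"

definition occ :: "(int \<Rightarrow> real) \<Rightarrow> (int \<Rightarrow> real) \<Rightarrow> (real \<times> real \<Rightarrow> real) \<Rightarrow> int \<Rightarrow> int \<Rightarrow> (int \<Rightarrow> real) \<Rightarrow> real" where
  "occ x d h l k \<zeta> = (if x l \<le> x k
     then (LINT r:{0..<1}|lborel. d k * \<zeta> k * h (arrival x d l k \<zeta> + d k * \<zeta> k * r, x k)) else 0)"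

lemma nn_integral_holding_times:
  assumes d: "\<And>k. 0 \<le> d k"
  shows "(\<integral>\<^sup>+\<zeta>. (\<integral>\<^sup>+k. ennreal (d k * \<zeta> k) \<partial>count_space A) \<partial>exp_clocks) = (\<integral>\<^sup>+k. ennreal (d k) \<partial>count_space A)"
proof -
  interpret sigma_finite_measure "count_space A"
    by (rule sigma_finite_measure_count_space_countable) simp
  interpret p: pair_sigma_finite exp_clocks "count_space A" ..
  have "(\<integral>\<^sup>+\<zeta>. (\<integral>\<^sup>+k. ennreal (d k * \<zeta> k) \<partial>count_space A) \<partial>exp_clocks) =
      (\<integral>\<^sup>+k. (\<integral>\<^sup>+\<zeta>. ennreal (d k * \<zeta> k) \<partial>exp_clocks) \<partial>count_space A)"
    by (rule p.Fubini'[symmetric]) (rule measurable_split_countable; simp)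
  also have "\<dots> = (\<integral>\<^sup>+k. ennreal (d k) \<partial>count_space A)"
    by (intro nn_integral_cong) (simp add: ennreal_mult' nn_integral_cmult nn_integral_clock d)
  finally show ?thesis .
qed

context trap_data
begin

abbreviation H :: "(int \<Rightarrow> real) \<Rightarrow> real set \<Rightarrow> ennreal" where
  "H \<zeta> \<equiv> emeasure (holding_measure x (\<lambda>k. ennreal (d k)) \<zeta>)"

abbreviation Zr :: "(int \<Rightarrow> real) \<Rightarrow> int \<Rightarrow> real \<Rightarrow> real" where
  "Zr \<zeta> l \<equiv> Z_right x (\<lambda>k. ennreal (d k)) \<zeta> (x l)"

text \<open>Almost sure properties under which a path can be analysed for fixed clocks; integer
  windows keep them countable in number. The last clause bounds the set in the supremum that defines
  \<open>Z_right\<close>, so that this supremum is a genuine one at every time.\<close>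

definition good :: "(int \<Rightarrow> real) \<Rightarrow> bool" where
  "good \<zeta> \<longleftrightarrow> (\<forall>k. 0 < \<zeta> k) \<and> (\<forall>N::nat. (\<lambda>k. d k * \<zeta> k) summable_on {k. \<bar>x k\<bar> \<le> real N}) \<and>
     (\<forall>N::nat. H \<zeta> {real N..} = \<infinity>)"

lemma H_eq:
  assumes "A \<in> sets borel"
  shows "H \<zeta> A = (\<integral>\<^sup>+k. ennreal (d k * \<zeta> k) \<partial>count_space {k. x k \<in> A})"
  using assms d_pos
  by (subst nn_integral_count_space_indicator)
     (auto simp: emeasure_holding_measure ennreal_mult' less_imp_le intro!: nn_integral_cong split: split_indicator)

lemma AE_good: "AE \<zeta> in exp_clocks. good \<zeta>"
proof -
  have 2: "AE \<zeta> in exp_clocks. (\<lambda>k. d k * \<zeta> k) summable_on {k. \<bar>x k\<bar> \<le> real N}" for N :: nat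
  proof -
    let ?K = "{k. \<bar>x k\<bar> \<le> real N}"
    have "(\<integral>\<^sup>+\<zeta>. (\<integral>\<^sup>+k. ennreal (d k * \<zeta> k) \<partial>count_space ?K) \<partial>exp_clocks) = (\<integral>\<^sup>+k. ennreal (d k) \<partial>count_space ?K)"
      by (rule nn_integral_holding_times) (rule less_imp_le[OF d_pos])
    also have "\<dots> < \<infinity>"
    proof -
      have "integrable (count_space ?K) d"
        by (simp add: integrable_count_space_real_iff d_summable)
      then show ?thesis
        by (simp add: integrable_iff_bounded less_imp_le[OF d_pos])
    qed
    finally have "AE \<zeta> in exp_clocks. (\<integral>\<^sup>+k. ennreal (d k * \<zeta> k) \<partial>count_space ?K) \<noteq> \<infinity>"
      by (intro nn_integral_PInf_AE borel_measurable_nn_integral_count_space) auto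
    with clock_pos show ?thesis
    proof eventually_elim
      fix \<zeta> :: "int \<Rightarrow> real"
      assume "\<forall>k. 0 < \<zeta> k" "(\<integral>\<^sup>+k. ennreal (d k * \<zeta> k) \<partial>count_space ?K) \<noteq> \<infinity>"
      then have "integrable (count_space ?K) (\<lambda>k. d k * \<zeta> k)"
        using d_pos by (simp add: integrable_iff_bounded abs_mult less_imp_le less_top)
      then show "(\<lambda>k. d k * \<zeta> k) summable_on ?K"
        by (simp add: integrable_count_space_real_iff)
    qed
  qed
  have 3: "AE \<zeta> in exp_clocks. H \<zeta> {real N..} = \<infinity>" for N :: nat
  proof -
    obtain \<epsilon> where \<epsilon>: "0 < \<epsilon>" "infinite {k. real N \<le> x k \<and> \<epsilon> \<le> d k}"
      using deep_right by blast
    let ?J = "{k. real N \<le> x k \<and> \<epsilon> \<le> d k}"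
    \<comment> \<open>Infinitely many traps to the right have depth at least \<epsilon>, and already
      their holding times have an infinite sum.\<close>
    have "AE \<zeta> in exp_clocks. (\<integral>\<^sup>+k. ennreal (\<epsilon> * \<zeta> k) \<partial>count_space ?J) = \<infinity>"
      using \<epsilon> by (intro clocks_sum_infinite)
    with clock_pos show ?thesis
    proof eventually_elim
      fix \<zeta> :: "int \<Rightarrow> real"
      assume \<zeta>: "\<forall>k. 0 < \<zeta> k" "(\<integral>\<^sup>+k. ennreal (\<epsilon> * \<zeta> k) \<partial>count_space ?J) = \<infinity>"
      have "(\<integral>\<^sup>+k. ennreal (\<epsilon> * \<zeta> k) \<partial>count_space ?J) \<le> (\<integral>\<^sup>+k. ennreal (d k * \<zeta> k) \<partial>count_space ?J)"
        using \<zeta>(1) by (intro nn_integral_mono) (auto intro!: ennreal_leI mult_right_mono simp: less_imp_le)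
      also have "\<dots> \<le> H \<zeta> {real N..}"
        unfolding H_eq[OF borel_closed[OF closed_atLeast]]
        by (subst (1 2) nn_integral_count_space_indicator)
           (auto intro!: nn_integral_mono split: split_indicator)
      finally show "H \<zeta> {real N..} = \<infinity>" using \<zeta>(2) by (simp add: top_unique)
    qed
  qed
  show ?thesis
    using clock_pos 2[unfolded atomize_all] 3
    unfolding good_def by (auto simp: AE_conj_iff AE_all_countable)
qed

section \<open>The path of one particle for fixed good clocks\<close>

context
  fixes \<zeta> :: "int \<Rightarrow> real"
  assumes good: "good \<zeta>"
begin

lemma hold_pos: "0 < d k * \<zeta> k"
  using good d_pos by (simp add: good_def)

lemma hold_summable:
  assumes "S \<subseteq> {k. a \<le> x k \<and> x k \<le> b}"
  shows "(\<lambda>k. d k * \<zeta> k) summable_on S"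
proof -
  obtain N :: nat where N: "max \<bar>a\<bar> \<bar>b\<bar> \<le> real N" using real_arch_simple by blast
  have "(\<lambda>k. d k * \<zeta> k) summable_on {k. \<bar>x k\<bar> \<le> real N}" using good by (simp add: good_def)
  then show ?thesis by (rule summable_on_subset_banach) (use assms N in auto)
qed

lemma H_interval:
  assumes "A \<in> sets borel" "A \<subseteq> {a..b}"
  shows "H \<zeta> A = ennreal (\<Sum>\<^sub>\<infinity>k\<in>{k. x k \<in> A}. d k * \<zeta> k)"
proof -
  have "(\<lambda>k. d k * \<zeta> k) summable_on {k. x k \<in> A}"
    by (rule hold_summable[of _ a b]) (use assms in auto)
  then show ?thesis
    unfolding H_eq[OF assms(1)] infsum_eq_lint_count_space
    by (intro nn_integral_eq_integral) (auto simp: integrable_count_space_real_iff less_imp_le[OF hold_pos])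
qed

lemma arrival_nonneg: "0 \<le> arrival x d l k \<zeta>"
  unfolding arrival_def by (intro infsum_nonneg less_imp_le[OF hold_pos])

lemma H_arrival: "H \<zeta> {x l..<x k} = ennreal (arrival x d l k \<zeta>)"
  unfolding arrival_def by (subst H_interval[of _ "x l" "x k"]) auto

lemma H_arrival_Suc:
  assumes "x l \<le> x k"
  shows "H \<zeta> {x l..x k} = ennreal (arrival x d l k \<zeta> + d k * \<zeta> k)"
proof -
  have "H \<zeta> {x l..x k} = H \<zeta> {x l..<x k} + H \<zeta> {x k}"
    using assms by (subst plus_emeasure) (auto intro!: arg_cong[where f="H \<zeta>"])
  also have "{k'. x k' \<in> {x k}} = {k}" using inj_x by (auto dest: injD)
  then have "H \<zeta> {x k} = ennreal (d k * \<zeta> k)"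
    by (subst H_interval[of _ "x k" "x k"]) auto
  finally show ?thesis
    by (simp add: H_arrival ennreal_plus[symmetric] arrival_nonneg less_imp_le[OF hold_pos] del: ennreal_plus)
qed

lemma H_mono: "a \<le> b \<Longrightarrow> H \<zeta> {x l..<a} \<le> H \<zeta> {x l..<b}"
  by (intro emeasure_mono) auto

lemma H_exceeds: "\<exists>N::nat. ennreal t < H \<zeta> {x l..<real N}"
proof -
  have "(SUP N::nat. H \<zeta> {x l..<real N}) = H \<zeta> (\<Union>N::nat. {x l..<real N})"
    by (intro SUP_emeasure_incseq) (auto simp: incseq_def)
  also have "(\<Union>N::nat. {x l..<real N}) = {x l..}"
    using reals_Archimedean2 by auto
  also obtain M :: nat where "x l \<le> real M" using real_arch_simple by blast
  then have "H \<zeta> {real M..} \<le> H \<zeta> {x l..}" by (intro emeasure_mono) auto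
  then have "H \<zeta> {x l..} = \<infinity>" using good by (simp add: good_def top_unique)
  finally have "(SUP N::nat. H \<zeta> {x l..<real N}) = \<infinity>" .
  then have "ennreal t < (SUP N::nat. H \<zeta> {x l..<real N})"
    by (simp only: infinity_ennreal_def ennreal_less_top)
  then show ?thesis by (simp add: less_SUP_iff)
qed

text \<open>Together with \<open>Zr_least\<close> this says that the path is the generalised inverse
  of the accumulated holding time. The analysis of paths below relies mainly on these two bounds on
  the supremum.\<close>

lemma Zr_upper: "z \<in> {z'. H \<zeta> {x l..<z'} \<le> ennreal t} \<Longrightarrow> z \<le> Zr \<zeta> l t"
proof -
  assume z: "z \<in> {z'. H \<zeta> {x l..<z'} \<le> ennreal t}"
  obtain N :: nat where N: "ennreal t < H \<zeta> {x l..<real N}" using H_exceeds by blast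
  have "w \<le> real N" if "H \<zeta> {x l..<w} \<le> ennreal t" for w
    using that N H_mono[of "real N" w l] by (meson leD le_cases order_trans)
  then have "bdd_above {z'. H \<zeta> {x l..<z'} \<le> ennreal t}" by (intro bdd_aboveI[of _ "real N"]) simp
  with z show ?thesis unfolding Z_right_def by (rule cSup_upper)
qed

lemma Zr_least:
  assumes "ennreal t < H \<zeta> {x l..<z}"
  shows "Zr \<zeta> l t \<le> z"
  unfolding Z_right_def
proof (rule cSup_least)
  show "{z'. H \<zeta> {x l..<z'} \<le> ennreal t} \<noteq> {}" by (auto intro!: exI[of _ "x l"])
  show "w \<le> z" if "w \<in> {z'. H \<zeta> {x l..<z'} \<le> ennreal t}" for w
    using that assms H_mono[of z w l] by (auto intro: leI dest: leD order_trans less_imp_le)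
qed

text \<open>Below a level \<open>b\<close> beyond the current position the accumulated holding time
  is finite and strictly above \<open>t\<close>, hence still above slightly later times;
  monotonicity gives the other half. Right continuity lets the path be recovered from its values on
  a countable grid.\<close>

lemma Zr_right_continuous:
  assumes "0 \<le> t"
  shows "(Zr \<zeta> l \<longlongrightarrow> Zr \<zeta> l t) (at_right t)"
proof (rule order_tendstoI)
  have mono: "Zr \<zeta> l t \<le> Zr \<zeta> l s" if "t \<le> s" for s
    unfolding Z_right_def
  proof (rule cSup_least)
    show "{z'. H \<zeta> {x l..<z'} \<le> ennreal t} \<noteq> {}" by (auto intro!: exI[of _ "x l"])
    fix w assume "w \<in> {z'. H \<zeta> {x l..<z'} \<le> ennreal t}"
    then have "w \<in> {z'. H \<zeta> {x l..<z'} \<le> ennreal s}"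
      using ennreal_leI[OF that] by (auto intro: order_trans)
    then show "w \<le> Sup {z'. H \<zeta> {x l..<z'} \<le> ennreal s}"
      using Zr_upper[of w l s] by (simp add: Z_right_def)
  qed
  show "eventually (\<lambda>s. a < Zr \<zeta> l s) (at_right t)" if "a < Zr \<zeta> l t" for a
    using eventually_at_right_less[of t] by eventually_elim (use mono that in \<open>meson less_imp_le less_le_trans\<close>)
  show "eventually (\<lambda>s. Zr \<zeta> l s < a) (at_right t)" if "Zr \<zeta> l t < a" for a
  proof -
    obtain b where b: "Zr \<zeta> l t < b" "b < a" using dense[OF \<open>Zr \<zeta> l t < a\<close>] by blast
    have "\<not> H \<zeta> {x l..<b} \<le> ennreal t" using Zr_upper[of b l t] b by auto
    then have "ennreal t < H \<zeta> {x l..<b}" by simp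
    also have H: "H \<zeta> {x l..<b} = ennreal (\<Sum>\<^sub>\<infinity>k\<in>{k. x k \<in> {x l..<b}}. d k * \<zeta> k)" (is "_ = ennreal ?c")
      by (rule H_interval[of _ "x l" b]) auto
    finally have "t < ?c" using assms by (simp add: ennreal_less_iff)
    then have "eventually (\<lambda>s. s < ?c) (at_right t)"
      by (intro order_tendstoD(2)[OF tendsto_ident_at])
    moreover have "eventually (\<lambda>s. t < s) (at_right t)" by (rule eventually_at_right_less)
    ultimately show ?thesis
    proof eventually_elim
      fix s assume "s < ?c" "t < s"
      then have "ennreal s < H \<zeta> {x l..<b}" unfolding H using assms by (intro ennreal_lessI) auto
      from Zr_least[OF this] b show "Zr \<zeta> l s < a" by simp
    qed
  qed
qed

definition slot :: "int \<Rightarrow> int \<Rightarrow> real set" where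
  "slot l k = {arrival x d l k \<zeta>..<arrival x d l k \<zeta> + d k * \<zeta> k}"

lemma Zr_slot:
  assumes "x l \<le> x k" "t \<in> slot l k"
  shows "Zr \<zeta> l t = x k"
proof (rule antisym)
  have t: "arrival x d l k \<zeta> \<le> t" "t < arrival x d l k \<zeta> + d k * \<zeta> k"
    using assms by (auto simp: slot_def)
  show "x k \<le> Zr \<zeta> l t" by (rule Zr_upper) (use t in \<open>simp add: H_arrival ennreal_leI\<close>)
  show "Zr \<zeta> l t \<le> x k"
  proof (rule dense_ge)
    \<comment> \<open>The intervals in \<open>Z_right\<close> exclude their right end, so the
      holding time of \<open>x k\<close> counts only for \<open>z\<close> strictly beyond it; the
      bound is obtained for all such \<open>z\<close>.\<close>
    fix z assume z: "x k < z"
    have "ennreal t < H \<zeta> {x l..x k}"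
      unfolding H_arrival_Suc[OF assms(1)] using t arrival_nonneg[of l k] by (intro ennreal_lessI) auto
    also have "\<dots> \<le> H \<zeta> {x l..<z}" using z by (intro emeasure_mono) auto
    finally show "Zr \<zeta> l t \<le> z" by (rule Zr_least)
  qed
qed

text \<open>A common time would place the particle in two locations at once, and distinct indices
  have distinct locations. This makes the slots disjoint without comparing their end points.\<close>

lemma slot_unique: "x l \<le> x k \<Longrightarrow> x l \<le> x k' \<Longrightarrow> t \<in> slot l k \<Longrightarrow> t \<in> slot l k' \<Longrightarrow> k = k'"
  using Zr_slot[of l k t] Zr_slot[of l k' t] inj_x by (auto dest: injD)

text \<open>The slots of the traps in a window have the total length of the interval that they fill.\<close>

lemma AE_slot: "AE t in lborel. 0 \<le> t \<longrightarrow> (\<exists>k. x l \<le> x k \<and> t \<in> slot l k)"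
proof -
  have "AE t in lborel. 0 \<le> t \<and> ennreal t < H \<zeta> {x l..<real N} \<longrightarrow> (\<exists>k. x l \<le> x k \<and> t \<in> slot l k)" for N :: nat
  proof -
    let ?S = "{k. x k \<in> {x l..<real N}}"
    define b where "b = (\<Sum>\<^sub>\<infinity>k\<in>?S. d k * \<zeta> k)"
    have b: "H \<zeta> {x l..<real N} = ennreal b" "0 \<le> b"
      unfolding b_def by (rule H_interval[of _ "x l" "real N"], auto intro!: infsum_nonneg less_imp_le[OF hold_pos])
    let ?U = "\<Union>k\<in>?S. slot l k"
    have sub: "?U \<subseteq> {0..<b}"
    proof
      fix t assume "t \<in> ?U"
      then obtain k where k: "x l \<le> x k" "x k < real N" "t \<in> slot l k" by auto
      have "H \<zeta> {x l..x k} \<le> H \<zeta> {x l..<real N}" using k by (intro emeasure_mono) auto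
      then have "arrival x d l k \<zeta> + d k * \<zeta> k \<le> b"
        using b by (simp add: H_arrival_Suc[OF k(1)] ennreal_le_iff)
      then show "t \<in> {0..<b}" using k(3) arrival_nonneg[of l k] by (auto simp: slot_def)
    qed
    have "emeasure lborel ?U = (\<integral>\<^sup>+k. emeasure lborel (slot l k) \<partial>count_space ?S)"
      by (rule emeasure_UN_countable) (auto simp: disjoint_family_on_def slot_def[symmetric] dest: slot_unique, simp add: slot_def)
    also have "\<dots> = H \<zeta> {x l..<real N}"
      by (subst H_eq) (auto intro!: nn_integral_cong simp: slot_def less_imp_le[OF hold_pos])
    finally have U: "emeasure lborel ?U = ennreal b" by (simp add: b)
    have meas: "?U \<in> sets lborel" by (intro sets.countable_UN'') (auto simp: slot_def)
    \<comment> \<open>The union and the interval containing it have the same length. This length is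
      finite because holding times are summable in a window, so the lengths may be subtracted and a
      null set remains.\<close>
    have "emeasure lborel ({0..<b} - ?U) = emeasure lborel {0..<b} - emeasure lborel ?U"
      using sub meas U by (intro emeasure_Diff) auto
    then have "emeasure lborel ({0..<b} - ?U) = 0" using b U by simp
    then have "AE t in lborel. t \<notin> {0..<b} - ?U"
      using meas by (intro AE_not_in) (auto simp: null_sets_def)
    then show ?thesis by eventually_elim (auto simp: b ennreal_less_iff)
  qed
  then have "AE t in lborel. \<forall>N::nat. 0 \<le> t \<and> ennreal t < H \<zeta> {x l..<real N} \<longrightarrow> (\<exists>k. x l \<le> x k \<and> t \<in> slot l k)"
    unfolding AE_all_countable by blast
  then show ?thesis by eventually_elim (use H_exceeds in blast)
qed

text \<open>Almost every time belongs to exactly one slot, so the time integral splits into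
  integrals over slots. The affine substitution that maps a slot to \<open>{0..<1}\<close> turns
  each of them into \<open>occ\<close>, whose domain of integration no longer depends on the clocks;
  the exchange of sum and integral is dominated by \<open>B\<close> times the summable holding
  times.\<close>

lemma occupation:
  fixes h :: "real \<times> real \<Rightarrow> real"
  assumes h [measurable]: "h \<in> borel_measurable borel"
    and bound: "\<And>p. \<bar>h p\<bar> \<le> B"
    and supp: "\<And>t z. L < \<bar>z\<bar> \<Longrightarrow> h (t, z) = 0"
  shows "(LINT t:{0..}|lborel. h (t, Zr \<zeta> l t)) = (\<Sum>\<^sub>\<infinity>k\<in>{k. \<bar>x k\<bar> \<le> L}. occ x d h l k \<zeta>)"
proof -
  let ?K = "{k. \<bar>x k\<bar> \<le> L}"
  define g where "g k t = (if x l \<le> x k then indicator (slot l k) t * h (t, x k) else 0)" for k t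
  have [measurable]: "g k \<in> borel_measurable lborel" for k
  proof (cases "x l \<le> x k")
    case True
    have [measurable]: "slot l k \<in> sets borel" by (simp add: slot_def)
    have [measurable]: "(\<lambda>t. h (t, x k)) \<in> borel_measurable borel"
      by (rule measurable_compose[OF _ h]) (intro borel_measurable_Pair; simp)
    have "g k = (\<lambda>t. indicator (slot l k) t * h (t, x k))" using True by (simp add: g_def fun_eq_iff)
    then show ?thesis by simp
  next
    case False
    then have "g k = (\<lambda>t. 0)" by (simp add: g_def fun_eq_iff)
    then show ?thesis by simp
  qed
  interpret K: sigma_finite_measure "count_space ?K"
    by (rule sigma_finite_measure_count_space_countable) simp
  interpret p: pair_sigma_finite lborel "count_space ?K" ..
  have "(LINT t:{0..}|lborel. h (t, Zr \<zeta> l t)) = (LINT t|lborel. LINT k|count_space ?K. g k t)"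
    unfolding set_lebesgue_integral_def
  proof (rule integral_cong_AE)
    have [measurable]: "Zr \<zeta> l \<in> borel_measurable lborel"
      by (rule measurable_Z_right) (simp_all add: measurable_const)
    have "(\<lambda>t. h (t, Zr \<zeta> l t)) \<in> borel_measurable lborel"
      by (rule measurable_compose[OF _ h]) (intro borel_measurable_Pair; simp)
    then show "(\<lambda>t. indicator {0..} t *\<^sub>R h (t, Zr \<zeta> l t)) \<in> borel_measurable lborel"
      by measurable
    show "(\<lambda>t. LINT k|count_space ?K. g k t) \<in> borel_measurable lborel"
      by (rule borel_measurable_lint_count_space) auto
    show "AE t in lborel. indicator {0..} t *\<^sub>R h (t, Zr \<zeta> l t) = (LINT k|count_space ?K. g k t)"
      using AE_slot[of l]
    proof eventually_elim
      fix t assume t: "0 \<le> t \<longrightarrow> (\<exists>k. x l \<le> x k \<and> t \<in> slot l k)"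
      show "indicator {0..} t *\<^sub>R h (t, Zr \<zeta> l t) = (LINT k|count_space ?K. g k t)"
      proof (cases "0 \<le> t")
        case True
        then obtain k where k: "x l \<le> x k" "t \<in> slot l k" using t by blast
        have "g k' t = (if k' = k then h (t, x k) else 0)" for k'
        proof (cases "k' = k")
          case False
          then have "\<not> (x l \<le> x k' \<and> t \<in> slot l k')" using slot_unique[of l k k' t] k by blast
          then show ?thesis using False by (simp add: g_def)
        qed (use k in \<open>simp add: g_def\<close>)
        then have "(LINT k'|count_space ?K. g k' t) = (\<Sum>\<^sub>\<infinity>k'\<in>?K. if k' = k then h (t, x k) else 0)"
          by (simp add: infsum_eq_lint_count_space)
        also have "\<dots> = h (t, x k)"
        proof (cases "k \<in> ?K")
          case True
          then show ?thesis by (subst infsum_cong_neutral[of "{k}" ?K]) auto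
        next
          case False
          then have "(\<Sum>\<^sub>\<infinity>k'\<in>?K. if k' = k then h (t, x k) else 0) = 0"
            by (intro infsum_0) auto
          then show ?thesis using False supp by simp
        qed
        finally show ?thesis using True Zr_slot[OF k] by simp
      next
        case False
        have "g k t = 0" for k using False arrival_nonneg[of l k] by (auto simp: g_def slot_def)
        then show ?thesis using False by simp
      qed
    qed
  qed
  also have "\<dots> = (LINT k|count_space ?K. LINT t|lborel. g k t)"
  proof (rule p.Fubini_integral[symmetric], rule integrableI_bounded)
    show [measurable]: "(\<lambda>(t, k). g k t) \<in> borel_measurable (lborel \<Otimes>\<^sub>M count_space ?K)"
      by (rule measurable_split_countable) auto
    have B: "0 \<le> B" using bound[of undefined] by linarith
    have "(\<integral>\<^sup>+p. ennreal (norm (case p of (t, k) \<Rightarrow> g k t)) \<partial>(lborel \<Otimes>\<^sub>M count_space ?K)) =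
        (\<integral>\<^sup>+k. (\<integral>\<^sup>+t. ennreal \<bar>g k t\<bar> \<partial>lborel) \<partial>count_space ?K)"
      by (subst p.nn_integral_snd[symmetric]) (simp_all add: split_beta')
    also have "\<dots> \<le> (\<integral>\<^sup>+k. ennreal (B * (d k * \<zeta> k)) \<partial>count_space ?K)"
    proof (intro nn_integral_mono)
      fix k
      have "(\<integral>\<^sup>+t. ennreal \<bar>g k t\<bar> \<partial>lborel) \<le> (\<integral>\<^sup>+t. ennreal B * indicator (slot l k) t \<partial>lborel)"
        using bound B by (intro nn_integral_mono) (auto simp: g_def abs_mult ennreal_leI split: split_indicator)
      also have "\<dots> = ennreal (B * (d k * \<zeta> k))"
        using hold_pos[of k] B by (subst nn_integral_cmult_indicator) (auto simp: slot_def ennreal_mult)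
      finally show "(\<integral>\<^sup>+t. ennreal \<bar>g k t\<bar> \<partial>lborel) \<le> ennreal (B * (d k * \<zeta> k))" .
    qed
    also have "\<dots> < \<infinity>"
    proof -
      have "(\<lambda>k. B * (d k * \<zeta> k)) summable_on ?K"
        by (rule summable_on_cmult_right, rule hold_summable[where a="-L" and b=L]) auto
      then show ?thesis
        using B hold_pos by (subst nn_integral_count_space_infsum) (auto simp: less_imp_le)
    qed
    finally show "(\<integral>\<^sup>+p. ennreal (norm (case p of (t, k) \<Rightarrow> g k t)) \<partial>(lborel \<Otimes>\<^sub>M count_space ?K)) < \<infinity>" .
  qed
  also have "\<dots> = (\<Sum>\<^sub>\<infinity>k\<in>?K. occ x d h l k \<zeta>)"
    unfolding infsum_eq_lint_count_space
  proof (intro Bochner_Integration.integral_cong refl)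
    fix k
    let ?a = "arrival x d l k \<zeta>" and ?c = "d k * \<zeta> k"
    have "(LINT t|lborel. indicator (slot l k) t * h (t, x k)) =
        ?c * (LINT r|lborel. indicator (slot l k) (?a + ?c * r) * h (?a + ?c * r, x k))"
      using hold_pos[of k]
      by (subst lborel_integral_real_affine[where c="?c" and t="?a"]) auto
    also have "\<dots> = (LINT r:{0..<1}|lborel. ?c * h (?a + ?c * r, x k))"
      unfolding set_lebesgue_integral_def integral_mult_right_zero[symmetric]
    proof (intro Bochner_Integration.integral_cong refl)
      fix r
      have "?a + ?c * r \<in> slot l k \<longleftrightarrow> r \<in> {0..<1}"
      proof -
        have "0 \<le> c * r \<longleftrightarrow> 0 \<le> r" "c * r < c \<longleftrightarrow> r < 1" if "0 < c" for c :: real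
          using that by (simp_all add: zero_le_mult_iff mult_less_cancel_left2)
        from this[OF hold_pos[of k]] show ?thesis unfolding slot_def atLeastLessThan_iff by linarith
      qed
      then show "?c * (indicator (slot l k) (?a + ?c * r) * h (?a + ?c * r, x k)) =
          indicator {0..<1} r *\<^sub>R (?c * h (?a + ?c * r, x k))"
        by (simp add: indicator_def)
    qed
    finally show "(LINT t|lborel. g k t) = occ x d h l k \<zeta>"
      unfolding g_def occ_def by simp
  qed
  finally show ?thesis .
qed

end

end

section \<open>Expected occupation and truncation of shallow traps\<close>

text \<open>The stationary excess law of the exponential distribution is the distribution itself.\<close>

lemma exp_law_excess:
  fixes f :: "real \<Rightarrow> real"
  assumes f [measurable]: "f \<in> borel_measurable borel" and bound: "\<And>s. \<bar>f s\<bar> \<le> B"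
  shows "(LINT s|exp_law. s * (LINT r:{0..<1}|lborel. f (s * r))) = (LINT s|exp_law. f s)"
proof -
  let ?e = "exponential_density 1"
  have e: "0 \<le> ?e s" for s by (rule exponential_density_nonneg) simp
  have B: "0 \<le> B" using bound[of 0] by linarith
  \<comment> \<open>The substitution \<open>v = s * r\<close> absorbs the factor \<open>s\<close>,
    so the left side is a double integral of \<open>g\<close>. Integrating over \<open>s\<close>
    first gives the other side.\<close>
  define g where "g s v = ?e s * (indicator {0..<s} v * f v)" for s v :: real
  have g_meas: "(\<lambda>p. g (fst p) (snd p)) \<in> borel_measurable (lborel \<Otimes>\<^sub>M lborel)"
    unfolding g_def indicator_def atLeastLessThan_iff by measurable
  have int: "integrable (lborel \<Otimes>\<^sub>M lborel) (\<lambda>(s, v). g s v)"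
  proof (rule integrableI_bounded)
    show "(\<lambda>(s, v). g s v) \<in> borel_measurable (lborel \<Otimes>\<^sub>M lborel)" using g_meas by (simp add: split_beta')
    have "(\<integral>\<^sup>+p. ennreal (norm (case p of (s, v) \<Rightarrow> g s v)) \<partial>(lborel \<Otimes>\<^sub>M lborel)) =
        (\<integral>\<^sup>+s. (\<integral>\<^sup>+v. ennreal \<bar>g s v\<bar> \<partial>lborel) \<partial>lborel)"
      using g_meas by (subst lborel.nn_integral_fst[symmetric]) (simp_all add: split_beta')
    also have "\<dots> \<le> (\<integral>\<^sup>+s. ennreal B * ennreal (?e s * s) \<partial>lborel)"
    proof (intro nn_integral_mono)
      fix s :: real
      have "(\<integral>\<^sup>+v. ennreal \<bar>g s v\<bar> \<partial>lborel) \<le> (\<integral>\<^sup>+v. ennreal (B * ?e s) * indicator {0..<s} v \<partial>lborel)"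
        using bound B e[of s]
        by (intro nn_integral_mono) (auto simp: g_def abs_mult mult.commute[of _ "?e s"] mult.commute[of B] intro!: ennreal_leI mult_left_mono split: split_indicator)
      also have "\<dots> = ennreal (B * ?e s) * emeasure lborel {0..<s}" by (simp add: nn_integral_cmult_indicator)
      also have "\<dots> = ennreal B * ennreal (?e s * s)"
      proof (cases "0 \<le> s")
        case True
        then show ?thesis using B e[of s] by (simp add: ennreal_mult[symmetric] mult.assoc)
      qed (simp add: exponential_density_def)
      finally show "(\<integral>\<^sup>+v. ennreal \<bar>g s v\<bar> \<partial>lborel) \<le> ennreal B * ennreal (?e s * s)" .
    qed
    also have "\<dots> = ennreal B * (\<integral>\<^sup>+s. ennreal s \<partial>exp_law)"
      using e by (subst nn_integral_cmult) (auto simp: nn_integral_density ennreal_mult')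
    also have "\<dots> < \<infinity>" by (simp add: exp_law_mean)
    finally show "(\<integral>\<^sup>+p. ennreal (norm (case p of (s, v) \<Rightarrow> g s v)) \<partial>(lborel \<Otimes>\<^sub>M lborel)) < \<infinity>" .
  qed
  have fr: "(\<lambda>s. s * (LINT r:{0..<1}|lborel. f (s * r))) \<in> borel_measurable borel"
  proof -
    have "(\<lambda>s. LINT r|lborel. indicator {0..<1} r *\<^sub>R f (s * r)) \<in> borel_measurable borel"
      by (rule lborel.borel_measurable_lebesgue_integral) measurable
    then show ?thesis unfolding set_lebesgue_integral_def by measurable
  qed
  have "(LINT s|exp_law. s * (LINT r:{0..<1}|lborel. f (s * r))) =
      (LINT s|lborel. ?e s * (s * (LINT r:{0..<1}|lborel. f (s * r))))"
    using fr e by (subst integral_density) auto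
  also have "\<dots> = (LINT s|lborel. (LINT v|lborel. g s v))"
  proof (rule integral_cong_AE)
    show "(\<lambda>s. ?e s * (s * (LINT r:{0..<1}|lborel. f (s * r)))) \<in> borel_measurable lborel"
      using fr by simp
    show "(\<lambda>s. LINT v|lborel. g s v) \<in> borel_measurable lborel"
      using g_meas by (intro lborel.borel_measurable_lebesgue_integral) (simp add: split_beta')
    have "AE s in lborel. s \<noteq> (0::real)" by (rule AE_lborel_singleton)
    then show "AE s in lborel. ?e s * (s * (LINT r:{0..<1}|lborel. f (s * r))) = (LINT v|lborel. g s v)"
    proof eventually_elim
      fix s :: real assume "s \<noteq> 0"
      show "?e s * (s * (LINT r:{0..<1}|lborel. f (s * r))) = (LINT v|lborel. g s v)"
      proof (cases "0 < s")
        case True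
        have "(LINT v|lborel. indicator {0..<s} v * f v) = s * (LINT r|lborel. indicator {0..<s} (s * r) * f (s * r))"
          using True by (subst lborel_integral_real_affine[where c=s and t=0]) auto
        also have "\<dots> = s * (LINT r:{0..<1}|lborel. f (s * r))"
          unfolding set_lebesgue_integral_def using True
          by (intro arg_cong[where f="\<lambda>a. s * a"] Bochner_Integration.integral_cong)
             (auto simp: zero_le_mult_iff split: split_indicator)
        finally show ?thesis by (simp add: g_def)
      next
        case False
        then have "?e s = 0" using \<open>s \<noteq> 0\<close> by (simp add: exponential_density_def)
        then show ?thesis by (simp add: g_def)
      qed
    qed
  qed
  also have "\<dots> = (LINT v|lborel. (LINT s|lborel. g s v))"
    by (rule lborel_pair.Fubini_integral[OF int, symmetric])
  also have "\<dots> = (LINT v|lborel. ?e v * f v)"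
  proof (intro Bochner_Integration.integral_cong refl)
    fix v :: real
    show "(LINT s|lborel. g s v) = ?e v * f v"
    proof (cases "0 \<le> v")
      case True
      \<comment> \<open>What multiplies \<open>f v\<close> is the tail mass beyond \<open>v\<close>.
        It equals \<open>exp (- v)\<close>, which is the exponential density at \<open>v\<close>;
        this coincidence is the excess property.\<close>
      have "(LINT s|lborel. g s v) = f v * (LINT s|lborel. ?e s * indicator {v<..} s)"
        unfolding g_def using True
        by (subst integral_mult_right_zero[symmetric], intro Bochner_Integration.integral_cong)
           (auto split: split_indicator)
      also have "(LINT s|lborel. ?e s * indicator {v<..} s) = (LINT s|exp_law. indicator {v<..} s)"
        using e by (subst integral_density) auto
      also have "\<dots> = measure exp_law {v<..}" by simp
      also have "{v<..} = space exp_law - {..v}" by auto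
      also have "measure exp_law (space exp_law - {..v}) = 1 - measure exp_law {..v}"
        by (rule exp_law.prob_compl) simp
      also have "measure exp_law {..v} = 1 - exp (- v)"
        using emeasure_erlang_density[of 1 0 v] True by (simp add: measure_def erlang_CDF_0)
      finally show ?thesis using True by (simp add: exponential_density_def)
    next
      case False
      then have "g s v = 0" for s by (simp add: g_def)
      then show ?thesis using False by (simp add: exponential_density_def)
    qed
  qed
  also have "\<dots> = (LINT s|exp_law. f s)"
    using e by (subst integral_density) auto
  finally show ?thesis .
qed

lemma integral_exp_clocks_upd:
  fixes f :: "(int \<Rightarrow> real) \<Rightarrow> real"
  assumes "integrable exp_clocks f"
  shows "(LINT \<zeta>|exp_clocks. f \<zeta>) = (LINT \<zeta>|exp_clocks. (LINT s|exp_law. f (\<zeta>(k := s))))"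
proof -
  interpret p: pair_sigma_finite exp_law exp_clocks ..
  let ?T = "\<lambda>(s, \<zeta>). \<zeta>(k := s)"
  have f: "f \<in> borel_measurable exp_clocks" using assms by auto
  have int: "integrable (exp_law \<Otimes>\<^sub>M exp_clocks) (\<lambda>p. f (?T p))"
    using assms integrable_distr_eq[OF measurable_exp_clocks_upd f, of k]
    by (simp add: distr_exp_clocks_upd)
  have "(LINT \<zeta>|exp_clocks. f \<zeta>) = (LINT p|(exp_law \<Otimes>\<^sub>M exp_clocks). f (?T p))"
    using integral_distr[OF measurable_exp_clocks_upd f, of k] by (simp add: distr_exp_clocks_upd)
  also have "\<dots> = (LINT \<zeta>|exp_clocks. (LINT s|exp_law. f (\<zeta>(k := s))))"
    using p.integral_snd[of "\<lambda>s \<zeta>. f (\<zeta>(k := s))"] int by (simp add: split_beta')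
  finally show ?thesis .
qed

text \<open>
  \<open>departure\<close> is \<open>\<tau>[x\<^sub>l, x\<^sub>k]\<close> in the environment thinned to the atoms in \<open>J\<close>. By the preceding property
  of \<open>exp_law\<close>, \<open>mean_occ\<close> is the expectation of \<open>occ\<close> in that environment.
\<close>

definition departure :: "(int \<Rightarrow> real) \<Rightarrow> (int \<Rightarrow> real) \<Rightarrow> int set \<Rightarrow> int \<Rightarrow> int \<Rightarrow> (int \<Rightarrow> real) \<Rightarrow> real" where
  "departure x d J l k \<zeta> = (\<Sum>\<^sub>\<infinity>j\<in>{j\<in>J. x l \<le> x j \<and> x j \<le> x k}. d j * \<zeta> j)"

definition mean_occ :: "(int \<Rightarrow> real) \<Rightarrow> (int \<Rightarrow> real) \<Rightarrow> (real \<times> real \<Rightarrow> real) \<Rightarrow> int set \<Rightarrow> int \<Rightarrow> int \<Rightarrow> real" where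
  "mean_occ x d h J l k = (if x l \<le> x k then d k * (LINT \<zeta>|exp_clocks. h (departure x d J l k \<zeta>, x k)) else 0)"

text \<open>For \<open>J\<close> a window containing the supports of \<open>u\<close> and of
  \<open>h\<close> in space, this is the mean of the integrated particle density divided by
  \<open>a\<close>: the trap \<open>l\<close> emits particles at rate
  \<open>a * u (x l) * d l\<close>. For other \<open>J\<close> the starts, the targets and the
  delaying traps are all thinned to \<open>J\<close>.\<close>

definition flux :: "(int \<Rightarrow> real) \<Rightarrow> (int \<Rightarrow> real) \<Rightarrow> (real \<Rightarrow> real) \<Rightarrow> (real \<times> real \<Rightarrow> real) \<Rightarrow> int set \<Rightarrow> real" where
  "flux x d u h J = (\<Sum>\<^sub>\<infinity>l\<in>J. u (x l) * d l * (\<Sum>\<^sub>\<infinity>k\<in>J. mean_occ x d h J l k))"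

lemma departure_measurable [measurable]: "departure x d J l k \<in> borel_measurable exp_clocks"
  unfolding departure_def[abs_def] by (rule borel_measurable_infsum_real) auto

lemma arrival_measurable [measurable]: "arrival x d l k \<in> borel_measurable exp_clocks"
  unfolding arrival_def[abs_def] by (rule borel_measurable_infsum_real) auto

lemma occ_measurable:
  assumes h: "continuous_on UNIV h"
  shows "occ x d h l k \<in> borel_measurable exp_clocks"
proof -
  have [measurable]: "h \<in> borel_measurable borel" by (rule borel_measurable_continuous_onI[OF h])
  have [measurable]: "(\<lambda>p. h (arrival x d l k (fst p) + d k * fst p k * snd p, x k)) \<in> borel_measurable (exp_clocks \<Otimes>\<^sub>M lborel)"
  proof (rule measurable_compose[OF _ \<open>h \<in> borel_measurable borel\<close>], rule borel_measurable_Pair)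
    have [measurable]: "(\<lambda>p. fst p k) \<in> borel_measurable (exp_clocks \<Otimes>\<^sub>M lborel)"
      by (rule measurable_compose[OF measurable_fst measurable_clock])
    show "(\<lambda>p. arrival x d l k (fst p) + d k * fst p k * snd p) \<in> borel_measurable (exp_clocks \<Otimes>\<^sub>M lborel)"
      by measurable
  qed simp
  have [measurable]: "(\<lambda>p. fst p k) \<in> borel_measurable (exp_clocks \<Otimes>\<^sub>M lborel)"
    by (rule measurable_compose[OF measurable_fst measurable_clock])
  have "(\<lambda>\<zeta>. (LINT r:{0..<1}|lborel. d k * \<zeta> k * h (arrival x d l k \<zeta> + d k * \<zeta> k * r, x k))) \<in> borel_measurable exp_clocks"
    unfolding set_lebesgue_integral_def
    by (rule lborel.borel_measurable_lebesgue_integral) (simp add: split_beta')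
  then show ?thesis
    unfolding occ_def[abs_def] by (cases "x l \<le> x k") simp_all
qed

lemma lint_abs_bound_AE:
  fixes f g :: "'a \<Rightarrow> real"
  assumes "integrable M f" "integrable M g" "AE w in M. norm (f w) \<le> g w"
  shows "\<bar>LINT w|M. f w\<bar> \<le> (LINT w|M. g w)"
proof -
  have "\<bar>LINT w|M. f w\<bar> \<le> (LINT w|M. norm (f w))"
    using integral_norm_bound[of M f] by simp
  also have "\<dots> \<le> (LINT w|M. g w)"
    by (intro integral_mono_AE integrable_norm assms)
  finally show ?thesis .
qed

lemma unit_integral_le:
  fixes f :: "real \<Rightarrow> real"
  assumes "\<And>r. 0 \<le> r \<Longrightarrow> r < 1 \<Longrightarrow> \<bar>f r\<bar> \<le> C" "0 \<le> C"
  shows "\<bar>LINT r:{0..<1}|lborel. f r\<bar> \<le> C"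
proof (cases "set_integrable lborel {0..<1} f")
  case True
  then show ?thesis
    unfolding set_lebesgue_integral_def set_integrable_def
    using lint_abs_bound_AE[of lborel "\<lambda>r. indicator {0..<1} r *\<^sub>R f r" "\<lambda>r. indicator {0..<1} r *\<^sub>R C"] assms
    by (auto split: split_indicator)
next
  case False
  then show ?thesis using assms(2)
    by (simp add: set_lebesgue_integral_def set_integrable_def not_integrable_integral_eq)
qed

lemma occ_bound:
  assumes "\<forall>p. \<bar>h p\<bar> \<le> B" "0 \<le> d k * \<zeta> k"
  shows "\<bar>occ x d h l k \<zeta>\<bar> \<le> B * (d k * \<zeta> k)"
proof -
  have "0 \<le> B" using assms(1)[rule_format, of undefined] by linarith
  have "\<bar>d k * \<zeta> k * h p\<bar> \<le> B * (d k * \<zeta> k)" for p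
    using mult_left_mono[OF assms(1)[rule_format, of p] assms(2)]
    unfolding abs_mult[of "d k * \<zeta> k"] abs_of_nonneg[OF assms(2)] by (simp only: mult.commute)
  then have "\<bar>LINT r:{0..<1}|lborel. d k * \<zeta> k * h (arrival x d l k \<zeta> + d k * \<zeta> k * r, x k)\<bar> \<le> B * (d k * \<zeta> k)"
    by (rule unit_integral_le) (use \<open>0 \<le> B\<close> assms(2) in simp)
  then show ?thesis using \<open>0 \<le> B\<close> assms(2)
    unfolding occ_def by (cases "x l \<le> x k") simp_all
qed

lemma occ_AE_bound:
  assumes "\<forall>p. \<bar>h p\<bar> \<le> B" "\<forall>k. 0 < d k"
  shows "AE \<zeta> in exp_clocks. norm (occ x d h l k \<zeta>) \<le> B * (d k * \<zeta> k)"
  using clock_pos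
proof eventually_elim
  fix \<zeta> :: "int \<Rightarrow> real" assume "\<forall>k. 0 < \<zeta> k"
  then show "norm (occ x d h l k \<zeta>) \<le> B * (d k * \<zeta> k)"
    unfolding real_norm_def using assms(2) by (intro occ_bound[OF assms(1)] mult_nonneg_nonneg) (auto simp: less_imp_le)
qed

lemma occ_integrable:
  assumes "continuous_on UNIV h" "\<forall>p. \<bar>h p\<bar> \<le> B" "\<forall>k. 0 < d k"
  shows "integrable exp_clocks (occ x d h l k)"
proof (rule Bochner_Integration.integrable_bound)
  have "0 \<le> B" using assms(2)[rule_format, of undefined] by linarith
  show "integrable exp_clocks (\<lambda>\<zeta>. B * (d k * \<zeta> k))"
    by (intro integrable_mult_right integrable_clock)
  show "AE \<zeta> in exp_clocks. norm (occ x d h l k \<zeta>) \<le> norm (B * (d k * \<zeta> k))"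
    using occ_AE_bound[OF assms(2,3), of x l k] by eventually_elim simp
qed (rule occ_measurable[OF assms(1)])

lemma integrable_departure:
  fixes h :: "real \<times> real \<Rightarrow> real"
  assumes h: "continuous_on UNIV h" and bound: "\<forall>p. \<bar>h p\<bar> \<le> B"
  shows "integrable exp_clocks (\<lambda>\<zeta>. h (departure x d J l k \<zeta>, z))"
proof (rule exp_clocks.integrable_const_bound[of _ B])
  show "(\<lambda>\<zeta>. h (departure x d J l k \<zeta>, z)) \<in> borel_measurable exp_clocks"
    by (rule measurable_compose[OF _ borel_measurable_continuous_onI[OF h]], rule borel_measurable_Pair) measurable
qed (use bound in auto)

lemma mean_occ_bound:
  assumes h: "continuous_on UNIV h" and bound: "\<forall>p. \<bar>h p\<bar> \<le> B" and pos: "\<forall>k. 0 < d k"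
  shows "\<bar>mean_occ x d h J l k\<bar> \<le> B * d k"
proof -
  have B: "0 \<le> B" using bound[rule_format, of undefined] by linarith
  have "\<bar>LINT \<zeta>|exp_clocks. h (departure x d J l k \<zeta>, x k)\<bar> \<le> (LINT \<zeta>|exp_clocks. B)"
    by (rule lint_abs_bound_AE[OF integrable_departure[OF h bound]]) (use bound in auto)
  also have "\<dots> = B" using exp_clocks.prob_space by simp
  finally show ?thesis
    using pos[rule_format, of k] B by (simp add: mean_occ_def abs_mult mult.commute)
qed

lemma abs_infsum_le:
  fixes f g :: "'a \<Rightarrow> real"
  assumes "g summable_on A" "\<And>a. a \<in> A \<Longrightarrow> \<bar>f a\<bar> \<le> g a"
  shows "f summable_on A" "\<bar>infsum f A\<bar> \<le> infsum g A"
proof -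
  have abs: "(\<lambda>a. norm (f a)) summable_on A"
    by (rule summable_on_comparison_test[OF assms(1)]) (use assms(2) in auto)
  then show "f summable_on A" by (rule abs_summable_summable)
  have "\<bar>infsum f A\<bar> \<le> (\<Sum>\<^sub>\<infinity>a\<in>A. norm (f a))"
    using norm_infsum_bound[OF abs] by simp
  also have "\<dots> \<le> infsum g A"
    by (rule infsum_mono[OF abs assms(1)]) (use assms(2) in auto)
  finally show "\<bar>infsum f A\<bar> \<le> infsum g A" .
qed

section \<open>Mean occupation, and the cost of removing shallow traps\<close>

context trap_data
begin

lemma d_pos_all: "\<forall>k. 0 < d k"
  using d_pos by blast

abbreviation window :: "real \<Rightarrow> int set" where "window L \<equiv> {k. \<bar>x k\<bar> \<le> L}"

lemma arrival_upd: "arrival x d l k (\<zeta>(k := s)) = arrival x d l k \<zeta>"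
  unfolding arrival_def by (intro infsum_cong) auto

text \<open>A trap between two points of the window lies in the window, so the thinning removes no
  delay on the way. Injectivity of \<open>x\<close> ensures that the last location contributes only
  the holding time of \<open>k\<close>.\<close>

lemma departure_eq_arrival:
  assumes g: "good \<zeta>" and lk: "l \<in> window L" "k \<in> window L" "x l \<le> x k"
  shows "departure x d (window L) l k \<zeta> = arrival x d l k \<zeta> + d k * \<zeta> k"
proof -
  let ?A = "{j. x l \<le> x j \<and> x j < x k}"
  have "(\<lambda>j. d j * \<zeta> j) summable_on ?A" by (rule hold_summable[OF g, of _ "x l" "x k"]) auto
  then have "infsum (\<lambda>j. d j * \<zeta> j) (insert k ?A) = infsum (\<lambda>j. d j * \<zeta> j) ?A + d k * \<zeta> k"
    by (subst infsum_insert) auto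
  moreover have "x j \<le> x k \<longleftrightarrow> j = k \<or> x j < x k" for j
    using injD[OF inj_x, of j k] by (auto simp: le_less)
  then have "insert k ?A = {j \<in> window L. x l \<le> x j \<and> x j \<le> x k}"
    using lk by (auto simp: abs_le_iff)
  ultimately show ?thesis by (simp add: departure_def arrival_def)
qed

context
  fixes h :: "real \<times> real \<Rightarrow> real" and B L :: real
  assumes h: "continuous_on UNIV h"
    and bound: "\<forall>p. \<bar>h p\<bar> \<le> B"
begin

lemma B_nonneg: "0 \<le> B"
  using bound[rule_format, of undefined] by linarith

lemma mean_occ_summable:
  assumes "A \<subseteq> window L"
  shows "(\<lambda>k. mean_occ x d h J l k) summable_on A" "\<bar>\<Sum>\<^sub>\<infinity>k\<in>A. mean_occ x d h J l k\<bar> \<le> B * infsum d A"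
proof -
  have d: "d summable_on A" by (rule summable_on_subset_banach[OF d_summable assms])
  have *: "(\<lambda>k. B * d k) summable_on A" by (intro summable_on_cmult_right d)
  show "(\<lambda>k. mean_occ x d h J l k) summable_on A"
    by (rule abs_infsum_le(1)[OF *]) (rule mean_occ_bound[OF h bound d_pos_all])
  have "\<bar>\<Sum>\<^sub>\<infinity>k\<in>A. mean_occ x d h J l k\<bar> \<le> (\<Sum>\<^sub>\<infinity>k\<in>A. B * d k)"
    by (rule abs_infsum_le(2)[OF *]) (rule mean_occ_bound[OF h bound d_pos_all])
  then show "\<bar>\<Sum>\<^sub>\<infinity>k\<in>A. mean_occ x d h J l k\<bar> \<le> B * infsum d A"
    by (simp add: infsum_cmult_right[OF d])
qed

text \<open>The arrival time does not involve the clock \<open>k\<close>. Resampling that clock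
  therefore isolates an integral to which the excess property applies, and it replaces the average
  of \<open>h\<close> over the stay by \<open>h\<close> at the departure time, with the factor
  \<open>d k\<close> in front.\<close>

lemma expectation_occ:
  assumes lk: "l \<in> window L" "k \<in> window L"
  shows "(LINT \<zeta>|exp_clocks. occ x d h l k \<zeta>) = mean_occ x d h (window L) l k"
proof (cases "x l \<le> x k")
  case le: True
  have hm: "h \<in> borel_measurable borel" by (rule borel_measurable_continuous_onI[OF h])
  have meas: "(\<lambda>\<zeta>. h (arrival x d l k \<zeta> + d k * \<zeta> k, x k)) \<in> borel_measurable exp_clocks"
    by (rule measurable_compose[OF _ hm], rule borel_measurable_Pair) measurable
  then have int: "integrable exp_clocks (\<lambda>\<zeta>. h (arrival x d l k \<zeta> + d k * \<zeta> k, x k))"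
    using bound by (intro exp_clocks.integrable_const_bound[of _ B]) auto
  have "(LINT \<zeta>|exp_clocks. occ x d h l k \<zeta>) = (LINT \<zeta>|exp_clocks. (LINT s|exp_law. occ x d h l k (\<zeta>(k := s))))"
    by (rule integral_exp_clocks_upd) (rule occ_integrable[OF h bound d_pos_all])
  also have "\<dots> = (LINT \<zeta>|exp_clocks. d k * (LINT s|exp_law. h (arrival x d l k \<zeta> + d k * s, x k)))"
  proof (intro Bochner_Integration.integral_cong refl)
    fix \<zeta>
    define f where "f v = h (arrival x d l k \<zeta> + d k * v, x k)" for v
    have "continuous_on UNIV f"
      unfolding f_def by (rule continuous_on_compose2[OF h]) (auto intro!: continuous_intros)
    then have f: "f \<in> borel_measurable borel" by (rule borel_measurable_continuous_onI)
    have "(LINT s|exp_law. occ x d h l k (\<zeta>(k := s))) = (LINT s|exp_law. d k * (s * (LINT r:{0..<1}|lborel. f (s * r))))"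
      using le by (intro Bochner_Integration.integral_cong refl) (simp add: occ_def arrival_upd f_def mult.assoc)
    also have "\<dots> = d k * (LINT s|exp_law. s * (LINT r:{0..<1}|lborel. f (s * r)))"
      by (rule integral_mult_right_zero)
    also have "(LINT s|exp_law. s * (LINT r:{0..<1}|lborel. f (s * r))) = (LINT s|exp_law. f s)"
      by (rule exp_law_excess[OF f, of B]) (simp add: f_def bound)
    finally show "(LINT s|exp_law. occ x d h l k (\<zeta>(k := s))) = d k * (LINT s|exp_law. h (arrival x d l k \<zeta> + d k * s, x k))"
      unfolding f_def .
  qed
  \<comment> \<open>The arrival time is rewritten with the updated clocks, although it is
    insensitive to them, so that the whole integrand has the form required to undo the
    resampling.\<close>
  also have "\<dots> = d k * (LINT \<zeta>|exp_clocks. (LINT s|exp_law. h (arrival x d l k (\<zeta>(k := s)) + d k * (\<zeta>(k := s)) k, x k)))"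
    by (simp add: arrival_upd)
  also have "\<dots> = d k * (LINT \<zeta>|exp_clocks. h (arrival x d l k \<zeta> + d k * \<zeta> k, x k))"
    using integral_exp_clocks_upd[OF int, of k] by simp
  also have "(LINT \<zeta>|exp_clocks. h (arrival x d l k \<zeta> + d k * \<zeta> k, x k)) = (LINT \<zeta>|exp_clocks. h (departure x d (window L) l k \<zeta>, x k))"
  proof (rule integral_cong_AE[OF meas borel_measurable_integrable[OF integrable_departure[OF h bound]]])
    show "AE \<zeta> in exp_clocks. h (arrival x d l k \<zeta> + d k * \<zeta> k, x k) = h (departure x d (window L) l k \<zeta>, x k)"
      using AE_good by eventually_elim (simp add: departure_eq_arrival[OF _ lk le])
  qed
  finally show ?thesis using le by (simp add: mean_occ_def)
qed (simp add: mean_occ_def occ_def)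

text \<open>Expectation and sum over targets are exchanged; the mean of
  \<open>\<bar>occ\<bar>\<close> at \<open>k\<close> is at most \<open>B * d k\<close>, which is
  summable over the window.\<close>

lemma expected_occupation:
  assumes supp: "\<And>t z. L < \<bar>z\<bar> \<Longrightarrow> h (t, z) = 0" and l: "l \<in> window L"
  shows "(LINT \<zeta>|exp_clocks. (LINT t:{0..}|lborel. h (t, Zr \<zeta> l t))) = (\<Sum>\<^sub>\<infinity>k\<in>window L. mean_occ x d h (window L) l k)"
proof -
  let ?K = "window L"
  interpret K: sigma_finite_measure "count_space ?K"
    by (rule sigma_finite_measure_count_space_countable) simp
  interpret p: pair_sigma_finite exp_clocks "count_space ?K" ..
  have hm: "h \<in> borel_measurable borel" by (rule borel_measurable_continuous_onI[OF h])
  have meas: "(\<lambda>(\<zeta>, k). occ x d h l k \<zeta>) \<in> borel_measurable (exp_clocks \<Otimes>\<^sub>M count_space ?K)"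
    using occ_measurable[OF h] by (intro measurable_split_countable) auto
  have "AE \<zeta> in exp_clocks. (LINT t:{0..}|lborel. h (t, Zr \<zeta> l t)) = (LINT k|count_space ?K. occ x d h l k \<zeta>)"
    using AE_good
  proof eventually_elim
    fix \<zeta> assume g: "good \<zeta>"
    show "(LINT t:{0..}|lborel. h (t, Zr \<zeta> l t)) = (LINT k|count_space ?K. occ x d h l k \<zeta>)"
    proof -
      have "(LINT t:{0..}|lborel. h (t, Zr \<zeta> l t)) = (\<Sum>\<^sub>\<infinity>k\<in>?K. occ x d h l k \<zeta>)"
        using bound supp by (intro occupation[OF g hm]) auto
      then show ?thesis by (simp add: infsum_eq_lint_count_space)
    qed
  qed
  moreover have m2: "(\<lambda>\<zeta>. LINT k|count_space ?K. occ x d h l k \<zeta>) \<in> borel_measurable exp_clocks"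
    using occ_measurable[OF h] by (intro borel_measurable_lint_count_space) auto
  moreover have "(\<lambda>\<zeta>. (LINT t:{0..}|lborel. h (t, Zr \<zeta> l t))) \<in> borel_measurable exp_clocks"
  proof -
    have "(\<lambda>p. h (snd p, Zr (fst p) l (snd p))) \<in> borel_measurable (exp_clocks \<Otimes>\<^sub>M lborel)"
      by (rule measurable_compose[OF _ hm], rule borel_measurable_Pair) measurable
    then show ?thesis
      unfolding set_lebesgue_integral_def
      by (intro lborel.borel_measurable_lebesgue_integral) (simp add: split_beta')
  qed
  ultimately have "(LINT \<zeta>|exp_clocks. (LINT t:{0..}|lborel. h (t, Zr \<zeta> l t))) = (LINT \<zeta>|exp_clocks. LINT k|count_space ?K. occ x d h l k \<zeta>)"
    by (intro integral_cong_AE)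
  also have "\<dots> = (LINT k|count_space ?K. LINT \<zeta>|exp_clocks. occ x d h l k \<zeta>)"
  proof (rule p.Fubini_integral[symmetric], rule integrableI_bounded[OF meas])
    have "(\<integral>\<^sup>+p. ennreal (norm (case p of (\<zeta>, k) \<Rightarrow> occ x d h l k \<zeta>)) \<partial>(exp_clocks \<Otimes>\<^sub>M count_space ?K)) =
        (\<integral>\<^sup>+k. (\<integral>\<^sup>+\<zeta>. ennreal (norm (occ x d h l k \<zeta>)) \<partial>exp_clocks) \<partial>count_space ?K)"
      using meas by (subst p.nn_integral_snd[symmetric]) (simp_all add: split_beta')
    also have "\<dots> \<le> (\<integral>\<^sup>+k. ennreal (B * d k) \<partial>count_space ?K)"
    proof (intro nn_integral_mono)
      fix k
      have "(\<integral>\<^sup>+\<zeta>. ennreal (norm (occ x d h l k \<zeta>)) \<partial>exp_clocks) \<le> (\<integral>\<^sup>+\<zeta>. ennreal (B * d k) * ennreal (\<zeta> k) \<partial>exp_clocks)"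
      proof (rule nn_integral_mono_AE)
        show "AE \<zeta> in exp_clocks. ennreal (norm (occ x d h l k \<zeta>)) \<le> ennreal (B * d k) * ennreal (\<zeta> k)"
          using occ_AE_bound[OF bound d_pos_all, of x l k]
        proof eventually_elim
          fix \<zeta> :: "int \<Rightarrow> real"
          assume "norm (occ x d h l k \<zeta>) \<le> B * (d k * \<zeta> k)"
          then show "ennreal (norm (occ x d h l k \<zeta>)) \<le> ennreal (B * d k) * ennreal (\<zeta> k)"
            using B_nonneg d_pos[of k] by (subst ennreal_mult'[symmetric]) (auto intro!: ennreal_leI simp: mult.assoc less_imp_le)
        qed
      qed
      also have "\<dots> = ennreal (B * d k)" by (simp add: nn_integral_cmult nn_integral_clock)
      finally show "(\<integral>\<^sup>+\<zeta>. ennreal (norm (occ x d h l k \<zeta>)) \<partial>exp_clocks) \<le> ennreal (B * d k)" .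
    qed
    also have "\<dots> < \<infinity>"
    proof -
      have "(\<lambda>k. B * d k) summable_on ?K" by (rule summable_on_cmult_right) (rule d_summable)
      then show ?thesis
        using B_nonneg d_pos by (subst nn_integral_count_space_infsum) (auto simp: less_imp_le)
    qed
    finally show "(\<integral>\<^sup>+p. ennreal (norm (case p of (\<zeta>, k) \<Rightarrow> occ x d h l k \<zeta>)) \<partial>(exp_clocks \<Otimes>\<^sub>M count_space ?K)) < \<infinity>" .
  qed
  also have "\<dots> = (\<Sum>\<^sub>\<infinity>k\<in>?K. mean_occ x d h ?K l k)"
    unfolding infsum_eq_lint_count_space[symmetric] by (intro infsum_cong expectation_occ l)
  finally show ?thesis .
qed

context
  fixes e C :: real
  assumes modulus: "\<And>s t z. \<bar>h (s, z) - h (t, z)\<bar> \<le> e + C * \<bar>s - t\<bar>" and C: "0 \<le> C" and e: "0 \<le> e"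
begin

text \<open>Thinning shortens the departure time by at most the holding times of the removed traps,
  whose mean is their total depth because clocks have mean 1. The test function need not be
  Lipschitz; a modulus affine in the time difference is enough, since it commutes with the
  expectation.\<close>

lemma mean_occ_diff:
  assumes I: "I \<subseteq> window L"
  shows "\<bar>mean_occ x d h (window L) l k - mean_occ x d h I l k\<bar> \<le> d k * (e + C * infsum d (window L - I))"
proof (cases "x l \<le> x k")
  case le: True
  let ?K = "window L" and ?R = "window L - I"
  let ?f = "\<lambda>\<zeta>. h (departure x d ?K l k \<zeta>, x k) - h (departure x d I l k \<zeta>, x k)"
  have int: "integrable exp_clocks ?f"
    by (intro Bochner_Integration.integrable_diff integrable_departure[OF h bound])
  have R: "0 \<le> infsum d ?R" by (intro infsum_nonneg less_imp_le[OF d_pos])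
  have "ennreal \<bar>LINT \<zeta>|exp_clocks. ?f \<zeta>\<bar> \<le> (\<integral>\<^sup>+\<zeta>. ennreal (norm (?f \<zeta>)) \<partial>exp_clocks)"
    using integral_norm_bound_ennreal[OF int] by simp
  also have "\<dots> \<le> (\<integral>\<^sup>+\<zeta>. ennreal e + ennreal C * (\<integral>\<^sup>+j. ennreal (d j * \<zeta> j) \<partial>count_space ?R) \<partial>exp_clocks)"
  proof (rule nn_integral_mono_AE)
    show "AE \<zeta> in exp_clocks. ennreal (norm (?f \<zeta>)) \<le> ennreal e + ennreal C * (\<integral>\<^sup>+j. ennreal (d j * \<zeta> j) \<partial>count_space ?R)"
      using AE_good
    proof eventually_elim
      fix \<zeta> assume g: "good \<zeta>"
      let ?t = "\<lambda>j. d j * \<zeta> j" and ?S = "\<lambda>J. {j\<in>J. x l \<le> x j \<and> x j \<le> x k}"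
      have s: "?t summable_on A" if "A \<subseteq> ?K" for A
        by (rule hold_summable[OF g, where a="-L" and b=L]) (use that in auto)
      have R0: "0 \<le> infsum ?t A" for A by (intro infsum_nonneg less_imp_le[OF hold_pos[OF g]])
      have "?S ?K = ?S I \<union> ?S ?R" using I by auto
      then have "departure x d ?K l k \<zeta> = departure x d I l k \<zeta> + infsum ?t (?S ?R)"
        unfolding departure_def by (simp only:) (intro infsum_Un_disjoint s; use I in auto)
      moreover have "infsum ?t (?S ?R) \<le> infsum ?t ?R"
        by (intro infsum_mono_neutral s) (auto simp: less_imp_le[OF hold_pos[OF g]])
      ultimately have "\<bar>departure x d ?K l k \<zeta> - departure x d I l k \<zeta>\<bar> \<le> infsum ?t ?R" using R0[of "?S ?R"] by simp
      then have "C * \<bar>departure x d ?K l k \<zeta> - departure x d I l k \<zeta>\<bar> \<le> C * infsum ?t ?R" using C by (rule mult_left_mono)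
      then have "\<bar>?f \<zeta>\<bar> \<le> e + C * infsum ?t ?R"
        using modulus[of "departure x d ?K l k \<zeta>" "x k" "departure x d I l k \<zeta>"] by linarith
      then have "ennreal (norm (?f \<zeta>)) \<le> ennreal (e + C * infsum ?t ?R)" by (simp add: ennreal_leI)
      also have "\<dots> = ennreal e + ennreal C * ennreal (infsum ?t ?R)"
        using R0 C e by (simp add: ennreal_plus ennreal_mult)
      also have "ennreal (infsum ?t ?R) = (\<integral>\<^sup>+j. ennreal (?t j) \<partial>count_space ?R)"
        by (intro nn_integral_count_space_infsum[symmetric] s) (auto simp: less_imp_le[OF hold_pos[OF g]])
      finally show "ennreal (norm (?f \<zeta>)) \<le> ennreal e + ennreal C * (\<integral>\<^sup>+j. ennreal (?t j) \<partial>count_space ?R)" .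
    qed
  qed
  also have "\<dots> = ennreal e + ennreal C * (\<integral>\<^sup>+j. ennreal (d j) \<partial>count_space ?R)"
  proof -
    define G where "G = (\<lambda>\<zeta>. \<integral>\<^sup>+j. ennreal (d j * \<zeta> j) \<partial>count_space ?R)"
    have [measurable]: "G \<in> borel_measurable exp_clocks"
      unfolding G_def by (rule borel_measurable_nn_integral_count_space) auto
    have "(\<integral>\<^sup>+\<zeta>. ennreal e + ennreal C * G \<zeta> \<partial>exp_clocks) = ennreal e + ennreal C * (\<integral>\<^sup>+\<zeta>. G \<zeta> \<partial>exp_clocks)"
      using exp_clocks.emeasure_space_1 by (subst nn_integral_add) (simp_all add: nn_integral_cmult)
    then show ?thesis
      unfolding G_def by (simp only: nn_integral_holding_times[OF less_imp_le[OF d_pos]])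
  qed
  also have "(\<integral>\<^sup>+j. ennreal (d j) \<partial>count_space ?R) = ennreal (infsum d ?R)"
    by (intro nn_integral_count_space_infsum summable_on_subset_banach[OF d_summable[of L]])
       (auto simp: less_imp_le[OF d_pos])
  also have "ennreal e + ennreal C * ennreal (infsum d ?R) = ennreal (e + C * infsum d ?R)"
    using C e R by (simp add: ennreal_plus ennreal_mult)
  finally have le': "\<bar>LINT \<zeta>|exp_clocks. ?f \<zeta>\<bar> \<le> e + C * infsum d ?R"
    using C e R by (subst (asm) ennreal_le_iff) auto
  have "mean_occ x d h ?K l k - mean_occ x d h I l k = d k * (LINT \<zeta>|exp_clocks. ?f \<zeta>)"
    using le by (simp add: mean_occ_def right_diff_distrib Bochner_Integration.integral_diff integrable_departure[OF h bound])
  then show ?thesis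
    using mult_left_mono[OF le' less_imp_le[OF d_pos[of k]]] d_pos[of k] by (simp add: abs_mult)
next
  case False
  have "0 \<le> d k * (e + C * infsum d (window L - I))"
    using C e d_pos by (intro mult_nonneg_nonneg add_nonneg_nonneg infsum_nonneg) (auto simp: less_imp_le)
  then show ?thesis using False by (simp add: mean_occ_def)
qed

text \<open>The terms have separate origins. \<open>B * \<delta>\<close> is lost on targets outside
  \<open>I\<close>, \<open>D * (e + C * \<delta>)\<close> on travel times to targets in
  \<open>I\<close>, both weighted by starts in \<open>I\<close> of total rate at most
  \<open>U * D\<close>; and \<open>U * \<delta> * (B * D)\<close> bounds the contribution of starts
  outside \<open>I\<close>. All but the part with \<open>e\<close> vanish as \<open>\<delta>\<close>
  does.\<close>

lemma flux_diff:
  assumes I: "I \<subseteq> window L" "finite I" and u: "\<And>z. 0 \<le> u z" "\<And>z. u z \<le> U"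
  defines "D \<equiv> infsum d (window L)" and "\<delta> \<equiv> infsum d (window L - I)"
  shows "\<bar>flux x d u h (window L) - flux x d u h I\<bar> \<le> U * D * (B * \<delta> + D * (e + C * \<delta>)) + U * \<delta> * (B * D)"
proof -
  let ?K = "window L"
  have U: "0 \<le> U" using u[of undefined] by linarith
  have dS: "d summable_on A" if "A \<subseteq> window L" for A
    by (rule summable_on_subset_banach[OF d_summable that])
  have D: "0 \<le> D" "0 \<le> \<delta>" unfolding D_def \<delta>_def by (auto intro!: infsum_nonneg less_imp_le[OF d_pos])
  have Un: "?K = I \<union> (?K - I)" using I by auto
  have DI: "infsum d I \<le> D"
    unfolding D_def using I by (intro infsum_mono_neutral dS) (auto simp: less_imp_le[OF d_pos])
  define S where "S = (\<lambda>J l. \<Sum>\<^sub>\<infinity>k\<in>J. mean_occ x d h J l k)"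
  have S_bound: "\<bar>S ?K l\<bar> \<le> B * D" for l
    unfolding S_def D_def by (rule mean_occ_summable(2)) simp
  have S_diff: "\<bar>S ?K l - S I l\<bar> \<le> B * \<delta> + D * (e + C * \<delta>)" for l
  proof -
    have "S ?K l = (\<Sum>\<^sub>\<infinity>k\<in>I. mean_occ x d h ?K l k) + (\<Sum>\<^sub>\<infinity>k\<in>?K - I. mean_occ x d h ?K l k)"
      unfolding S_def by (subst Un, rule infsum_Un_disjoint) (use I in \<open>auto intro!: mean_occ_summable(1)\<close>)
    moreover have "\<bar>\<Sum>\<^sub>\<infinity>k\<in>?K - I. mean_occ x d h ?K l k\<bar> \<le> B * \<delta>"
      unfolding \<delta>_def by (rule mean_occ_summable(2)) auto
    moreover have "\<bar>(\<Sum>\<^sub>\<infinity>k\<in>I. mean_occ x d h ?K l k) - S I l\<bar> \<le> D * (e + C * \<delta>)"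
    proof -
      have "\<bar>(\<Sum>\<^sub>\<infinity>k\<in>I. mean_occ x d h ?K l k) - S I l\<bar> = \<bar>\<Sum>k\<in>I. mean_occ x d h ?K l k - mean_occ x d h I l k\<bar>"
        using I by (simp add: S_def sum_subtractf)
      also have "\<dots> \<le> (\<Sum>k\<in>I. d k * (e + C * \<delta>))"
        unfolding \<delta>_def by (intro order_trans[OF sum_abs] sum_mono mean_occ_diff I)
      also have "\<dots> = infsum d I * (e + C * \<delta>)"
        using I by (simp add: sum_distrib_right)
      also have "\<dots> \<le> D * (e + C * \<delta>)"
        using DI C e D by (intro mult_right_mono) auto
      finally show ?thesis .
    qed
    ultimately show ?thesis by linarith
  qed
  have wl: "0 \<le> u (x l) * d l" "u (x l) * d l \<le> U * d l" for l
    using u d_pos[of l] by (auto intro: mult_right_mono)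
  have sm: "(\<lambda>l. u (x l) * d l * S ?K l) summable_on A" "\<bar>\<Sum>\<^sub>\<infinity>l\<in>A. u (x l) * d l * S ?K l\<bar> \<le> U * infsum d A * (B * D)"
    if "A \<subseteq> ?K" for A
  proof -
    have s: "(\<lambda>l. d l * (U * (B * D))) summable_on A" by (intro summable_on_cmult_left dS that)
    have b: "\<bar>u (x l) * d l * S ?K l\<bar> \<le> d l * (U * (B * D))" for l
    proof -
      have "\<bar>u (x l) * d l * S ?K l\<bar> \<le> (U * d l) * (B * D)"
        unfolding abs_mult[of "u (x l) * d l"] using wl[of l] S_bound[of l] D U d_pos[of l]
        by (intro mult_mono) auto
      then show ?thesis by (simp add: mult_ac)
    qed
    show "(\<lambda>l. u (x l) * d l * S ?K l) summable_on A" by (rule abs_infsum_le(1)[OF s b])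
    have "\<bar>\<Sum>\<^sub>\<infinity>l\<in>A. u (x l) * d l * S ?K l\<bar> \<le> (\<Sum>\<^sub>\<infinity>l\<in>A. d l * (U * (B * D)))"
      by (rule abs_infsum_le(2)[OF s b])
    also have "\<dots> = U * infsum d A * (B * D)"
      by (subst infsum_cmult_left) (use dS[OF that] in \<open>simp_all add: mult_ac\<close>)
    finally show "\<bar>\<Sum>\<^sub>\<infinity>l\<in>A. u (x l) * d l * S ?K l\<bar> \<le> U * infsum d A * (B * D)" .
  qed
  have "flux x d u h ?K = (\<Sum>\<^sub>\<infinity>l\<in>I. u (x l) * d l * S ?K l) + (\<Sum>\<^sub>\<infinity>l\<in>?K - I. u (x l) * d l * S ?K l)"
  proof -
    have "flux x d u h ?K = (\<Sum>\<^sub>\<infinity>l\<in>?K. u (x l) * d l * S ?K l)" by (simp add: flux_def S_def)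
    also have "\<dots> = (\<Sum>\<^sub>\<infinity>l\<in>I \<union> (?K - I). u (x l) * d l * S ?K l)" using Un by (intro infsum_cong_neutral) auto
    also have "\<dots> = (\<Sum>\<^sub>\<infinity>l\<in>I. u (x l) * d l * S ?K l) + (\<Sum>\<^sub>\<infinity>l\<in>?K - I. u (x l) * d l * S ?K l)"
      by (rule infsum_Un_disjoint) (use I sm(1)[of I] sm(1)[of "?K - I"] in auto)
    finally show ?thesis .
  qed
  moreover have "\<bar>\<Sum>\<^sub>\<infinity>l\<in>?K - I. u (x l) * d l * S ?K l\<bar> \<le> U * \<delta> * (B * D)"
    unfolding \<delta>_def by (rule sm(2)) auto
  moreover have "\<bar>(\<Sum>\<^sub>\<infinity>l\<in>I. u (x l) * d l * S ?K l) - flux x d u h I\<bar> \<le> U * D * (B * \<delta> + D * (e + C * \<delta>))"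
  proof -
    let ?R = "B * \<delta> + D * (e + C * \<delta>)"
    have R: "0 \<le> ?R" using B_nonneg C e D by auto
    have "\<bar>(\<Sum>\<^sub>\<infinity>l\<in>I. u (x l) * d l * S ?K l) - flux x d u h I\<bar> = \<bar>\<Sum>l\<in>I. u (x l) * d l * (S ?K l - S I l)\<bar>"
      using I by (simp add: flux_def S_def sum_subtractf right_diff_distrib)
    also have "\<dots> \<le> (\<Sum>l\<in>I. (U * d l) * ?R)"
    proof (intro order_trans[OF sum_abs] sum_mono)
      fix l
      show "\<bar>u (x l) * d l * (S ?K l - S I l)\<bar> \<le> U * d l * ?R"
        unfolding abs_mult[of "u (x l) * d l"] using wl[of l] S_diff[of l] U d_pos[of l]
        by (intro mult_mono) auto
    qed
    also have "\<dots> = U * infsum d I * ?R"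
      using I by (simp add: sum_distrib_right sum_distrib_left mult_ac)
    also have "\<dots> \<le> U * D * ?R"
      using DI U R by (intro mult_right_mono mult_left_mono) auto
    finally show ?thesis .
  qed
  ultimately show ?thesis by linarith
qed

end

end

end

section \<open>Matching of deep traps\<close>

text \<open>Infinite depth is included, its inverse being 0. Only depth 0 is left out: there the
  inverse is infinite and \<open>enn2real\<close> is discontinuous.\<close>

lemma continuous_on_enn2real_inverse: "continuous_on {0<..} (\<lambda>y. enn2real (inverse y))"
  unfolding continuous_on
proof
  fix y :: ennreal assume y: "y \<in> {0<..}"
  then have "inverse y < top" by (simp add: less_top[symmetric] ennreal_inverse_eq_top_iff)
  then obtain r where r: "inverse y = ennreal r" "0 \<le> r" by (cases "inverse y") auto
  have "(inverse \<longlongrightarrow> inverse y) (at y within {0<..})"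
    using continuous_on_inverse_ennreal[OF continuous_on_id, of "{0<..}"] y by (auto simp: continuous_on)
  then show "((\<lambda>y. enn2real (inverse y)) \<longlongrightarrow> enn2real (inverse y)) (at y within {0<..})"
    unfolding r using r(2) by (simp add: tendsto_enn2real)
qed

context trap_env
begin

text \<open>The depth enters through its inverse, so that depths near infinity become bounded.\<close>

definition pt :: "int \<Rightarrow> real \<times> real" where "pt k = (x k, 1 / d k)"

lemma finite_pt: "finite {k. \<bar>fst (pt k)\<bar> \<le> R \<and> snd (pt k) \<le> R}"
proof (cases "0 < R")
  case True
  have "{k. \<bar>fst (pt k)\<bar> \<le> R \<and> snd (pt k) \<le> R} = {k. \<bar>x k\<bar> \<le> R \<and> 1 / R \<le> d k}"
    using True d_pos by (auto simp: pt_def field_simps)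
  then show ?thesis using finite_deep[of "1 / R" R] True by simp
next
  case False
  then have "\<not> snd (pt k) \<le> R" for k
    unfolding pt_def snd_conv using divide_pos_pos[OF zero_less_one d_pos[of k]] by linarith
  then show ?thesis by simp
qed

end

text \<open>Functions of position and inverse depth. A bound on the inverse depth keeps depths away
  from 0, so the pull-back to the space of atoms has compact support there, infinite depth included,
  and is a legitimate test function for vague convergence.\<close>

definition window_fun :: "real \<Rightarrow> (real \<times> real \<Rightarrow> real) \<Rightarrow> bool" where
  "window_fun R G \<longleftrightarrow> continuous_on UNIV G \<and> (\<forall>p. R < \<bar>fst p\<bar> \<or> R < snd p \<longrightarrow> G p = 0)"

lemma window_fun_test:
  assumes G: "window_fun R G" and R: "0 < R"
  defines "f \<equiv> \<lambda>p::real \<times> ennreal. G (fst p, enn2real (inverse (snd p)))"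
  shows "continuous_on env_set f"
    and "\<exists>K. compact K \<and> K \<subseteq> env_set \<and> (\<forall>p\<in>env_set - K. f p = 0)"
proof -
  show "continuous_on env_set f"
    unfolding f_def
  proof (rule continuous_on_compose2[where g=G and t=UNIV])
    show "continuous_on UNIV G" using G by (simp add: window_fun_def)
    have "continuous_on env_set (\<lambda>p. enn2real (inverse (snd p)))"
      by (rule continuous_on_compose2[OF continuous_on_enn2real_inverse])
         (auto simp: env_set_def intro: continuous_on_snd continuous_on_id)
    then show "continuous_on env_set (\<lambda>p. (fst p, enn2real (inverse (snd p))))"
      by (intro continuous_on_Pair continuous_on_fst continuous_on_id)
  qed simp
  have "f p = 0" if "p \<in> env_set - {-R..R} \<times> {ennreal (1 / R)..}" for p
  proof (cases "\<bar>fst p\<bar> \<le> R")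
    case True
    obtain a b where p: "p = (a, b)" by force
    have b: "0 < b" "b < ennreal (1 / R)" using that True by (auto simp: p env_set_def abs_le_iff not_le)
    then obtain c where c: "b = ennreal c" "0 < c" "c < 1 / R"
      by (cases b) (auto simp: ennreal_less_iff)
    have "R < 1 / c" using c R by (simp add: field_simps)
    then show ?thesis using G c by (simp add: window_fun_def f_def p inverse_ennreal divide_inverse)
  qed (use G in \<open>simp add: window_fun_def f_def\<close>)
  then show "\<exists>K. compact K \<and> K \<subseteq> env_set \<and> (\<forall>p\<in>env_set - K. f p = 0)"
    using R atLeast_ennreal_pos[of "1 / R"]
    by (intro exI[of _ "{-R..R} \<times> {ennreal (1 / R)..}"]) (auto simp: compact_window env_set_def)
qed

lemma (in trap_env) lint_window_fun:
  assumes G: "window_fun R G" and R: "0 < R"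
  shows "(LINT p|W. G (fst p, enn2real (inverse (snd p)))) = (\<Sum>\<^sub>\<infinity>k. G (pt k))"
proof -
  have "(LINT p|W. G (fst p, enn2real (inverse (snd p)))) = (LINT k|count_space UNIV. G (fst (x k, y k), enn2real (inverse (snd (x k, y k)))))"
    using window_fun_test(1)[OF G R] unfolding env_space_def
    by (intro lint_env) (simp add: env_space_def borel_measurable_continuous_on_restrict)
  also have "\<dots> = (LINT k|count_space UNIV. G (pt k))"
    using d_pos by (intro Bochner_Integration.integral_cong) (auto simp: pt_def y_eq inverse_ennreal divide_inverse less_imp_le)
  finally show ?thesis by (simp add: infsum_eq_lint_count_space)
qed

locale trap_env_seq = lim: trap_env x y W
  for x :: "int \<Rightarrow> real" and y :: "int \<Rightarrow> ennreal" and W :: "(real \<times> ennreal) measure" +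
  fixes xs :: "nat \<Rightarrow> int \<Rightarrow> real" and ys :: "nat \<Rightarrow> int \<Rightarrow> ennreal" and Ws :: "nat \<Rightarrow> (real \<times> ennreal) measure"
  assumes seq: "\<And>n. trap_env (xs n) (ys n) (Ws n)"
    and vague: "vague_conv Ws W"
begin

sublocale sq: trap_env "xs n" "ys n" "Ws n" for n by (rule seq)

abbreviation ds where "ds n \<equiv> sq.d n"
abbreviation d where "d \<equiv> lim.d"

lemma window_fun_tendsto:
  assumes G: "window_fun R G" and R: "0 < R"
  shows "(\<lambda>n. \<Sum>\<^sub>\<infinity>k. G (sq.pt n k)) \<longlonglongrightarrow> (\<Sum>\<^sub>\<infinity>k. G (lim.pt k))"
  unfolding sq.lint_window_fun[OF G R, symmetric] lim.lint_window_fun[OF G R, symmetric]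
  using vague window_fun_test[OF G R] unfolding vague_conv_def by blast

text \<open>The region is described by \<open>F \<le> 0\<close>, and \<open>off\<close> says that no
  limit atom sits on its boundary. Its indicator lies between two continuous ramps that agree at all
  limit atoms; vague convergence of both forces the counts to converge, and convergent integers are
  eventually constant.\<close>

lemma count_eventually_eq:
  fixes F :: "real \<times> real \<Rightarrow> real"
  assumes F: "continuous_on UNIV F" and supp: "\<And>p. F p \<le> 1 \<Longrightarrow> \<bar>fst p\<bar> \<le> R \<and> snd p \<le> R" and R: "0 < R"
    and off: "\<And>k. F (lim.pt k) \<noteq> 0"
  shows "eventually (\<lambda>n. card {k. F (sq.pt n k) \<le> 0} = card {k. F (lim.pt k) \<le> 0}) sequentially"
proof -
  have finF: "finite {k. F (q k) \<le> c}" if "\<And>R. finite {k. \<bar>fst (q k)\<bar> \<le> R \<and> snd (q k) \<le> R}" "c \<le> 1"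
    for q :: "int \<Rightarrow> real \<times> real" and c
  proof (rule finite_subset[OF _ that(1)[of R]], rule subsetI)
    fix k assume "k \<in> {k. F (q k) \<le> c}"
    then show "k \<in> {k. \<bar>fst (q k)\<bar> \<le> R \<and> snd (q k) \<le> R}" using supp[of "q k"] that(2) by simp
  qed
  have fin: "finite {k. F (lim.pt k) \<le> 1}" by (rule finF[OF lim.finite_pt]) simp
  \<comment> \<open>Only finitely many limit atoms have \<open>F\<close> at most 1, so a gap
    \<open>\<delta>\<close> around the boundary stays free of them.\<close>
  have "eventually (\<lambda>\<delta>. \<forall>k\<in>{k. F (lim.pt k) \<le> 1}. \<delta> < \<bar>F (lim.pt k)\<bar>) (at_right 0)"
    using off by (intro eventually_ball_finite fin ballI order_tendstoD(2)[OF tendsto_ident_at]) simp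
  moreover have "eventually (\<lambda>\<delta>::real. \<delta> < 1) (at_right 0)"
    by (rule order_tendstoD(2)[OF tendsto_ident_at]) simp
  moreover have "eventually (\<lambda>\<delta>::real. 0 < \<delta>) (at_right 0)"
    by (rule eventually_at_right_less)
  ultimately have "eventually (\<lambda>\<delta>. (\<forall>k\<in>{k. F (lim.pt k) \<le> 1}. \<delta> < \<bar>F (lim.pt k)\<bar>) \<and> \<delta> < 1 \<and> 0 < \<delta>) (at_right 0)"
    by eventually_elim blast
  then obtain \<delta> where \<delta>: "0 < \<delta>" "\<delta> < 1" "\<And>k. F (lim.pt k) \<le> 1 \<Longrightarrow> \<delta> < \<bar>F (lim.pt k)\<bar>"
    by (metis (no_types, lifting) eventually_happens' mem_Collect_eq trivial_limit_at_right_real)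
  \<comment> \<open>For \<open>s = 0\<close> the ramp falls from 1 to 0 as \<open>F\<close> runs
    from \<open>- \<delta>\<close> to 0, for \<open>s = 1\<close> as it runs from 0 to
    \<open>\<delta>\<close>. Since \<open>\<delta> < 1\<close>, both vanish where \<open>F\<close>
    exceeds 1, hence outside a bounded window.\<close>
  define g where "g s p = max 0 (min 1 (s - F p / \<delta>))" for s :: real and p
  have wf: "window_fun R (g s)" if "s \<le> 1" for s
    unfolding window_fun_def
  proof (intro conjI allI impI)
    show "continuous_on UNIV (g s)"
      unfolding g_def[abs_def] using F \<delta> by (intro continuous_intros) auto
    fix p assume "R < \<bar>fst p\<bar> \<or> R < snd p"
    then have "1 < F p" using supp[of p] by (meson not_le)
    then have "1 < F p / \<delta>" using \<delta> by (simp add: less_divide_eq)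
    then show "g s p = 0" using that by (simp add: g_def)
  qed
  have gb: "0 \<le> g s p" "g s p \<le> 1" for s p by (auto simp: g_def)
  have g1: "g 1 p = 1" if "F p \<le> 0" for p using that \<delta> by (simp add: g_def divide_nonpos_pos)
  have g0: "g 0 p = 0" if "\<not> F p \<le> 0" for p
  proof -
    have "0 < F p / \<delta>" using that \<delta> by simp
    then show ?thesis by (simp add: g_def)
  qed
  have gs: "g s p = 0" if "s \<le> 1" "1 < F p" for s p
  proof -
    have "1 < F p / \<delta>" using that \<delta> by (simp add: less_divide_eq)
    then show ?thesis using that by (simp add: g_def)
  qed
  have glim: "g s (lim.pt k) = (if F (lim.pt k) \<le> 0 then 1 else 0)" if "s = 0 \<or> s = 1" for s k
  proof (cases "F (lim.pt k) \<le> 1")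
    case True
    show ?thesis
    proof (cases "F (lim.pt k) \<le> 0")
      case le: True
      then have "F (lim.pt k) / \<delta> < - 1" using \<delta>(3)[OF True] \<delta>(1) by (simp add: divide_less_eq)
      then show ?thesis using that le by (auto simp: g_def)
    next
      case False
      then have "1 < F (lim.pt k) / \<delta>" using \<delta>(3)[OF True] \<delta>(1) by (simp add: less_divide_eq)
      then show ?thesis using that False by (auto simp: g_def)
    qed
  next
    case False
    then show ?thesis using gs[of s "lim.pt k"] that by auto
  qed
  have sum_eq: "(\<Sum>\<^sub>\<infinity>k. g s (q k)) = (\<Sum>k\<in>{k. F (q k) \<le> 1}. g s (q k))"
    if "\<And>R. finite {k. \<bar>fst (q k)\<bar> \<le> R \<and> snd (q k) \<le> R}" "s \<le> 1" for q :: "int \<Rightarrow> real \<times> real" and s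
  proof -
    have "(\<Sum>\<^sub>\<infinity>k. g s (q k)) = (\<Sum>\<^sub>\<infinity>k\<in>{k. F (q k) \<le> 1}. g s (q k))"
      by (rule infsum_cong_neutral) (use gs[OF that(2)] in auto)
    also have "\<dots> = (\<Sum>k\<in>{k. F (q k) \<le> 1}. g s (q k))"
      by (rule infsum_finite, rule finF[OF that(1)]) simp
    finally show ?thesis .
  qed
  have limval: "(\<Sum>\<^sub>\<infinity>k. g s (lim.pt k)) = real (card {k. F (lim.pt k) \<le> 0})" if "s = 0 \<or> s = 1" for s
  proof -
    have "(\<Sum>\<^sub>\<infinity>k. g s (lim.pt k)) = (\<Sum>k\<in>{k. F (lim.pt k) \<le> 1}. if F (lim.pt k) \<le> 0 then 1 else 0)"
      using that by (subst sum_eq[OF lim.finite_pt]) (auto simp: glim)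
    also have "\<dots> = (\<Sum>k\<in>{k. F (lim.pt k) \<le> 0}. 1)"
      using fin by (intro sum.mono_neutral_cong_right) auto
    finally show ?thesis by simp
  qed
  have lower: "(\<Sum>\<^sub>\<infinity>k. g 0 (sq.pt n k)) \<le> real (card {k. F (sq.pt n k) \<le> 0})" for n
  proof -
    have "(\<Sum>\<^sub>\<infinity>k. g 0 (sq.pt n k)) = (\<Sum>\<^sub>\<infinity>k\<in>{k. F (sq.pt n k) \<le> 0}. g 0 (sq.pt n k))"
      by (rule infsum_cong_neutral) (use g0 in auto)
    also have "\<dots> = (\<Sum>k\<in>{k. F (sq.pt n k) \<le> 0}. g 0 (sq.pt n k))"
      by (rule infsum_finite, rule finF[OF sq.finite_pt]) simp
    also have "\<dots> \<le> of_nat (card {k. F (sq.pt n k) \<le> 0}) * 1"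
      by (intro sum_bounded_above gb)
    finally show ?thesis by simp
  qed
  have upper: "real (card {k. F (sq.pt n k) \<le> 0}) \<le> (\<Sum>\<^sub>\<infinity>k. g 1 (sq.pt n k))" for n
  proof -
    have "real (card {k. F (sq.pt n k) \<le> 0}) = (\<Sum>k\<in>{k. F (sq.pt n k) \<le> 0}. g 1 (sq.pt n k))"
      by (simp add: g1)
    also have "\<dots> \<le> (\<Sum>k\<in>{k. F (sq.pt n k) \<le> 1}. g 1 (sq.pt n k))"
      using finF[OF sq.finite_pt, of 1 n] gb by (intro sum_mono2) auto
    also have "\<dots> = (\<Sum>\<^sub>\<infinity>k. g 1 (sq.pt n k))"
      by (subst sum_eq[OF sq.finite_pt]) auto
    finally show ?thesis .
  qed
  let ?c = "real (card {k. F (lim.pt k) \<le> 0})"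
  have "(\<lambda>n. \<Sum>\<^sub>\<infinity>k. g 0 (sq.pt n k)) \<longlonglongrightarrow> ?c" "(\<lambda>n. \<Sum>\<^sub>\<infinity>k. g 1 (sq.pt n k)) \<longlonglongrightarrow> ?c"
    using window_fun_tendsto[OF wf R, of 0] window_fun_tendsto[OF wf R, of 1] by (simp_all add: limval)
  then have "(\<lambda>n. real (card {k. F (sq.pt n k) \<le> 0})) \<longlonglongrightarrow> ?c"
    by (rule tendsto_sandwich[rotated 2]) (simp_all add: lower upper)
  \<comment> \<open>Integers at distance less than 1 coincide.\<close>
  then have "eventually (\<lambda>n. dist (real (card {k. F (sq.pt n k) \<le> 0})) ?c < 1) sequentially"
    by (rule tendstoD) simp
  then show ?thesis by eventually_elim (simp add: dist_real_def)
qed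

text \<open>Every deep limit trap gets a small box in position and inverse depth that contains no
  other limit trap. Counting shows that eventually each box holds exactly one trap of
  \<open>Ws n\<close>, and counting in the whole deep window shows that there are no further ones.
  The assumptions on \<open>L\<close> and \<open>e\<close> keep limit atoms off the boundary of that
  window.\<close>

lemma matching:
  assumes L: "0 < L" "\<And>k. \<bar>x k\<bar> \<noteq> L" and e: "0 < e" "\<And>k. d k \<noteq> e"
  defines "I \<equiv> {k. \<bar>x k\<bar> \<le> L \<and> e \<le> d k}"
  obtains \<sigma> where "\<And>i. i \<in> I \<Longrightarrow> (\<lambda>n. xs n (\<sigma> n i)) \<longlonglongrightarrow> x i"
    "\<And>i. i \<in> I \<Longrightarrow> (\<lambda>n. ds n (\<sigma> n i)) \<longlonglongrightarrow> d i"
    "eventually (\<lambda>n. bij_betw (\<sigma> n) I {k. \<bar>xs n k\<bar> \<le> L \<and> e \<le> ds n k}) sequentially"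
proof -
  have fin: "finite I" unfolding I_def using e(1) by (rule lim.finite_deep)
  define c where "c = 1 / e"
  have c: "0 < c" using e by (simp add: c_def)
  have le_c: "e \<le> a \<longleftrightarrow> 1 / a \<le> c" if "0 < a" for a :: real
    using that e(1) by (simp add: c_def field_simps)
  have v: "1 / d k \<noteq> c" for k using e lim.d_pos[of k] by (auto simp: c_def field_simps)
  define F where "F p = max (\<bar>fst p\<bar> - L) (snd p - c)" for p :: "real \<times> real"
  have F_lim: "{k. F (lim.pt k) \<le> 0} = I"
    using le_c[OF lim.d_pos] by (auto simp: F_def lim.pt_def I_def)
  have F_seq: "{k. F (sq.pt n k) \<le> 0} = {k. \<bar>xs n k\<bar> \<le> L \<and> e \<le> ds n k}" for n
    using le_c[OF sq.d_pos] by (auto simp: F_def sq.pt_def)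
  have "F (lim.pt k) \<noteq> 0" for k
    using L(2)[of k] v[of k] by (auto simp: F_def lim.pt_def max_def)
  then have cardI: "eventually (\<lambda>n. card {k. \<bar>xs n k\<bar> \<le> L \<and> e \<le> ds n k} = card I) sequentially"
    unfolding F_seq[symmetric] F_lim[symmetric] using L(1) c
    by (intro count_eventually_eq[where R="L + c + 1"])
       (auto simp: F_def[abs_def] intro!: continuous_intros)
  have lt: "\<bar>x i\<bar> < L" "1 / d i < c" if "i \<in> I" for i
    using that L(2)[of i] v[of i] le_c[OF lim.d_pos, of i] by (auto simp: I_def)
  \<comment> \<open>The first two conditions keep the boxes inside the deep window, the third makes
    them disjoint; \<open>I\<close> is finite, so one radius serves all.\<close>
  have ev1: "eventually (\<lambda>r. \<forall>i\<in>I. r < L - \<bar>x i\<bar> \<and> r < c - 1 / d i \<and> (\<forall>j\<in>I - {i}. r < \<bar>x i - x j\<bar> / 2)) (at_right 0)"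
    using lt lim.inj_x fin
    by (intro eventually_ball_finite ballI eventually_conj order_tendstoD(2)[OF tendsto_ident_at])
       (auto dest: injD)
  have "\<exists>r. 0 < r \<and> (\<forall>i\<in>I. r < L - \<bar>x i\<bar> \<and> r < c - 1 / d i \<and> (\<forall>j\<in>I - {i}. r < \<bar>x i - x j\<bar> / 2))"
    by (rule eventually_happens'[OF trivial_limit_at_right_real eventually_conj[OF eventually_at_right_less ev1]])
  then obtain r0 where "0 < r0 \<and> (\<forall>i\<in>I. r0 < L - \<bar>x i\<bar> \<and> r0 < c - 1 / d i \<and> (\<forall>j\<in>I - {i}. r0 < \<bar>x i - x j\<bar> / 2))" ..
  then have r0: "0 < r0" "\<And>i. i \<in> I \<Longrightarrow> r0 < L - \<bar>x i\<bar>" "\<And>i. i \<in> I \<Longrightarrow> r0 < c - 1 / d i"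
      "\<And>i j. i \<in> I \<Longrightarrow> j \<in> I \<Longrightarrow> j \<noteq> i \<Longrightarrow> r0 < \<bar>x i - x j\<bar> / 2"
    by blast+
  define box where "box i r = {p::real \<times> real. \<bar>fst p - x i\<bar> \<le> r \<and> \<bar>snd p - 1 / d i\<bar> \<le> r}" for i r
  have box_lim: "{k. lim.pt k \<in> box i r} = {i}" if i: "i \<in> I" and r: "0 < r" "r \<le> r0" for i r
  proof -
    have "k = i" if k: "lim.pt k \<in> box i r" for k
    proof (rule ccontr)
      assume "k \<noteq> i"
      have "\<bar>x k\<bar> \<le> L" "1 / d k \<le> c" using k r r0(2,3)[OF i] by (auto simp: box_def lim.pt_def)
      then have "k \<in> I" using le_c[OF lim.d_pos] by (simp add: I_def)
      from r0(4)[OF i this \<open>k \<noteq> i\<close>] k r r0(1) show False by (auto simp: box_def lim.pt_def)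
    qed
    then show ?thesis using r by (auto simp: box_def lim.pt_def)
  qed
  have box_seq: "eventually (\<lambda>n. card {k. sq.pt n k \<in> box i r} = 1) sequentially"
    if i: "i \<in> I" and r: "0 < r" "r \<le> r0" for i r
  proof -
    define G where "G p = max \<bar>fst p - x i\<bar> \<bar>snd p - 1 / d i\<bar> - r" for p :: "real \<times> real"
    have G: "G p \<le> 0 \<longleftrightarrow> p \<in> box i r" for p by (auto simp: G_def box_def)
    have "eventually (\<lambda>n. card {k. G (sq.pt n k) \<le> 0} = card {k. G (lim.pt k) \<le> 0}) sequentially"
    proof (rule count_eventually_eq[where R="\<bar>x i\<bar> + \<bar>1 / d i\<bar> + r + 1"])
      show "continuous_on UNIV G" unfolding G_def[abs_def] by (intro continuous_intros)
      show "\<bar>fst p\<bar> \<le> \<bar>x i\<bar> + \<bar>1 / d i\<bar> + r + 1 \<and> snd p \<le> \<bar>x i\<bar> + \<bar>1 / d i\<bar> + r + 1" if "G p \<le> 1" for p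
        using that unfolding G_def by linarith
      show "G (lim.pt k) \<noteq> 0" for k
      proof (cases "k = i")
        case True
        then show ?thesis using r by (simp add: G_def lim.pt_def)
      next
        case False
        \<comment> \<open>The large box contains the trap \<open>i\<close> alone, so no other limit
          trap can lie on the boundary of a smaller box around it.\<close>
        then have "lim.pt k \<notin> box i r0" using box_lim[OF i r0(1)] by auto
        then show ?thesis using r by (auto simp: G_def box_def)
      qed
      show "0 < \<bar>x i\<bar> + \<bar>1 / d i\<bar> + r + 1" using r by linarith
    qed
    then show ?thesis unfolding G box_lim[OF i r] by simp
  qed
  \<comment> \<open>The choice is made in the box of radius \<open>r0\<close>. Once that box holds a
    single trap, the trap found in any smaller box must be the chosen one, and this gives
    convergence.\<close>
  define \<sigma> where "\<sigma> n i = (SOME k. sq.pt n k \<in> box i r0)" for n i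
  have \<sigma>: "eventually (\<lambda>n. sq.pt n (\<sigma> n i) \<in> box i r) sequentially" if i: "i \<in> I" and r: "0 < r" "r \<le> r0" for i r
    using box_seq[OF i r0(1) order_refl] box_seq[OF i r]
  proof eventually_elim
    fix n assume "card {k. sq.pt n k \<in> box i r0} = 1" "card {k. sq.pt n k \<in> box i r} = 1"
    then obtain a b where a: "{k. sq.pt n k \<in> box i r0} = {a}" and b: "{k. sq.pt n k \<in> box i r} = {b}"
      by (auto simp: card_1_singleton_iff)
    have "sq.pt n (\<sigma> n i) \<in> box i r0" unfolding \<sigma>_def by (rule someI[of _ a]) (use a in auto)
    then have "\<sigma> n i = a" using a by auto
    have "sq.pt n b \<in> box i r0" using b r by (auto simp: box_def)
    then have "b \<in> {k. sq.pt n k \<in> box i r0}" by simp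
    then have "b = a" unfolding a by simp
    with \<open>\<sigma> n i = a\<close> have "\<sigma> n i = b" by simp
    then show "sq.pt n (\<sigma> n i) \<in> box i r" using b by auto
  qed
  have close: "eventually (\<lambda>n. \<bar>xs n (\<sigma> n i) - x i\<bar> < r \<and> \<bar>1 / ds n (\<sigma> n i) - 1 / d i\<bar> < r) sequentially"
    if i: "i \<in> I" and r: "0 < r" for i r
  proof -
    have "eventually (\<lambda>n. sq.pt n (\<sigma> n i) \<in> box i (min r0 (r / 2))) sequentially"
      by (rule \<sigma>[OF i]) (use r r0(1) in auto)
    then show ?thesis by eventually_elim (use r in \<open>auto simp: box_def sq.pt_def\<close>)
  qed
  have lim_x: "(\<lambda>n. xs n (\<sigma> n i)) \<longlonglongrightarrow> x i" if "i \<in> I" for i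
    unfolding tendsto_iff dist_real_def
  proof (intro allI impI)
    fix r :: real assume "0 < r"
    from close[OF that this] show "eventually (\<lambda>n. \<bar>xs n (\<sigma> n i) - x i\<bar> < r) sequentially" by eventually_elim simp
  qed
  have "(\<lambda>n. 1 / ds n (\<sigma> n i)) \<longlonglongrightarrow> 1 / d i" if "i \<in> I" for i
    unfolding tendsto_iff dist_real_def
  proof (intro allI impI)
    fix r :: real assume "0 < r"
    from close[OF that this] show "eventually (\<lambda>n. \<bar>1 / ds n (\<sigma> n i) - 1 / d i\<bar> < r) sequentially" by eventually_elim simp
  qed
  then have lim_d: "(\<lambda>n. ds n (\<sigma> n i)) \<longlonglongrightarrow> d i" if "i \<in> I" for i
    using tendsto_inverse[of "\<lambda>n. 1 / ds n (\<sigma> n i)" "1 / d i"] that lim.d_pos[of i] by simp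
  have "eventually (\<lambda>n. \<forall>i\<in>I. sq.pt n (\<sigma> n i) \<in> box i r0) sequentially"
    using \<sigma>[OF _ r0(1) order_refl] by (intro eventually_ball_finite fin ballI) auto
  then have bij: "eventually (\<lambda>n. bij_betw (\<sigma> n) I {k. \<bar>xs n k\<bar> \<le> L \<and> e \<le> ds n k}) sequentially"
    using cardI
  proof eventually_elim
    fix n assume box: "\<forall>i\<in>I. sq.pt n (\<sigma> n i) \<in> box i r0" and card: "card {k. \<bar>xs n k\<bar> \<le> L \<and> e \<le> ds n k} = card I"
    have inj: "inj_on (\<sigma> n) I"
    proof (rule inj_onI, rule ccontr)
      fix i j assume ij: "i \<in> I" "j \<in> I" "\<sigma> n i = \<sigma> n j" "i \<noteq> j"
      have "\<bar>xs n (\<sigma> n i) - x i\<bar> \<le> r0" "\<bar>xs n (\<sigma> n i) - x j\<bar> \<le> r0"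
        using box ij(1,2) ij(3) by (auto simp: box_def sq.pt_def)
      then have "\<bar>x i - x j\<bar> \<le> 2 * r0" unfolding abs_le_iff by linarith
      then have "\<bar>x i - x j\<bar> / 2 \<le> r0" by simp
      then show False using r0(4)[of i j] ij by auto
    qed
    have sub: "\<sigma> n ` I \<subseteq> {k. \<bar>xs n k\<bar> \<le> L \<and> e \<le> ds n k}"
    proof
      fix k assume "k \<in> \<sigma> n ` I"
      then obtain i where i: "i \<in> I" "k = \<sigma> n i" by auto
      have "\<bar>xs n k - x i\<bar> \<le> r0" "\<bar>1 / ds n k - 1 / d i\<bar> \<le> r0"
        using box i by (auto simp: box_def sq.pt_def)
      then have "\<bar>xs n k\<bar> \<le> L" "1 / ds n k \<le> c" using r0(2,3)[OF i(1)] by linarith+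
      then show "k \<in> {k. \<bar>xs n k\<bar> \<le> L \<and> e \<le> ds n k}" using le_c[OF sq.d_pos] by simp
    qed
    \<comment> \<open>An injective image inside a finite set of the same cardinality is the whole
      set.\<close>
    have "\<sigma> n ` I = {k. \<bar>xs n k\<bar> \<le> L \<and> e \<le> ds n k}"
      using sq.finite_deep[OF e(1)] sub card card_image[OF inj] by (intro card_subset_eq) auto
    then show "bij_betw (\<sigma> n) I {k. \<bar>xs n k\<bar> \<le> L \<and> e \<le> ds n k}" using inj by (simp add: bij_betw_def)
  qed
  show thesis by (rule that[OF lim_x lim_d bij])
qed

end

section \<open>Convergence of finite systems\<close>

text \<open>The complements of a finite set and of its image are both countably infinite, hence in
  bijection. The extension to all indices is wanted because the clocks form a family over all of
  \<open>int\<close>, and relabelling them preserves their law along a globally injective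
  map.\<close>

lemma finite_inj_on_extend:
  fixes \<sigma> :: "int \<Rightarrow> int"
  assumes I: "finite I" and inj: "inj_on \<sigma> I"
  obtains \<pi> where "inj \<pi>" "\<And>i. i \<in> I \<Longrightarrow> \<pi> i = \<sigma> i"
proof -
  define f where "f i = from_nat_into (- (\<sigma> ` I)) (to_nat_on (- I) i)" for i
  have inf: "infinite (- I)" "infinite (- (\<sigma> ` I))" using I by (auto simp: Compl_eq_Diff_UNIV infinite_UNIV_int)
  have bij: "bij_betw (to_nat_on (- I)) (- I) UNIV" "bij_betw (from_nat_into (- (\<sigma> ` I))) UNIV (- (\<sigma> ` I))"
    using inf by (auto intro!: to_nat_on_infinite bij_betw_from_nat_into)
  have "bij_betw f (- I) (- (\<sigma> ` I))"
    using bij_betw_trans[OF bij] by (simp add: f_def[abs_def] comp_def)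
  then have f: "inj_on f (- I)" "f ` (- I) = - (\<sigma> ` I)" by (auto simp: bij_betw_def)
  define \<pi> where "\<pi> i = (if i \<in> I then \<sigma> i else f i)" for i
  have "inj \<pi>"
  proof (rule injI)
    fix i j assume eq: "\<pi> i = \<pi> j"
    have "f k \<notin> \<sigma> ` I" if "k \<notin> I" for k using f(2) that by blast
    then show "i = j"
      using eq inj f(1) by (simp add: \<pi>_def inj_on_def split: if_splits) (metis imageI)+
  qed
  then show thesis by (rule that) (simp add: \<pi>_def)
qed

lemma departure_reindex:
  assumes "inj \<pi>"
  shows "departure x d (\<pi> ` J) (\<pi> l) (\<pi> k) \<zeta> = departure (x \<circ> \<pi>) (d \<circ> \<pi>) J l k (\<zeta> \<circ> \<pi>)"
proof -
  have "{j \<in> \<pi> ` J. x (\<pi> l) \<le> x j \<and> x j \<le> x (\<pi> k)} = \<pi> ` {j \<in> J. (x \<circ> \<pi>) l \<le> (x \<circ> \<pi>) j \<and> (x \<circ> \<pi>) j \<le> (x \<circ> \<pi>) k}"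
    by auto
  then show ?thesis unfolding departure_def
    using infsum_reindex[of \<pi> "{j \<in> J. (x \<circ> \<pi>) l \<le> (x \<circ> \<pi>) j \<and> (x \<circ> \<pi>) j \<le> (x \<circ> \<pi>) k}" "\<lambda>j. d j * \<zeta> j"]
      inj_on_subset[OF assms] by (simp add: comp_def)
qed

lemma distr_exp_clocks_reindex:
  assumes "inj \<pi>"
  shows "distr exp_clocks exp_clocks (\<lambda>\<zeta>. \<zeta> \<circ> \<pi>) = exp_clocks"
  using distr_PiM_reindex[of UNIV "\<lambda>_. exp_law" \<pi> UNIV] assms exp_law.prob_space_axioms
  by (simp add: exp_clocks_def comp_def restrict_def)

lemma measurable_exp_clocks_reindex:
  "(\<lambda>\<zeta>. \<zeta> \<circ> \<pi>) \<in> measurable exp_clocks exp_clocks"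
  unfolding exp_clocks_def comp_def
  using measurable_clock[unfolded exp_clocks_def]
  by (intro measurable_PiM_single') (auto simp: space_PiM cong: measurable_cong_sets)

lemma mean_occ_reindex:
  assumes "inj \<pi>" and h: "continuous_on UNIV h"
  shows "mean_occ x d h (\<pi> ` J) (\<pi> l) (\<pi> k) = mean_occ (x \<circ> \<pi>) (d \<circ> \<pi>) h J l k"
proof -
  let ?f = "\<lambda>\<zeta>. h (departure (x \<circ> \<pi>) (d \<circ> \<pi>) J l k \<zeta>, x (\<pi> k))"
  have m: "?f \<in> borel_measurable exp_clocks"
    by (rule measurable_compose[OF _ borel_measurable_continuous_onI[OF h]], rule borel_measurable_Pair) measurable
  have "(LINT \<zeta>|exp_clocks. ?f \<zeta>) = (LINT \<zeta>|distr exp_clocks exp_clocks (\<lambda>\<zeta>. \<zeta> \<circ> \<pi>). ?f \<zeta>)"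
    unfolding distr_exp_clocks_reindex[OF assms(1)] ..
  also have "\<dots> = (LINT \<zeta>|exp_clocks. ?f (\<zeta> \<circ> \<pi>))"
    by (rule integral_distr[OF measurable_exp_clocks_reindex m])
  finally show ?thesis by (simp add: mean_occ_def departure_reindex[OF assms(1)])
qed

text \<open>The clocks are i.i.d., so only the traps matter and not their labels. The deep traps of
  every environment can thus be carried to one index set, driven by the same clocks, which reduces
  convergence of fluxes to pointwise convergence.\<close>

lemma flux_reindex:
  assumes "inj \<pi>" "continuous_on UNIV h"
  shows "flux x d u h (\<pi> ` J) = flux (x \<circ> \<pi>) (d \<circ> \<pi>) u h J"
  unfolding flux_def
  by (simp add: infsum_reindex[OF inj_on_subset[OF assms(1)]] comp_def
      mean_occ_reindex[OF assms, unfolded comp_def])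

text \<open>The limit positions are distinct, so eventually the finitely many traps stand in their
  limiting order. From then on the departure time is a sum over a fixed index set.\<close>

lemma departure_tendsto:
  fixes X D :: "nat \<Rightarrow> int \<Rightarrow> real"
  assumes I: "finite I" and x: "\<And>i. i \<in> I \<Longrightarrow> (\<lambda>n. X n i) \<longlonglongrightarrow> x i"
    and d: "\<And>i. i \<in> I \<Longrightarrow> (\<lambda>n. D n i) \<longlonglongrightarrow> d i" and inj: "inj_on x I" and l: "l \<in> I" and k: "k \<in> I"
  shows "(\<lambda>n. departure (X n) (D n) I l k \<zeta>) \<longlonglongrightarrow> departure x d I l k \<zeta>"
    and "eventually (\<lambda>n. X n l \<le> X n k \<longleftrightarrow> x l \<le> x k) sequentially"
proof -
  have less: "eventually (\<lambda>n. X n i < X n j) sequentially" if "i \<in> I" "j \<in> I" "x i < x j" for i j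
    using order_tendstoD(1)[OF tendsto_diff[OF x[OF that(2)] x[OF that(1)]], of 0] that(3) by simp
  have le: "eventually (\<lambda>n. X n i \<le> X n j \<longleftrightarrow> x i \<le> x j) sequentially" if "i \<in> I" "j \<in> I" for i j
  proof (cases "x i" "x j" rule: linorder_cases)
    case less': less
    show ?thesis using less[OF that less'] less' by (auto elim: eventually_mono)
  next
    case equal
    then have "i = j" using inj that by (auto dest: inj_onD)
    then show ?thesis by simp
  next
    case greater
    show ?thesis using less[OF that(2,1) greater] greater by (auto elim!: eventually_mono)
  qed
  show "eventually (\<lambda>n. X n l \<le> X n k \<longleftrightarrow> x l \<le> x k) sequentially" by (rule le[OF l k])
  have "eventually (\<lambda>n. \<forall>j\<in>I. (X n l \<le> X n j \<longleftrightarrow> x l \<le> x j) \<and> (X n j \<le> X n k \<longleftrightarrow> x j \<le> x k)) sequentially"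
    using l k le by (intro eventually_ball_finite I ballI eventually_conj) auto
  then have ev: "eventually (\<lambda>n. departure (X n) (D n) I l k \<zeta> = (\<Sum>j\<in>{j\<in>I. x l \<le> x j \<and> x j \<le> x k}. D n j * \<zeta> j)) sequentially"
  proof eventually_elim
    fix n assume "\<forall>j\<in>I. (X n l \<le> X n j \<longleftrightarrow> x l \<le> x j) \<and> (X n j \<le> X n k \<longleftrightarrow> x j \<le> x k)"
    then have "{j\<in>I. X n l \<le> X n j \<and> X n j \<le> X n k} = {j\<in>I. x l \<le> x j \<and> x j \<le> x k}"
      by auto
    then show "departure (X n) (D n) I l k \<zeta> = (\<Sum>j\<in>{j\<in>I. x l \<le> x j \<and> x j \<le> x k}. D n j * \<zeta> j)"
      using I by (simp add: departure_def)
  qed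
  have "(\<lambda>n. \<Sum>j\<in>{j\<in>I. x l \<le> x j \<and> x j \<le> x k}. D n j * \<zeta> j) \<longlonglongrightarrow> (\<Sum>j\<in>{j\<in>I. x l \<le> x j \<and> x j \<le> x k}. d j * \<zeta> j)"
    using d by (intro tendsto_intros) auto
  also have "(\<Sum>j\<in>{j\<in>I. x l \<le> x j \<and> x j \<le> x k}. d j * \<zeta> j) = departure x d I l k \<zeta>"
    using I by (simp add: departure_def)
  finally show "(\<lambda>n. departure (X n) (D n) I l k \<zeta>) \<longlonglongrightarrow> departure x d I l k \<zeta>"
    by (rule tendsto_cong[THEN iffD2, OF ev])
qed

lemma mean_occ_tendsto:
  fixes X D :: "nat \<Rightarrow> int \<Rightarrow> real"
  assumes I: "finite I" and x: "\<And>i. i \<in> I \<Longrightarrow> (\<lambda>n. X n i) \<longlonglongrightarrow> x i"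
    and d: "\<And>i. i \<in> I \<Longrightarrow> (\<lambda>n. D n i) \<longlonglongrightarrow> d i" and inj: "inj_on x I" and l: "l \<in> I" and k: "k \<in> I"
    and h: "continuous_on UNIV h" and bound: "\<forall>p. \<bar>h p\<bar> \<le> B"
  shows "(\<lambda>n. mean_occ (X n) (D n) h I l k) \<longlonglongrightarrow> mean_occ x d h I l k"
proof -
  have isCont: "isCont h p" for p using h continuous_on_eq_continuous_at[of UNIV h] by blast
  have "(\<lambda>n. LINT \<zeta>|exp_clocks. h (departure (X n) (D n) I l k \<zeta>, X n k)) \<longlonglongrightarrow> (LINT \<zeta>|exp_clocks. h (departure x d I l k \<zeta>, x k))"
  proof (rule integral_dominated_convergence)
    show "AE \<zeta> in exp_clocks. (\<lambda>n. h (departure (X n) (D n) I l k \<zeta>, X n k)) \<longlonglongrightarrow> h (departure x d I l k \<zeta>, x k)"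
      by (intro AE_I2 isCont_tendsto_compose[OF isCont] tendsto_Pair departure_tendsto x d inj I l k)
    show "integrable exp_clocks (\<lambda>_. B)" by simp
  qed (use bound in \<open>auto intro: borel_measurable_integrable[OF integrable_departure[OF h bound]]\<close>)
  then have lim: "(\<lambda>n. if x l \<le> x k then D n k * (LINT \<zeta>|exp_clocks. h (departure (X n) (D n) I l k \<zeta>, X n k)) else 0) \<longlonglongrightarrow> mean_occ x d h I l k"
    unfolding mean_occ_def using d[OF k] by (auto intro!: tendsto_intros)
  have "eventually (\<lambda>n. X n l \<le> X n k \<longleftrightarrow> x l \<le> x k) sequentially"
    using I x d inj l k by (rule departure_tendsto(2))
  then show ?thesis
    by (intro Lim_transform_eventually[OF lim]) (auto elim!: eventually_mono simp: mean_occ_def)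
qed

lemma flux_tendsto:
  fixes X D :: "nat \<Rightarrow> int \<Rightarrow> real"
  assumes I: "finite I" and x: "\<And>i. i \<in> I \<Longrightarrow> (\<lambda>n. X n i) \<longlonglongrightarrow> x i"
    and d: "\<And>i. i \<in> I \<Longrightarrow> (\<lambda>n. D n i) \<longlonglongrightarrow> d i" and inj: "inj_on x I"
    and h: "continuous_on UNIV h" and bound: "\<forall>p. \<bar>h p\<bar> \<le> B"
    and u: "continuous_on UNIV u"
  shows "(\<lambda>n. flux (X n) (D n) u h I) \<longlonglongrightarrow> flux x d u h I"
proof -
  have flux: "flux x d u h I = (\<Sum>l\<in>I. u (x l) * d l * (\<Sum>k\<in>I. mean_occ x d h I l k))" for x d
    using I by (simp add: flux_def)
  have "isCont u z" for z using u by (simp add: continuous_on_eq_continuous_at)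
  then have "(\<lambda>n. u (X n l)) \<longlonglongrightarrow> u (x l)" if "l \<in> I" for l
    using x[OF that] by (rule isCont_tendsto_compose)
  then show ?thesis unfolding flux
    by (intro tendsto_sum tendsto_mult d mean_occ_tendsto[OF I x d inj _ _ h bound])
qed

section \<open>Shallow traps and the convergence of fluxes\<close>

lemma (in trap_data) infsum_small_depths:
  assumes "0 < e"
  shows "eventually (\<lambda>\<epsilon>. infsum d {k. \<bar>x k\<bar> \<le> L \<and> d k < \<epsilon>} < e) (at_right 0)"
proof -
  let ?K = "window L"
  have dS: "d summable_on A" if "A \<subseteq> ?K" for A
    by (rule summable_on_subset_banach[OF d_summable that])
  have "(d has_sum infsum d ?K) ?K" by (rule has_sum_infsum[OF d_summable])
  then obtain F where F: "finite F" "F \<subseteq> ?K" "dist (sum d F) (infsum d ?K) \<le> e / 2"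
    using has_sum_finite_approximation[of d ?K "infsum d ?K" "e / 2"] assms by auto
  \<comment> \<open>All of the depth except \<open>e / 2\<close> sits in the finite set
    \<open>F\<close>. A cutoff below every depth in \<open>F\<close> leaves only traps outside
    it.\<close>
  have "eventually (\<lambda>\<epsilon>. \<forall>k\<in>F. \<epsilon> < d k) (at_right 0)"
    using d_pos by (intro eventually_ball_finite F(1) ballI order_tendstoD(2)[OF tendsto_ident_at])
  then show ?thesis
  proof eventually_elim
    fix \<epsilon> assume \<epsilon>: "\<forall>k\<in>F. \<epsilon> < d k"
    have "infsum d {k. \<bar>x k\<bar> \<le> L \<and> d k < \<epsilon>} \<le> infsum d (?K - F)"
      using \<epsilon> by (intro infsum_mono_neutral dS) (auto simp: less_imp_le[OF d_pos] dest: less_asym)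
    also have "\<dots> = infsum d ?K - infsum d F"
      using F by (intro infsum_Diff dS) auto
    also have "infsum d F = sum d F" using F(1) by simp
    also have "infsum d ?K - sum d F < e" using F(3) assms unfolding dist_real_def by linarith
    finally show "infsum d {k. \<bar>x k\<bar> \<le> L \<and> d k < \<epsilon>} < e" .
  qed
qed

lemma (in trap_env) truncated_depth_infsum:
  "truncated_depth W L \<epsilon> = ennreal (infsum d {k. \<bar>x k\<bar> \<le> L \<and> d k < \<epsilon>})"
  unfolding truncated_depth_d
  by (rule nn_integral_count_space_infsum)
     (auto intro: summable_on_subset_banach[OF d_summable[of L]] less_imp_le[OF d_pos])

context trap_env_seq
begin

lemma small_depths:
  assumes tight: "((\<lambda>\<epsilon>. limsup (\<lambda>n. truncated_depth (Ws n) L \<epsilon>)) \<longlongrightarrow> 0) (at_right 0)" and e: "0 < e"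
  obtains \<epsilon> where "0 < \<epsilon>" "\<And>k. d k \<noteq> \<epsilon>" "infsum d {k. \<bar>x k\<bar> \<le> L \<and> d k < \<epsilon>} < e"
    "eventually (\<lambda>n. infsum (ds n) {k. \<bar>xs n k\<bar> \<le> L \<and> ds n k < \<epsilon>} < e) sequentially"
proof -
  have "eventually (\<lambda>\<epsilon>. limsup (\<lambda>n. truncated_depth (Ws n) L \<epsilon>) < ennreal e) (at_right 0)"
    using tight by (rule order_tendstoD(2)) (use e in simp)
  then have "eventually (\<lambda>\<epsilon>. limsup (\<lambda>n. truncated_depth (Ws n) L \<epsilon>) < ennreal e \<and>
      infsum d {k. \<bar>x k\<bar> \<le> L \<and> d k < \<epsilon>} < e) (at_right 0)"
    using lim.infsum_small_depths[OF e, of L] by (rule eventually_conj)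
  then obtain b where b: "0 < b" "\<And>\<epsilon>. 0 < \<epsilon> \<Longrightarrow> \<epsilon> < b \<Longrightarrow> limsup (\<lambda>n. truncated_depth (Ws n) L \<epsilon>) < ennreal e \<and>
      infsum d {k. \<bar>x k\<bar> \<le> L \<and> d k < \<epsilon>} < e"
    unfolding eventually_at_right_field by blast
  \<comment> \<open>The matching requires a cutoff that is not the depth of a limit trap; only
    countably many values are excluded.\<close>
  have "uncountable ({0<..<b} - range d)"
    using b(1) by (intro uncountable_minus_countable) (auto simp: uncountable_open_interval)
  then have "{0<..<b} - range d \<noteq> {}" by (metis countable_empty)
  then obtain \<epsilon> where \<epsilon>: "\<epsilon> \<in> {0<..<b} - range d" by blast
  show thesis
  proof (rule that)
    show "0 < \<epsilon>" "\<And>k. d k \<noteq> \<epsilon>" "infsum d {k. \<bar>x k\<bar> \<le> L \<and> d k < \<epsilon>} < e" using \<epsilon> b(2) by auto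
    have "limsup (\<lambda>n. truncated_depth (Ws n) L \<epsilon>) < ennreal e" using \<epsilon> b(2) by auto
    then have "eventually (\<lambda>n. truncated_depth (Ws n) L \<epsilon> < ennreal e) sequentially"
      by (rule Limsup_lessD)
    then show "eventually (\<lambda>n. infsum (ds n) {k. \<bar>xs n k\<bar> \<le> L \<and> ds n k < \<epsilon>} < e) sequentially"
      by eventually_elim
         (simp add: sq.truncated_depth_infsum ennreal_less_iff infsum_nonneg less_imp_le[OF sq.d_pos])
  qed
qed

text \<open>A three-part estimate: full against thinned flux in \<open>Ws n\<close>, thinned against
  its limit, thinned against full flux in \<open>W\<close>. The two outer parts are uniform in
  \<open>n\<close> through the depth of the removed traps. The second conclusion is kept because the
  variance bound for the particles involves the depth of the window.\<close>

lemma flux_limit: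
  fixes h :: "real \<times> real \<Rightarrow> real"
  assumes tight: "((\<lambda>\<epsilon>. limsup (\<lambda>n. truncated_depth (Ws n) L \<epsilon>)) \<longlongrightarrow> 0) (at_right 0)"
    and L: "0 < L" "\<And>k. \<bar>x k\<bar> \<noteq> L"
    and h: "continuous_on UNIV h" and bound: "\<forall>p. \<bar>h p\<bar> \<le> B"
    and modulus: "\<And>e. 0 < e \<Longrightarrow> \<exists>C\<ge>0. \<forall>s t z. \<bar>h (s, z) - h (t, z)\<bar> \<le> e + C * \<bar>s - t\<bar>"
    and u: "continuous_on UNIV u" "\<And>z. 0 \<le> u z" "\<And>z. u z \<le> U"
  shows "(\<lambda>n. flux (xs n) (ds n) u h (sq.window n L)) \<longlonglongrightarrow> flux x d u h (lim.window L)"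
    and "\<exists>M. eventually (\<lambda>n. infsum (ds n) (sq.window n L) \<le> M) sequentially"
proof -
  have U: "0 \<le> U" using u(2,3)[of 0] by linarith
  have B: "0 \<le> B" using bound[rule_format, of undefined] by linarith
  \<comment> \<open>One unit of slack is for the deep traps, whose depths only converge to those of
    the limit; the other is for the shallow ones, of total depth below
    \<open>\<delta> < 1\<close>.\<close>
  define M where "M = infsum d (lim.window L) + 2"
  have D0: "0 \<le> infsum d (lim.window L)" by (intro infsum_nonneg less_imp_le[OF lim.d_pos])
  have main: "\<exists>\<sigma> I. finite I \<and> I \<subseteq> lim.window L \<and> infsum d (lim.window L - I) < \<delta> \<and>
      eventually (\<lambda>n. finite (\<sigma> n ` I) \<and> \<sigma> n ` I \<subseteq> sq.window n L \<and> infsum (ds n) (sq.window n L - \<sigma> n ` I) < \<delta> \<and>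
        infsum (ds n) (sq.window n L) \<le> M) sequentially \<and>
      (\<lambda>n. flux (xs n) (ds n) u h (\<sigma> n ` I)) \<longlonglongrightarrow> flux x d u h I" if \<delta>: "0 < \<delta>" "\<delta> < 1" for \<delta>
  proof -
    obtain \<epsilon> where \<epsilon>: "0 < \<epsilon>" "\<And>k. d k \<noteq> \<epsilon>" "infsum d {k. \<bar>x k\<bar> \<le> L \<and> d k < \<epsilon>} < \<delta>"
      "eventually (\<lambda>n. infsum (ds n) {k. \<bar>xs n k\<bar> \<le> L \<and> ds n k < \<epsilon>} < \<delta>) sequentially"
      using small_depths[OF tight \<delta>(1)] by blast
    define I where "I = {k. \<bar>x k\<bar> \<le> L \<and> \<epsilon> \<le> d k}"
    have I: "finite I" unfolding I_def by (rule lim.finite_deep[OF \<epsilon>(1)])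
    obtain \<sigma> where \<sigma>: "\<And>i. i \<in> I \<Longrightarrow> (\<lambda>n. xs n (\<sigma> n i)) \<longlonglongrightarrow> x i"
      "\<And>i. i \<in> I \<Longrightarrow> (\<lambda>n. ds n (\<sigma> n i)) \<longlonglongrightarrow> d i"
      "eventually (\<lambda>n. bij_betw (\<sigma> n) I {k. \<bar>xs n k\<bar> \<le> L \<and> \<epsilon> \<le> ds n k}) sequentially"
      using matching[OF L \<epsilon>(1,2)] unfolding I_def by blast
    \<comment> \<open>The matching is injective only for large \<open>n\<close>. For the remaining
      \<open>n\<close> the identity serves as a default, so that relabelling is valid for every
      \<open>n\<close>.\<close>
    have "\<exists>\<pi>. inj \<pi> \<and> (inj_on (\<sigma> n) I \<longrightarrow> (\<forall>i\<in>I. \<pi> i = \<sigma> n i))" for n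
    proof (cases "inj_on (\<sigma> n) I")
      case True
      show ?thesis by (rule finite_inj_on_extend[OF I True]) blast
    next
      case False
      then show ?thesis by (intro exI[of _ id]) simp
    qed
    then obtain \<pi> where \<pi>: "\<And>n. inj (\<pi> n)" "\<And>n. inj_on (\<sigma> n) I \<Longrightarrow> \<forall>i\<in>I. \<pi> n i = \<sigma> n i"
      by metis
    have \<pi>\<sigma>: "eventually (\<lambda>n. \<forall>i\<in>I. \<pi> n i = \<sigma> n i) sequentially"
      using \<sigma>(3) by eventually_elim (use \<pi>(2) in \<open>auto simp: bij_betw_def\<close>)
    have lim_x: "(\<lambda>n. (xs n \<circ> \<pi> n) i) \<longlonglongrightarrow> x i" if "i \<in> I" for i
      by (rule Lim_transform_eventually[OF \<sigma>(1)[OF that]])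
         (use \<pi>\<sigma> in eventually_elim, use that in simp)
    have lim_d: "(\<lambda>n. (ds n \<circ> \<pi> n) i) \<longlonglongrightarrow> d i" if "i \<in> I" for i
      by (rule Lim_transform_eventually[OF \<sigma>(2)[OF that]])
         (use \<pi>\<sigma> in eventually_elim, use that in simp)
    have img: "eventually (\<lambda>n. \<pi> n ` I = {k. \<bar>xs n k\<bar> \<le> L \<and> \<epsilon> \<le> ds n k}) sequentially"
      using \<sigma>(3) \<pi>\<sigma> by eventually_elim (auto simp: bij_betw_def)
    have split: "{k. \<bar>a k\<bar> \<le> L} - {k. \<bar>a k\<bar> \<le> L \<and> \<epsilon> \<le> b k} = {k. \<bar>a k\<bar> \<le> L \<and> b k < \<epsilon>}" for a b :: "int \<Rightarrow> real"
      by auto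
    have "(\<lambda>n. \<Sum>i\<in>I. (ds n \<circ> \<pi> n) i) \<longlonglongrightarrow> (\<Sum>i\<in>I. d i)"
      by (intro tendsto_sum lim_d)
    then have "eventually (\<lambda>n. (\<Sum>i\<in>I. (ds n \<circ> \<pi> n) i) < (\<Sum>i\<in>I. d i) + 1) sequentially"
      by (rule order_tendstoD) simp
    moreover have "(\<Sum>i\<in>I. d i) \<le> infsum d (lim.window L)"
    proof -
      have "infsum d I \<le> infsum d (lim.window L)"
        using I by (intro infsum_mono_neutral summable_on_finite lim.d_summable) (auto simp: I_def less_imp_le[OF lim.d_pos])
      then show ?thesis using I by simp
    qed
    ultimately have ev: "eventually (\<lambda>n. (\<Sum>i\<in>I. (ds n \<circ> \<pi> n) i) < infsum d (lim.window L) + 1) sequentially"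
      by (auto elim!: eventually_mono)
    have "eventually (\<lambda>n. finite (\<pi> n ` I) \<and> \<pi> n ` I \<subseteq> sq.window n L \<and> infsum (ds n) (sq.window n L - \<pi> n ` I) < \<delta> \<and>
        infsum (ds n) (sq.window n L) \<le> M) sequentially"
      using img \<epsilon>(4) ev
    proof eventually_elim
      fix n assume n: "\<pi> n ` I = {k. \<bar>xs n k\<bar> \<le> L \<and> \<epsilon> \<le> ds n k}"
        "infsum (ds n) {k. \<bar>xs n k\<bar> \<le> L \<and> ds n k < \<epsilon>} < \<delta>"
        "(\<Sum>i\<in>I. (ds n \<circ> \<pi> n) i) < infsum d (lim.window L) + 1"
      have small: "infsum (ds n) (sq.window n L - \<pi> n ` I) < \<delta>"
        unfolding n(1) split by (rule n(2))
      have "infsum (ds n) (sq.window n L - \<pi> n ` I) = infsum (ds n) (sq.window n L) - infsum (ds n) (\<pi> n ` I)"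
        unfolding n(1) by (intro infsum_Diff sq.d_summable summable_on_finite sq.finite_deep \<epsilon>(1)) auto
      moreover have "infsum (ds n) (\<pi> n ` I) = (\<Sum>i\<in>I. (ds n \<circ> \<pi> n) i)"
        using I sum.reindex[OF inj_on_subset[OF \<pi>(1)[of n]], of I "ds n"] by simp
      ultimately have "infsum (ds n) (sq.window n L) \<le> M"
        using small n(3) \<delta> by (simp add: M_def)
      then show "finite (\<pi> n ` I) \<and> \<pi> n ` I \<subseteq> sq.window n L \<and> infsum (ds n) (sq.window n L - \<pi> n ` I) < \<delta> \<and>
        infsum (ds n) (sq.window n L) \<le> M"
        using sq.finite_deep[OF \<epsilon>(1)] small unfolding n(1) by auto
    qed
    moreover have "(\<lambda>n. flux (xs n) (ds n) u h (\<pi> n ` I)) \<longlonglongrightarrow> flux x d u h I"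
      unfolding flux_reindex[OF \<pi>(1) h]
      using I lim_x lim_d _ h bound u(1)
    proof (rule flux_tendsto)
      show "inj_on x I" by (rule inj_on_subset[OF lim.inj_x]) simp
    qed
    moreover have "infsum d (lim.window L - I) < \<delta>"
      unfolding I_def split by (rule \<epsilon>(3))
    moreover have "I \<subseteq> lim.window L" by (auto simp: I_def)
    ultimately show ?thesis using I by blast
  qed
  show "\<exists>M. eventually (\<lambda>n. infsum (ds n) (sq.window n L) \<le> M) sequentially"
  proof -
    have half: "0 < (1/2::real)" "(1/2::real) < 1" by simp_all
    obtain \<sigma> :: "nat \<Rightarrow> int \<Rightarrow> int" and I where "eventually (\<lambda>n. finite (\<sigma> n ` I) \<and> \<sigma> n ` I \<subseteq> sq.window n L \<and> infsum (ds n) (sq.window n L - \<sigma> n ` I) < 1/2 \<and>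
        infsum (ds n) (sq.window n L) \<le> M) sequentially"
      using main[OF half] by blast
    then show ?thesis by (intro exI[of _ M]) (auto elim: eventually_mono)
  qed
  show "(\<lambda>n. flux (xs n) (ds n) u h (sq.window n L)) \<longlonglongrightarrow> flux x d u h (lim.window L)"
  proof (rule tendstoI)
    fix \<kappa> :: real assume \<kappa>: "0 < \<kappa>"
    \<comment> \<open>This is the part of the truncation error that does not vanish with
      \<open>\<delta>\<close>: with depths bounded by \<open>M\<close> it is
      \<open>U * M * M * e\<close>, now at most \<open>\<kappa> / 4\<close>. The added 1 avoids
      division by 0.\<close>
    define e where "e = \<kappa> / (4 * (U * M * M + 1))"
    have M0: "0 \<le> M" using D0 by (simp add: M_def)
    have UM: "0 \<le> U * M * M" using U M0 by simp
    have e: "0 < e" using \<kappa> UM unfolding e_def by (intro divide_pos_pos) auto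
    have UMe: "U * M * M * e < \<kappa> / 3"
    proof -
      have "U * M * M * e \<le> (U * M * M + 1) * e" using e by (simp add: algebra_simps)
      also have "\<dots> = \<kappa> / 4" using UM unfolding e_def by (simp add: field_simps add_nonneg_eq_0_iff)
      finally show ?thesis using \<kappa> by simp
    qed
    obtain C where C: "0 \<le> C" "\<And>s t z. \<bar>h (s, z) - h (t, z)\<bar> \<le> e + C * \<bar>s - t\<bar>"
      using modulus[OF e] by blast
    \<comment> \<open>The bound of \<open>flux_diff\<close> with the depth of the window replaced by
      \<open>M\<close>, so that it applies to \<open>W\<close> and, eventually, to all
      \<open>Ws n\<close>. At \<open>\<delta> = 0\<close> it reduces to
      \<open>U * M * M * e\<close>.\<close>
    define b where "b \<delta> = U * M * (B * \<delta> + M * (e + C * \<delta>)) + U * \<delta> * (B * M)" for \<delta>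
    have "(b \<longlongrightarrow> U * M * (B * 0 + M * (e + C * 0)) + U * 0 * (B * M)) (at_right 0)"
      unfolding b_def by (intro tendsto_intros)
    then have "eventually (\<lambda>\<delta>. b \<delta> < \<kappa> / 3) (at_right 0)"
      by (rule order_tendstoD) (use UMe in \<open>simp add: mult.assoc\<close>)
    moreover have "eventually (\<lambda>\<delta>::real. \<delta> < 1) (at_right 0)"
      by (rule order_tendstoD(2)[OF tendsto_ident_at]) simp
    ultimately have "\<exists>\<delta>. (b \<delta> < \<kappa> / 3 \<and> \<delta> < 1) \<and> 0 < \<delta>"
      by (intro eventually_happens'[OF trivial_limit_at_right_real eventually_conj[OF eventually_conj eventually_at_right_less]])
    then obtain \<delta> where \<delta>: "b \<delta> < \<kappa> / 3" "\<delta> < 1" "0 < \<delta>" by blast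
    obtain \<sigma> I where I: "finite I" "I \<subseteq> lim.window L" "infsum d (lim.window L - I) < \<delta>"
      and ev: "eventually (\<lambda>n. finite (\<sigma> n ` I) \<and> \<sigma> n ` I \<subseteq> sq.window n L \<and> infsum (ds n) (sq.window n L - \<sigma> n ` I) < \<delta> \<and>
        infsum (ds n) (sq.window n L) \<le> M) sequentially"
      and lim: "(\<lambda>n. flux (xs n) (ds n) u h (\<sigma> n ` I)) \<longlonglongrightarrow> flux x d u h I"
      using main[OF \<delta>(3,2)] by blast
    have mono: "U * D' * (B * \<delta>' + D' * (e + C * \<delta>')) + U * \<delta>' * (B * D') \<le> b \<delta>"
      if "0 \<le> D'" "D' \<le> M" "0 \<le> \<delta>'" "\<delta>' \<le> \<delta>" for D' \<delta>'
      unfolding b_def using that U B C e M0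
      by (intro add_mono mult_mono mult_nonneg_nonneg add_nonneg_nonneg order_refl) auto
    have lim_diff: "\<bar>flux x d u h (lim.window L) - flux x d u h I\<bar> < \<kappa> / 3"
    proof -
      have "\<bar>flux x d u h (lim.window L) - flux x d u h I\<bar> \<le> b \<delta>"
        using D0 I(3) less_imp_le[OF lim.d_pos]
        by (intro order_trans[OF lim.flux_diff[OF h bound C(2) C(1) less_imp_le[OF e] I(2,1) u(2,3)] mono])
           (auto simp: M_def intro: infsum_nonneg)
      then show ?thesis using \<delta>(1) by simp
    qed
    have "eventually (\<lambda>n. dist (flux (xs n) (ds n) u h (\<sigma> n ` I)) (flux x d u h I) < \<kappa> / 3) sequentially"
      using lim by (rule tendstoD) (use \<kappa> in simp)
    then show "eventually (\<lambda>n. dist (flux (xs n) (ds n) u h (sq.window n L)) (flux x d u h (lim.window L)) < \<kappa>) sequentially"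
      using ev
    proof eventually_elim
      fix n assume 1: "dist (flux (xs n) (ds n) u h (\<sigma> n ` I)) (flux x d u h I) < \<kappa> / 3"
        and 2: "finite (\<sigma> n ` I) \<and> \<sigma> n ` I \<subseteq> sq.window n L \<and> infsum (ds n) (sq.window n L - \<sigma> n ` I) < \<delta> \<and>
        infsum (ds n) (sq.window n L) \<le> M"
      have "\<bar>flux (xs n) (ds n) u h (sq.window n L) - flux (xs n) (ds n) u h (\<sigma> n ` I)\<bar> \<le> b \<delta>"
        using 2 less_imp_le[OF sq.d_pos]
        by (intro order_trans[OF sq.flux_diff[OF h bound C(2) C(1) less_imp_le[OF e] _ _ u(2,3)] mono])
           (auto intro: infsum_nonneg)
      then show "dist (flux (xs n) (ds n) u h (sq.window n L)) (flux x d u h (lim.window L)) < \<kappa>"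
        using 1 lim_diff \<delta>(1) unfolding dist_real_def by linarith
    qed
  qed
qed

end

section \<open>Duality of the right- and left-directed processes\<close>

context trap_data
begin

lemma trap_data_uminus: "trap_data (\<lambda>k. - x k) d"
proof
  show "inj (\<lambda>k. - x k)" using inj_x by (auto simp: inj_def)
  show "0 < d k" for k by (rule d_pos)
  show "d summable_on {k. \<bar>- x k\<bar> \<le> L}" for L using d_summable by simp
  obtain \<epsilon> where \<epsilon>: "0 < \<epsilon>" "\<forall>L. infinite {k. x k \<le> L \<and> \<epsilon> \<le> d k}" using deep_left by blast
  have "infinite {k. L \<le> - x k \<and> \<epsilon> \<le> d k}" for L
    using \<epsilon>(2)[rule_format, of "- L"] by (simp add: le_minus_iff)
  then show "\<exists>\<epsilon>>0. \<forall>L. infinite {k. L \<le> - x k \<and> \<epsilon> \<le> d k}" using \<epsilon>(1) by blast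
  obtain \<epsilon>' where \<epsilon>': "0 < \<epsilon>'" "\<forall>L. infinite {k. L \<le> x k \<and> \<epsilon>' \<le> d k}" using deep_right by blast
  have "infinite {k. - x k \<le> L \<and> \<epsilon>' \<le> d k}" for L
    using \<epsilon>'(2)[rule_format, of "- L"] by (simp add: minus_le_iff)
  then show "\<exists>\<epsilon>>0. \<forall>L. infinite {k. - x k \<le> L \<and> \<epsilon> \<le> d k}" using \<epsilon>'(1) by blast
qed

text \<open>Both sides involve the sum of holding times over the closed interval between
  \<open>x l\<close> and \<open>x k\<close>, which reflection maps to itself with the ends swapped.
  The depth supplied by \<open>mean_occ\<close> is that of the target, so the prefactor on either
  side completes the same product of \<open>d l\<close> and \<open>d k\<close>.\<close>

lemma mean_occ_duality:
  "d k * mean_occ (\<lambda>k. - x k) d (\<lambda>p. h (fst p, x k) * u (- snd p)) J k l = u (x l) * d l * mean_occ x d h J l k"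
proof -
  have "{j\<in>J. - x k \<le> - x j \<and> - x j \<le> - x l} = {j\<in>J. x l \<le> x j \<and> x j \<le> x k}" by auto
  then have "departure (\<lambda>k. - x k) d J k l = departure x d J l k" by (intro ext) (simp add: departure_def)
  then show ?thesis by (simp add: mean_occ_def)
qed

end

section \<open>Exchange of integrals and sums dominated by products; measurability of
  \<open>u_env\<close>\<close>

lemma (in pair_sigma_finite) integrable_pair_product_bound:
  fixes f :: "'a \<times> 'b \<Rightarrow> real"
  assumes f: "f \<in> borel_measurable (M1 \<Otimes>\<^sub>M M2)"
    and bound: "\<And>a b. a \<in> space M1 \<Longrightarrow> b \<in> space M2 \<Longrightarrow> \<bar>f (a, b)\<bar> \<le> g a * k b"
    and g: "integrable M1 g" "\<And>a. 0 \<le> g a" and k: "integrable M2 k" "\<And>b. 0 \<le> k b"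
  shows "integrable (M1 \<Otimes>\<^sub>M M2) f"
proof (rule integrableI_bounded[OF f])
  have [measurable]: "g \<in> borel_measurable M1" "k \<in> borel_measurable M2" using g k by auto
  have fin: "(\<integral>\<^sup>+a. ennreal (g a) \<partial>M1) < \<infinity>" "(\<integral>\<^sup>+b. ennreal (k b) \<partial>M2) < \<infinity>"
    using g k by (simp_all add: integrable_iff_bounded)
  have "(\<integral>\<^sup>+p. ennreal (norm (f p)) \<partial>(M1 \<Otimes>\<^sub>M M2)) \<le> (\<integral>\<^sup>+p. ennreal (g (fst p)) * ennreal (k (snd p)) \<partial>(M1 \<Otimes>\<^sub>M M2))"
    using bound g k by (intro nn_integral_mono) (auto simp: space_pair_measure ennreal_mult[symmetric] intro!: ennreal_leI)
  also have "\<dots> = (\<integral>\<^sup>+a. (\<integral>\<^sup>+b. ennreal (g a) * ennreal (k b) \<partial>M2) \<partial>M1)"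
    by (subst M2.nn_integral_fst[symmetric]) (simp_all, measurable)
  also have "\<dots> = (\<integral>\<^sup>+a. ennreal (g a) \<partial>M1) * (\<integral>\<^sup>+b. ennreal (k b) \<partial>M2)"
    by (simp add: nn_integral_cmult nn_integral_multc)
  also have "\<dots> < \<infinity>" using fin by (simp add: ennreal_mult_less_top)
  finally show "(\<integral>\<^sup>+p. ennreal (norm (f p)) \<partial>(M1 \<Otimes>\<^sub>M M2)) < \<infinity>" .
qed

lemma infsum_swap_product_bound:
  fixes f :: "'a \<Rightarrow> 'b \<Rightarrow> real"
  assumes a: "a summable_on A" "\<And>x. 0 \<le> a x" and b: "b summable_on B" "\<And>y. 0 \<le> b y"
    and bound: "\<And>x y. x \<in> A \<Longrightarrow> y \<in> B \<Longrightarrow> \<bar>f x y\<bar> \<le> a x * b y"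
  shows "(\<Sum>\<^sub>\<infinity>x\<in>A. \<Sum>\<^sub>\<infinity>y\<in>B. f x y) = (\<Sum>\<^sub>\<infinity>y\<in>B. \<Sum>\<^sub>\<infinity>x\<in>A. f x y)"
proof (rule infsum_swap_banach)
  have "(\<lambda>(x, y). a x * b y) summable_on (A \<times> B)"
  proof (rule summable_on_SigmaI)
    fix x assume "x \<in> A"
    show "((\<lambda>y. case (x, y) of (x, y) \<Rightarrow> a x * b y) has_sum a x * infsum b B) B"
      using has_sum_cmult_right[OF has_sum_infsum[OF b(1)], of "a x"] by simp
  next
    show "(\<lambda>x. a x * infsum b B) summable_on A" by (rule summable_on_cmult_left[OF a(1)])
  qed (simp add: a b)
  then show "(\<lambda>(x, y). f x y) summable_on (A \<times> B)"
    by (rule abs_infsum_le(1)) (use bound in auto)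
qed

lemma measurable_Z_left_time:
  assumes u: "u \<in> borel_measurable borel"
  shows "(\<lambda>p. u (Z_left x y (snd p) (snd (fst p)) (fst (fst p)))) \<in> borel_measurable ((borel \<Otimes>\<^sub>M borel) \<Otimes>\<^sub>M exp_clocks)"
  by (rule measurable_compose[OF _ u]) measurable

lemma measurable_u_env:
  assumes u: "u \<in> borel_measurable borel"
  shows "(\<lambda>p. u_env x y u (fst p) (snd p)) \<in> borel_measurable (borel \<Otimes>\<^sub>M borel)"
  unfolding u_env_def
  using measurable_Z_left_time[OF u]
  by (intro exp_clocks.borel_measurable_lebesgue_integral) (simp add: split_beta')

lemma u_env_bound:
  assumes u: "u \<in> borel_measurable borel" "\<And>z. 0 \<le> u z" "\<And>z. u z \<le> U"
  shows "\<bar>u_env x y u t z\<bar> \<le> U"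
proof -
  have U: "0 \<le> U" using u(2,3)[of 0] by linarith
  have m: "(\<lambda>\<zeta>. u (Z_left x y \<zeta> z t)) \<in> borel_measurable exp_clocks"
    by (rule measurable_compose[OF _ u(1)]) measurable
  have "\<bar>u_env x y u t z\<bar> \<le> (LINT \<zeta>|exp_clocks. U)"
    unfolding u_env_def
    by (rule lint_abs_bound_AE) (use u m in \<open>auto intro!: exp_clocks.integrable_const_bound[of _ U]\<close>)
  then show ?thesis using exp_clocks.prob_space by simp
qed

context trap_data
begin

text \<open>The left-directed process from \<open>x k\<close> is the right-directed one in the
  reflected environment. Its expected occupation, with \<open>h\<close> as a weight in time and
  \<open>u\<close> evaluated at the visited trap, is a sum of mean occupations, which duality turns
  into those from \<open>l\<close> to \<open>k\<close>; exchanging the two sums yields the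
  flux.\<close>

lemma left_flux:
  fixes h :: "real \<times> real \<Rightarrow> real"
  assumes h: "continuous_on UNIV h" and bound: "\<forall>p. \<bar>h p\<bar> \<le> B"
    and supp_z: "\<And>t z. L < \<bar>z\<bar> \<Longrightarrow> h (t, z) = 0" and supp_t: "\<And>t z. T < t \<Longrightarrow> h (t, z) = 0"
    and u: "continuous_on UNIV u" "\<And>z. 0 \<le> u z" "\<And>z. u z \<le> U" and supp_u: "\<And>z. L < \<bar>z\<bar> \<Longrightarrow> u z = 0"
  shows "(LINT t:{0..}|lborel. (LINT k|count_space UNIV. d k * (h (t, x k) * u_env x (\<lambda>k. ennreal (d k)) u t (x k)))) =
    flux x d u h (window L)"
proof -
  let ?K = "window L" and ?y = "\<lambda>k. ennreal (d k)"
  define v where "v t z = u_env x ?y u t z" for t z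
  have B: "0 \<le> B" using bound[rule_format, of undefined] by linarith
  have U: "0 \<le> U" using u(2,3)[of 0] by linarith
  have um: "u \<in> borel_measurable borel" by (rule borel_measurable_continuous_onI[OF u(1)])
  have hm: "h \<in> borel_measurable borel" by (rule borel_measurable_continuous_onI[OF h])
  have hk [measurable]: "(\<lambda>t. h (t, z)) \<in> borel_measurable borel" for z
    by (rule measurable_compose[OF _ hm]) (intro borel_measurable_Pair; simp)
  have v_meas [measurable]: "(\<lambda>t. v t z) \<in> borel_measurable borel" for z
    unfolding v_def using measurable_compose[OF _ measurable_u_env[OF um], of "\<lambda>t. (t, z)" borel] by simp
  have v: "\<bar>v t z\<bar> \<le> U" for t z unfolding v_def by (rule u_env_bound[OF um u(2,3)])
  \<comment> \<open>Since \<open>u_env\<close> is merely bounded in time, the integrable bound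
    needed for Fubini comes from the compact time support of \<open>h\<close>.\<close>
  define I where "I t = (indicator {0..T} t :: real)" for t
  have [measurable]: "I \<in> borel_measurable borel" unfolding I_def[abs_def] by simp
  have I: "integrable lborel I" "0 \<le> I t" for t
    by (auto simp: I_def[abs_def] integrable_indicator_iff emeasure_lborel_Icc_eq)
  have hI: "\<bar>indicator {0..} t * h (t, z)\<bar> \<le> B * I t" for t z
    using bound B supp_t[of t z] by (auto simp: I_def abs_mult split: split_indicator)
  interpret K: sigma_finite_measure "count_space ?K"
    by (rule sigma_finite_measure_count_space_countable) simp
  interpret p: pair_sigma_finite lborel "count_space ?K" ..
  interpret q: pair_sigma_finite lborel exp_clocks ..
  interpret r: trap_data "\<lambda>k. - x k" d by (rule trap_data_uminus)
  define G where "G t k = indicator {0..} t * (d k * (h (t, x k) * v t (x k)))" for t k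
  have "(LINT t:{0..}|lborel. (LINT k|count_space UNIV. d k * (h (t, x k) * v t (x k)))) =
      (LINT t|lborel. (LINT k|count_space ?K. G t k))"
    unfolding set_lebesgue_integral_def
  proof (intro Bochner_Integration.integral_cong refl)
    fix t
    have "(\<Sum>\<^sub>\<infinity>k. d k * (h (t, x k) * v t (x k))) = (\<Sum>\<^sub>\<infinity>k\<in>?K. d k * (h (t, x k) * v t (x k)))"
      by (rule infsum_cong_neutral) (use supp_z in \<open>auto simp: not_le\<close>)
    then show "indicator {0..} t *\<^sub>R (LINT k|count_space UNIV. d k * (h (t, x k) * v t (x k))) = (LINT k|count_space ?K. G t k)"
      by (simp add: G_def infsum_eq_lint_count_space)
  qed
  also have "\<dots> = (LINT k|count_space ?K. (LINT t|lborel. G t k))"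
  proof (rule p.Fubini_integral[symmetric], rule p.integrable_pair_product_bound)
    show "(\<lambda>(t, k). G t k) \<in> borel_measurable (lborel \<Otimes>\<^sub>M count_space ?K)"
      unfolding G_def by (rule measurable_split_countable) simp_all
    show "integrable lborel (\<lambda>t. B * I t)" using I(1) by simp
    show "integrable (count_space ?K) (\<lambda>k. d k * U)"
      unfolding integrable_count_space_real_iff by (rule summable_on_cmult_left[OF d_summable])
    fix t k
    have "\<bar>(indicator {0..} t * h (t, x k)) * (d k * v t (x k))\<bar> \<le> (B * I t) * (d k * U)"
      unfolding abs_mult[of "indicator {0..} t * h (t, x k)"] using hI[of t "x k"] v[of t "x k"] d_pos[of k] B I(2)[of t] U
      by (intro mult_mono) (auto simp: abs_mult)
    then show "\<bar>case (t, k) of (t, k) \<Rightarrow> G t k\<bar> \<le> B * I t * (d k * U)" by (simp add: G_def mult_ac)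
  qed (use B U I(2) d_pos in \<open>auto simp: less_imp_le\<close>)
  also have "\<dots> = (\<Sum>\<^sub>\<infinity>k\<in>?K. \<Sum>\<^sub>\<infinity>l\<in>?K. u (x l) * d l * mean_occ x d h ?K l k)"
    unfolding infsum_eq_lint_count_space[symmetric]
  proof (rule infsum_cong)
    fix k assume k: "k \<in> ?K"
    let ?g = "\<lambda>p. h (fst p, x k) * u (- snd p)"
    have g: "continuous_on UNIV ?g"
      by (intro continuous_on_mult continuous_on_compose2[OF h] continuous_on_compose2[OF u(1)])
         (auto intro!: continuous_intros)
    have gb: "\<forall>p. \<bar>?g p\<bar> \<le> B * U"
      unfolding abs_mult using bound u(2,3) B by (intro allI mult_mono) auto
    have meas: "(\<lambda>p. indicator {0..} (fst p) * (h (fst p, x k) * u (Z_left x ?y (snd p) (x k) (fst p)))) \<in> borel_measurable (lborel \<Otimes>\<^sub>M exp_clocks)"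
    proof -
      have [measurable]: "(\<lambda>p. u (Z_left x ?y (snd p) (x k) (fst p))) \<in> borel_measurable (lborel \<Otimes>\<^sub>M exp_clocks)"
        by (rule measurable_compose[OF _ um]) measurable
      have [measurable]: "(\<lambda>p. h (fst p, x k)) \<in> borel_measurable (lborel \<Otimes>\<^sub>M exp_clocks)"
        by (rule measurable_compose[OF _ hk]) simp
      show ?thesis by measurable
    qed
    have "(LINT t|lborel. G t k) = d k * (LINT t|lborel. (LINT \<zeta>|exp_clocks. indicator {0..} t * (h (t, x k) * u (Z_left x ?y \<zeta> (x k) t))))"
      unfolding G_def v_def u_env_def
      by (simp add: integral_mult_right_zero[symmetric] mult_ac del: integral_mult_right_zero integral_mult_left_zero)
    also have "\<dots> = d k * (LINT \<zeta>|exp_clocks. (LINT t|lborel. indicator {0..} t * (h (t, x k) * u (Z_left x ?y \<zeta> (x k) t))))"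
    proof (rule arg_cong[where f="\<lambda>a. d k * a"], rule q.Fubini_integral[symmetric], rule q.integrable_pair_product_bound)
      show "(\<lambda>(t, \<zeta>). indicator {0..} t * (h (t, x k) * u (Z_left x ?y \<zeta> (x k) t))) \<in> borel_measurable (lborel \<Otimes>\<^sub>M exp_clocks)"
        using meas by (simp add: split_beta')
      show "integrable lborel (\<lambda>t. B * I t)" using I(1) by simp
      show "integrable exp_clocks (\<lambda>_. U)" by simp
      fix t \<zeta>
      have "\<bar>(indicator {0..} t * h (t, x k)) * u (Z_left x ?y \<zeta> (x k) t)\<bar> \<le> (B * I t) * U"
        unfolding abs_mult[of "indicator {0..} t * h (t, x k)"] using hI[of t "x k"] u(2,3) B I(2)[of t]
        by (intro mult_mono) auto
      then show "\<bar>case (t, \<zeta>) of (t, \<zeta>) \<Rightarrow> indicator {0..} t * (h (t, x k) * u (Z_left x ?y \<zeta> (x k) t))\<bar> \<le> B * I t * U"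
        by (simp add: mult_ac)
    qed (use B U I(2) in auto)
    also have "(LINT \<zeta>|exp_clocks. (LINT t|lborel. indicator {0..} t * (h (t, x k) * u (Z_left x ?y \<zeta> (x k) t)))) =
        (LINT \<zeta>|exp_clocks. (LINT t:{0..}|lborel. ?g (t, r.Zr \<zeta> k t)))"
      unfolding set_lebesgue_integral_def by (simp add: Z_right_eq_Z_left)
    also have "\<dots> = (\<Sum>\<^sub>\<infinity>l\<in>?K. mean_occ (\<lambda>k. - x k) d ?g ?K k l)"
    proof -
      have "(LINT \<zeta>|exp_clocks. (LINT t:{0..}|lborel. ?g (t, r.Zr \<zeta> k t))) = (\<Sum>\<^sub>\<infinity>l\<in>r.window L. mean_occ (\<lambda>k. - x k) d ?g (r.window L) k l)"
        by (rule r.expected_occupation[OF g gb]) (use supp_u k in auto)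
      then show ?thesis by simp
    qed
    also have "d k * \<dots> = (\<Sum>\<^sub>\<infinity>l\<in>?K. d k * mean_occ (\<lambda>k. - x k) d ?g ?K k l)"
      by (rule infsum_cmult_right'[symmetric])
    also have "\<dots> = (\<Sum>\<^sub>\<infinity>l\<in>?K. u (x l) * d l * mean_occ x d h ?K l k)"
      by (intro infsum_cong mean_occ_duality)
    finally show "(LINT t|lborel. G t k) = (\<Sum>\<^sub>\<infinity>l\<in>?K. u (x l) * d l * mean_occ x d h ?K l k)" .
  qed
  also have "\<dots> = (\<Sum>\<^sub>\<infinity>l\<in>?K. \<Sum>\<^sub>\<infinity>k\<in>?K. u (x l) * d l * mean_occ x d h ?K l k)"
  proof (rule infsum_swap_product_bound[OF summable_on_cmult_right[OF d_summable, of B] _ summable_on_cmult_right[OF d_summable, of U]])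
    fix k l
    have "\<bar>u (x l) * d l * mean_occ x d h ?K l k\<bar> \<le> (U * d l) * (B * d k)"
      unfolding abs_mult using u(2,3)[of "x l"] d_pos[of l] mean_occ_bound[OF h bound d_pos_all, of x ?K l k]
      by (intro mult_mono) (auto intro: mult_right_mono order_trans[OF abs_ge_zero])
    then show "\<bar>u (x l) * d l * mean_occ x d h ?K l k\<bar> \<le> B * d k * (U * d l)" by (simp add: mult_ac)
  qed (use B U d_pos in \<open>auto simp: less_imp_le\<close>)
  also have "\<dots> = flux x d u h ?K"
    unfolding flux_def by (intro infsum_cong infsum_cmult_right')
  finally show ?thesis unfolding v_def .
qed

end

section \<open>The limit as an integral against the trap measure\<close>

context trap_env
begin

lemma y_fun: "y = (\<lambda>k. ennreal (d k))"
  by (rule ext) (rule y_eq)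

lemma trap_measure_eq: "trap_measure W = distr (density (count_space UNIV) (\<lambda>k. ennreal (d k))) borel x"
proof (rule measure_eqI)
  show "sets (trap_measure W) = sets (distr (density (count_space UNIV) (\<lambda>k. ennreal (d k))) borel x)"
    by (simp add: trap_measure_def)
  fix A assume "A \<in> sets (trap_measure W)"
  then have A: "A \<in> sets borel" by (simp add: trap_measure_def)
  have c: "continuous_on UNIV (fst :: real \<times> ennreal \<Rightarrow> real)" "continuous_on UNIV (snd :: real \<times> ennreal \<Rightarrow> ennreal)"
    by (auto intro: continuous_on_fst continuous_on_snd continuous_on_id)
  have fst: "fst \<in> measurable env_space borel"
    unfolding env_space_def by (intro measurable_restrict_space1 borel_measurable_continuous_onI c)
  have "(UNIV :: real set) \<times> {0<..<\<infinity>::ennreal} \<in> sets borel" by (simp add: borel_Times)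
  then have w: "(\<lambda>p. snd p * indicator (UNIV \<times> {0<..<\<infinity>}) p) \<in> borel_measurable env_space"
    unfolding env_space_def
    by (intro measurable_restrict_space1 borel_measurable_times_ennreal borel_measurable_indicator borel_measurable_continuous_onI c)
  have ws: "fst -` A \<inter> space W \<in> sets W"
    using measurable_sets[OF fst A] by (simp add: W_eq)
  have "emeasure (trap_measure W) A = (\<integral>\<^sup>+p. snd p * indicator (UNIV \<times> {0<..<\<infinity>}) p * indicator (fst -` A \<inter> space W) p \<partial>W)"
    unfolding trap_measure_def using A ws w fst
    by (subst emeasure_distr) (auto simp: emeasure_density cong: measurable_cong_sets)
  also have "\<dots> = (\<integral>\<^sup>+k. y k * indicator (UNIV \<times> {0<..<\<infinity>}) (x k, y k) * indicator (fst -` A \<inter> space W) (x k, y k) \<partial>count_space UNIV)"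
    using w ws by (subst nn_integral_env) (auto intro!: borel_measurable_times_ennreal)
  also have "\<dots> = (\<integral>\<^sup>+k. ennreal (d k) * indicator (x -` A) k \<partial>count_space UNIV)"
    using y_pos y_finite by (intro nn_integral_cong) (auto simp: y_eq[symmetric] W_eq env_set_def split: split_indicator)
  also have "\<dots> = emeasure (distr (density (count_space UNIV) (\<lambda>k. ennreal (d k))) borel x) A"
    using A by (subst emeasure_distr) (auto simp: emeasure_density)
  finally show "emeasure (trap_measure W) A = emeasure (distr (density (count_space UNIV) (\<lambda>k. ennreal (d k))) borel x) A" .
qed

lemma lint_trap_measure:
  fixes f :: "real \<Rightarrow> real"
  assumes f: "f \<in> borel_measurable borel"
  shows "(LINT z|trap_measure W. f z) = (LINT k|count_space UNIV. d k * f (x k))"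
  unfolding trap_measure_eq using f
  by (subst integral_distr) (auto simp: integral_density less_imp_le[OF d_pos] AE_count_space)

lemma limit_eq_flux:
  fixes h :: "real \<times> real \<Rightarrow> real"
  assumes h: "continuous_on UNIV h" and bound: "\<forall>p. \<bar>h p\<bar> \<le> B"
    and supp_z: "\<And>t z. L < \<bar>z\<bar> \<Longrightarrow> h (t, z) = 0" and supp_t: "\<And>t z. T < t \<Longrightarrow> h (t, z) = 0"
    and u: "continuous_on UNIV u" "\<And>z. 0 \<le> u z" "\<And>z. u z \<le> U" and supp_u: "\<And>z. L < \<bar>z\<bar> \<Longrightarrow> u z = 0"
  shows "(LINT t:{0..}|lborel. (LINT z|trap_measure W. h (t, z) * u_env x y u t z)) = flux x d u h (window L)"
proof -
  have um: "u \<in> borel_measurable borel" by (rule borel_measurable_continuous_onI[OF u(1)])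
  have hm: "h \<in> borel_measurable borel" by (rule borel_measurable_continuous_onI[OF h])
  have "(\<lambda>z. h (t, z) * u_env x y u t z) \<in> borel_measurable borel" for t
  proof (rule borel_measurable_times)
    show "(\<lambda>z. h (t, z)) \<in> borel_measurable borel"
      by (rule measurable_compose[OF _ hm]) (intro borel_measurable_Pair; simp)
    show "(\<lambda>z. u_env x y u t z) \<in> borel_measurable borel"
      using measurable_compose[OF _ measurable_u_env[OF um], of "\<lambda>z. (t, z)" borel] by simp
  qed
  then show ?thesis
    using left_flux[OF h bound supp_z supp_t u supp_u] by (simp add: lint_trap_measure y_fun[symmetric])
qed

end

section \<open>Deviations of compound Poisson sums\<close>

context prob_space
begin

lemma second_moment_orthogonal_sum:
  fixes g :: "'i \<Rightarrow> 'a \<Rightarrow> real"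
  assumes fin: "finite S" and meas: "\<And>s. s \<in> S \<Longrightarrow> g s \<in> borel_measurable M"
    and sq: "\<And>s. s \<in> S \<Longrightarrow> integrable M (\<lambda>\<omega>. (g s \<omega>)\<^sup>2)"
    and orth: "\<And>s t. s \<in> S \<Longrightarrow> t \<in> S \<Longrightarrow> s \<noteq> t \<Longrightarrow> expectation (\<lambda>\<omega>. g s \<omega> * g t \<omega>) = 0"
  shows "integrable M (\<lambda>\<omega>. (\<Sum>s\<in>S. g s \<omega>)\<^sup>2)"
    and "expectation (\<lambda>\<omega>. (\<Sum>s\<in>S. g s \<omega>)\<^sup>2) = (\<Sum>s\<in>S. expectation (\<lambda>\<omega>. (g s \<omega>)\<^sup>2))"
proof -
  have prod: "integrable M (\<lambda>\<omega>. g s \<omega> * g t \<omega>)" if "s \<in> S" "t \<in> S" for s t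
  proof (rule Bochner_Integration.integrable_bound)
    show "integrable M (\<lambda>\<omega>. (g s \<omega>)\<^sup>2 + (g t \<omega>)\<^sup>2)" by (intro Bochner_Integration.integrable_add sq that)
    show "(\<lambda>\<omega>. g s \<omega> * g t \<omega>) \<in> borel_measurable M" by (intro borel_measurable_times meas that)
    have "\<bar>a * b\<bar> \<le> a\<^sup>2 + b\<^sup>2" for a b :: real
      using zero_le_power2[of "\<bar>a\<bar> - \<bar>b\<bar>"] mult_nonneg_nonneg[of "\<bar>a\<bar>" "\<bar>b\<bar>"]
      unfolding power2_diff abs_mult power2_abs by linarith
    then show "AE \<omega> in M. norm (g s \<omega> * g t \<omega>) \<le> norm ((g s \<omega>)\<^sup>2 + (g t \<omega>)\<^sup>2)" by simp
  qed
  have eq: "(\<Sum>s\<in>S. g s \<omega>)\<^sup>2 = (\<Sum>s\<in>S. \<Sum>t\<in>S. g s \<omega> * g t \<omega>)" for \<omega>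
    by (simp add: power2_eq_square sum_product)
  show "integrable M (\<lambda>\<omega>. (\<Sum>s\<in>S. g s \<omega>)\<^sup>2)"
    unfolding eq by (intro Bochner_Integration.integrable_sum prod)
  have "expectation (\<lambda>\<omega>. (\<Sum>s\<in>S. g s \<omega>)\<^sup>2) = (\<Sum>s\<in>S. \<Sum>t\<in>S. expectation (\<lambda>\<omega>. g s \<omega> * g t \<omega>))"
    unfolding eq using prod by simp
  also have "\<dots> = (\<Sum>s\<in>S. \<Sum>t\<in>S. if t = s then expectation (\<lambda>\<omega>. (g s \<omega>)\<^sup>2) else 0)"
    using orth by (intro sum.cong) (auto simp: power2_eq_square)
  also have "\<dots> = (\<Sum>s\<in>S. expectation (\<lambda>\<omega>. (g s \<omega>)\<^sup>2))"
    using fin by (simp add: sum.delta)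
  finally show "expectation (\<lambda>\<omega>. (\<Sum>s\<in>S. g s \<omega>)\<^sup>2) = (\<Sum>s\<in>S. expectation (\<lambda>\<omega>. (g s \<omega>)\<^sup>2))" .
qed

lemma indep_vars_expectation_mult:
  fixes X :: "'i \<Rightarrow> 'a \<Rightarrow> real"
  assumes "indep_vars (\<lambda>_. borel) X I" "i \<in> I" "j \<in> I" "i \<noteq> j" "integrable M (X i)" "integrable M (X j)"
  shows "expectation (\<lambda>\<omega>. X i \<omega> * X j \<omega>) = expectation (X i) * expectation (X j)"
  using indep_vars_lebesgue_integral[of "{i, j}" X] indep_vars_subset[OF assms(1), of "{i, j}"] assms
  by fastforce

lemma poisson_nn_integral:
  assumes "poisson_distributed M X r"
  shows "(\<integral>\<^sup>+\<omega>. f (X \<omega>) \<partial>M) = (\<Sum>m. f m * ennreal (exp (- r) * r ^ m / fact m))"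
proof -
  have r: "0 \<le> r" and [measurable]: "X \<in> measurable M (count_space UNIV)"
    and P: "\<And>m. prob {\<omega> \<in> space M. X \<omega> = m} = exp (- r) * r ^ m / fact m"
    using assms by (auto simp: poisson_distributed_def)
  have "emeasure (distr M (count_space UNIV) X) {m} = ennreal (exp (- r) * r ^ m / fact m)" for m
    unfolding P[symmetric] emeasure_eq_measure[symmetric]
    by (subst emeasure_distr) (auto intro!: arg_cong[where f="emeasure M"])
  then have "distr M (count_space UNIV) X = density (count_space UNIV) (\<lambda>m. ennreal (exp (- r) * r ^ m / fact m))"
    by (intro measure_eqI_countable[where A=UNIV]) (auto simp: emeasure_density)
  then have "(\<integral>\<^sup>+m. f m \<partial>distr M (count_space UNIV) X) =
      (\<integral>\<^sup>+m. ennreal (exp (- r) * r ^ m / fact m) * f m \<partial>count_space UNIV)"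
    by (simp add: nn_integral_density)
  then show ?thesis
    by (subst (asm) nn_integral_distr) (simp_all add: nn_integral_count_space_nat mult.commute)
qed

lemma poisson_factorial_moment:
  assumes "poisson_distributed M X r"
  shows "(\<integral>\<^sup>+\<omega>. ennreal (real (X \<omega>)) \<partial>M) = ennreal r"
    and "(\<integral>\<^sup>+\<omega>. ennreal (real (X \<omega>) * (real (X \<omega>) - 1)) \<partial>M) = ennreal (r\<^sup>2)"
proof -
  have r: "0 \<le> r" using assms by (simp add: poisson_distributed_def)
  have e: "(\<lambda>m. r ^ m / fact m) sums exp r"
    using exp_converges[of r] by (simp add: divide_inverse mult.commute)
  have mom: "(\<Sum>m. ennreal (g m) * ennreal (exp (- r) * r ^ m / fact m)) = ennreal s"
    if g: "\<And>m. 0 \<le> g m" and "(\<lambda>m. g m * (r ^ m / fact m)) sums (s * exp r)" for g s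
  proof -
    have "(\<lambda>m. exp (- r) * (g m * (r ^ m / fact m))) sums (exp (- r) * (s * exp r))"
      by (intro sums_mult that)
    then have "(\<lambda>m. g m * (exp (- r) * r ^ m / fact m)) sums s"
      by (simp add: exp_minus field_simps)
    then show ?thesis
      using r g by (subst ennreal_mult[symmetric]) (auto intro!: suminf_ennreal_eq)
  qed
  have s1: "(\<lambda>m. real m * (r ^ m / fact m)) sums (r * exp r)"
  proof (rule sums_Suc_imp)
    have "real (Suc m) * (r ^ Suc m / fact (Suc m)) = r * (r ^ m / fact m)" for m
      by (simp add: field_simps del: of_nat_Suc)
    then show "(\<lambda>m. real (Suc m) * (r ^ Suc m / fact (Suc m))) sums (r * exp r)"
      using sums_mult[OF e, of r] by simp
  qed simp
  then show "(\<integral>\<^sup>+\<omega>. ennreal (real (X \<omega>)) \<partial>M) = ennreal r"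
    unfolding poisson_nn_integral[OF assms, of "\<lambda>m. ennreal (real m)"] by (intro mom) auto
  have s2: "(\<lambda>m. real m * (real m - 1) * (r ^ m / fact m)) sums (r\<^sup>2 * exp r)"
  proof (rule sums_Suc_imp)
    have "real (Suc m) * (real (Suc m) - 1) * (r ^ Suc m / fact (Suc m)) = r * (real m * (r ^ m / fact m))" for m
    proof -
      have "real (Suc m) * (r ^ Suc m / fact (Suc m)) = r * (r ^ m / fact m)"
        by (simp add: field_simps del: of_nat_Suc)
      then have "real m * (real (Suc m) * (r ^ Suc m / fact (Suc m))) = real m * (r * (r ^ m / fact m))"
        by (rule arg_cong)
      moreover have "real (Suc m) - 1 = real m" by simp
      ultimately show ?thesis by (simp only: mult_ac)
    qed
    then have eq: "(\<lambda>m. real (Suc m) * (real (Suc m) - 1) * (r ^ Suc m / fact (Suc m))) =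
        (\<lambda>m. r * (real m * (r ^ m / fact m)))" by (rule ext)
    show "(\<lambda>m. real (Suc m) * (real (Suc m) - 1) * (r ^ Suc m / fact (Suc m))) sums (r\<^sup>2 * exp r)"
      unfolding eq using sums_mult[OF s1, of r] by (simp only: power2_eq_square mult.assoc)
  qed simp
  have nn: "0 \<le> real m * (real m - 1)" for m by (cases m) auto
  show "(\<integral>\<^sup>+\<omega>. ennreal (real (X \<omega>) * (real (X \<omega>) - 1)) \<partial>M) = ennreal (r\<^sup>2)"
    unfolding poisson_nn_integral[OF assms, of "\<lambda>m. ennreal (real m * (real m - 1))"]
    by (intro mom nn s2)
qed

lemma poisson_moments:
  assumes "poisson_distributed M X r"
  shows "integrable M (\<lambda>\<omega>. real (X \<omega>))" "expectation (\<lambda>\<omega>. real (X \<omega>)) = r"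
    "integrable M (\<lambda>\<omega>. (real (X \<omega>) - r)\<^sup>2)" "expectation (\<lambda>\<omega>. (real (X \<omega>) - r)\<^sup>2) = r"
proof -
  have r: "0 \<le> r" and X [measurable]: "X \<in> measurable M (count_space UNIV)"
    using assms by (auto simp: poisson_distributed_def)
  have [measurable]: "(\<lambda>\<omega>. g (X \<omega>)) \<in> borel_measurable M" for g :: "nat \<Rightarrow> real"
    by measurable
  have nn: "0 \<le> real m * (real m - 1)" for m by (cases m) auto
  note mom = poisson_factorial_moment[OF assms]
  show 1: "integrable M (\<lambda>\<omega>. real (X \<omega>))"
    by (rule integrableI_nn_integral_finite[OF _ _ mom(1)]) auto
  show 2: "expectation (\<lambda>\<omega>. real (X \<omega>)) = r"
    by (subst integral_eq_nn_integral) (auto simp: mom(1) r)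
  have 3: "integrable M (\<lambda>\<omega>. real (X \<omega>) * (real (X \<omega>) - 1))"
    by (rule integrableI_nn_integral_finite[OF _ _ mom(2)]) (auto simp: nn)
  have 4: "expectation (\<lambda>\<omega>. real (X \<omega>) * (real (X \<omega>) - 1)) = r\<^sup>2"
    by (subst integral_eq_nn_integral) (auto simp: mom(2) nn)
  have eq: "(real m - r)\<^sup>2 = real m * (real m - 1) + (1 - 2 * r) * real m + r\<^sup>2" for m
    by (simp add: power2_eq_square algebra_simps)
  show "integrable M (\<lambda>\<omega>. (real (X \<omega>) - r)\<^sup>2)" unfolding eq using 1 3 by simp
  have "expectation (\<lambda>\<omega>. (real (X \<omega>) - r)\<^sup>2) = r\<^sup>2 + (1 - 2 * r) * r + r\<^sup>2"
    unfolding eq using 1 3 by (simp add: 2 4 prob_space)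
  then show "expectation (\<lambda>\<omega>. (real (X \<omega>) - r)\<^sup>2) = r" by (simp add: power2_eq_square algebra_simps)
qed

text \<open>The independence of initial configuration and trajectories is assumed between generated
  \<sigma>-algebras. A measurable functional of either object generates a smaller \<sigma>-algebra,
  so independence is inherited, and so is measurability with respect to \<open>M\<close>.\<close>

lemma indep_set_vimage_algebra_indep_var:
  assumes ind: "indep_set (sets (vimage_algebra (space M) X A)) (sets (vimage_algebra (space M) Y B))"
    and X: "X \<in> space M \<rightarrow> space A" and Y: "Y \<in> space M \<rightarrow> space B"
    and U: "U \<in> measurable A S" and V: "V \<in> measurable B T"
  shows "indep_var S (\<lambda>\<omega>. U (X \<omega>)) T (\<lambda>\<omega>. V (Y \<omega>))"
proof -
  have UX: "(\<lambda>\<omega>. U (X \<omega>)) \<in> measurable (vimage_algebra (space M) X A) S"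
    using measurable_compose[OF measurable_vimage_algebra1[OF X] U] .
  have VY: "(\<lambda>\<omega>. V (Y \<omega>)) \<in> measurable (vimage_algebra (space M) Y B) T"
    using measurable_compose[OF measurable_vimage_algebra1[OF Y] V] .
  have subX: "sigma_sets (space M) {(\<lambda>\<omega>. U (X \<omega>)) -` C \<inter> space M |C. C \<in> sets S} \<subseteq> sets (vimage_algebra (space M) X A)"
    using sets.sigma_sets_subset[of "{(\<lambda>\<omega>. U (X \<omega>)) -` C \<inter> space M |C. C \<in> sets S}" "vimage_algebra (space M) X A"]
      measurable_sets[OF UX] by auto
  have subY: "sigma_sets (space M) {(\<lambda>\<omega>. V (Y \<omega>)) -` C \<inter> space M |C. C \<in> sets T} \<subseteq> sets (vimage_algebra (space M) Y B)"
    using sets.sigma_sets_subset[of "{(\<lambda>\<omega>. V (Y \<omega>)) -` C \<inter> space M |C. C \<in> sets T}" "vimage_algebra (space M) Y B"]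
      measurable_sets[OF VY] by auto
  have ev: "sets (vimage_algebra (space M) X A) \<subseteq> events" "sets (vimage_algebra (space M) Y B) \<subseteq> events"
    using ind by (auto simp: indep_sets2_eq)
  have "(\<lambda>\<omega>. U (X \<omega>)) \<in> measurable M S" "(\<lambda>\<omega>. V (Y \<omega>)) \<in> measurable M T"
    using UX VY ev unfolding measurable_def by auto
  then show ?thesis
    unfolding indep_var_eq using ind subX subY unfolding indep_sets2_eq by blast
qed

text \<open>The deviation is \<open>G + H\<close>. \<open>H\<close> comes from the Poisson counts,
  with variance at most \<open>B\<^sup>2\<close> times the total rate; \<open>G\<close> comes from
  the centred trajectory functionals, each bounded by \<open>2 * B\<close>, with second moment at
  most \<open>4 * B\<^sup>2\<close> times the total rate. Chebyshev at level
  \<open>\<epsilon>\<close> for each of them gives the constant 5 and the threshold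
  \<open>2 * \<epsilon>\<close>.\<close>

lemma compound_poisson_deviation:
  fixes \<eta> :: "'i \<Rightarrow> 'a \<Rightarrow> nat" and F :: "'i \<Rightarrow> nat \<Rightarrow> 'a \<Rightarrow> real"
  assumes fin: "finite \<Lambda>"
    and pois: "\<And>l. poisson_distributed M (\<eta> l) (r l)"
    and indep: "indep_vars (\<lambda>_. count_space UNIV) \<eta> UNIV"
    and indepF: "indep_vars (\<lambda>_. borel) (\<lambda>(l, j). F l j) (UNIV \<times> {1..})"
    and cross: "\<And>U V. U \<in> borel_measurable (PiM UNIV (\<lambda>_. count_space UNIV)) \<Longrightarrow>
      V \<in> borel_measurable (PiM (UNIV \<times> {1..}) (\<lambda>_. borel)) \<Longrightarrow>
      indep_var borel (\<lambda>\<omega>. U (\<lambda>l. \<eta> l \<omega>) :: real)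
        borel (\<lambda>\<omega>. V (\<lambda>p\<in>UNIV \<times> {1..}. F (fst p) (snd p) \<omega>) :: real)"
    and bound: "\<And>l j \<omega>. 1 \<le> j \<Longrightarrow> \<omega> \<in> space M \<Longrightarrow> \<bar>F l j \<omega>\<bar> \<le> B"
    and mean: "\<And>l j. 1 \<le> j \<Longrightarrow> expectation (F l j) = f l"
    and \<epsilon>: "0 < \<epsilon>"
  shows "prob {\<omega> \<in> space M. \<bar>(\<Sum>l\<in>\<Lambda>. \<Sum>j=1..\<eta> l \<omega>. F l j \<omega>) - (\<Sum>l\<in>\<Lambda>. r l * f l)\<bar> > 2 * \<epsilon>} \<le>
    5 * B\<^sup>2 * (\<Sum>l\<in>\<Lambda>. r l) / \<epsilon>\<^sup>2"
proof -
  have [measurable]: "\<eta> l \<in> measurable M (count_space UNIV)" and r: "0 \<le> r l" for l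
    using pois[of l] by (auto simp: poisson_distributed_def)
  have F [measurable]: "F l j \<in> borel_measurable M" if "1 \<le> j" for l j
    using indepF that unfolding indep_vars_def by force
  have intF: "integrable M (F l j)" if "1 \<le> j" for l j
    using that bound by (intro integrable_const_bound[of _ B] AE_I2) auto
  have B: "0 \<le> B" using bound[of 1 "SOME \<omega>. \<omega> \<in> space M" undefined] not_empty some_in_eq[of "space M"] by force
  have f: "\<bar>f l\<bar> \<le> B" for l
  proof -
    have "\<bar>expectation (F l 1)\<bar> \<le> expectation (\<lambda>\<omega>. \<bar>F l 1 \<omega>\<bar>)"
      by (rule integral_abs_bound)
    also have "\<dots> \<le> expectation (\<lambda>\<omega>. B)"
      using intF[of 1 l] bound[of 1 _ l] by (intro integral_mono) auto
    finally show ?thesis by (simp add: mean prob_space)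
  qed
  define H where "H \<omega> = (\<Sum>l\<in>\<Lambda>. f l * (real (\<eta> l \<omega>) - r l))" for \<omega>
  have H2: "integrable M (\<lambda>\<omega>. (H \<omega>)\<^sup>2)" "expectation (\<lambda>\<omega>. (H \<omega>)\<^sup>2) \<le> B\<^sup>2 * (\<Sum>l\<in>\<Lambda>. r l)"
  proof -
    have sq: "integrable M (\<lambda>\<omega>. (f l * (real (\<eta> l \<omega>) - r l))\<^sup>2)"
      "expectation (\<lambda>\<omega>. (f l * (real (\<eta> l \<omega>) - r l))\<^sup>2) = (f l)\<^sup>2 * r l" for l
      unfolding power_mult_distrib using poisson_moments[OF pois[of l]] by auto
    have ind: "indep_vars (\<lambda>_. borel) (\<lambda>l \<omega>. f l * (real (\<eta> l \<omega>) - r l)) UNIV"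
      by (rule indep_vars_compose2[OF indep]) simp
    have orth: "expectation (\<lambda>\<omega>. (f l * (real (\<eta> l \<omega>) - r l)) * (f k * (real (\<eta> k \<omega>) - r k))) = 0" if "l \<noteq> k" for l k
    proof -
      have i: "integrable M (\<lambda>\<omega>. f l * (real (\<eta> l \<omega>) - r l))" "expectation (\<lambda>\<omega>. f l * (real (\<eta> l \<omega>) - r l)) = 0" for l
        using poisson_moments(1,2)[OF pois[of l]] by (auto simp: prob_space)
      show ?thesis using indep_vars_expectation_mult[OF ind _ _ that i(1) i(1)] unfolding i(2) by simp
    qed
    note S = second_moment_orthogonal_sum[OF fin, of "\<lambda>l \<omega>. f l * (real (\<eta> l \<omega>) - r l)"]
    show "integrable M (\<lambda>\<omega>. (H \<omega>)\<^sup>2)" unfolding H_def by (rule S(1)) (auto intro: sq orth)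
    have "expectation (\<lambda>\<omega>. (H \<omega>)\<^sup>2) = (\<Sum>l\<in>\<Lambda>. (f l)\<^sup>2 * r l)"
      unfolding H_def by (subst S(2)) (auto intro: sq orth simp: sq(2))
    also have "\<dots> \<le> (\<Sum>l\<in>\<Lambda>. B\<^sup>2 * r l)"
      using f r by (intro sum_mono mult_right_mono) (simp_all add: abs_le_square_iff[symmetric] B)
    finally show "expectation (\<lambda>\<omega>. (H \<omega>)\<^sup>2) \<le> B\<^sup>2 * (\<Sum>l\<in>\<Lambda>. r l)" by (simp add: sum_distrib_left)
  qed
  have [measurable]: "H \<in> borel_measurable M" unfolding H_def[abs_def] by measurable
  have PH: "prob {\<omega> \<in> space M. \<epsilon> \<le> \<bar>H \<omega>\<bar>} \<le> B\<^sup>2 * (\<Sum>l\<in>\<Lambda>. r l) / \<epsilon>\<^sup>2"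
    by (rule order_trans[OF second_moment_method[OF \<open>H \<in> borel_measurable M\<close> H2(1) \<epsilon>] divide_right_mono[OF H2(2)]]) simp
  \<comment> \<open>Cutting at \<open>J\<close> particles per trap turns the random number of
    summands into a fixed finite family with indicators, so that orthogonality can be used; the
    bounds do not depend on \<open>J\<close>.\<close>
  define G where "G J \<omega> = (\<Sum>p\<in>\<Lambda> \<times> {1..J}. of_bool (snd p \<le> \<eta> (fst p) \<omega>) * (F (fst p) (snd p) \<omega> - f (fst p)))" for J \<omega>
  have PG: "prob {\<omega> \<in> space M. \<epsilon> \<le> \<bar>G J \<omega>\<bar>} \<le> 4 * B\<^sup>2 * (\<Sum>l\<in>\<Lambda>. r l) / \<epsilon>\<^sup>2" and [measurable]: "G J \<in> borel_measurable M" for J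
  proof -
    let ?g = "\<lambda>p \<omega>. of_bool (snd p \<le> \<eta> (fst p) \<omega>) * (F (fst p) (snd p) \<omega> - f (fst p))"
    let ?S = "\<Lambda> \<times> {1..J}"
    have meas: "?g p \<in> borel_measurable M" if "p \<in> ?S" for p
      using that F[of "snd p" "fst p"] by (auto intro!: borel_measurable_times borel_measurable_diff)
    then show GJ: "G J \<in> borel_measurable M" unfolding G_def[abs_def] by (intro borel_measurable_sum) auto
    have le: "(?g p \<omega>)\<^sup>2 \<le> 4 * B\<^sup>2 * of_bool (snd p \<le> \<eta> (fst p) \<omega>)" if "p \<in> ?S" "\<omega> \<in> space M" for p \<omega>
    proof -
      have "\<bar>F (fst p) (snd p) \<omega> - f (fst p)\<bar> \<le> 2 * B"
        using that bound[of "snd p" \<omega> "fst p"] f[of "fst p"] by auto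
      then have "(F (fst p) (snd p) \<omega> - f (fst p))\<^sup>2 \<le> (2 * B)\<^sup>2"
        using B by (intro power2_le_iff_abs_le[THEN iffD2]) auto
      then show ?thesis by (auto simp: power_mult_distrib)
    qed
    have sq: "integrable M (\<lambda>\<omega>. (?g p \<omega>)\<^sup>2)" if "p \<in> ?S" for p
    proof (rule integrable_const_bound[of _ "4 * B\<^sup>2"])
      show "AE \<omega> in M. norm ((?g p \<omega>)\<^sup>2) \<le> 4 * B\<^sup>2"
      proof (rule AE_I2)
        fix \<omega> assume "\<omega> \<in> space M"
        from le[OF that this] have "(?g p \<omega>)\<^sup>2 \<le> 4 * B\<^sup>2 * of_bool (snd p \<le> \<eta> (fst p) \<omega>)" .
        also have "\<dots> \<le> 4 * B\<^sup>2 * 1" by (intro mult_left_mono) auto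
        finally show "norm ((?g p \<omega>)\<^sup>2) \<le> 4 * B\<^sup>2" by simp
      qed
    qed (use meas[OF that] in simp)
    have orth: "expectation (\<lambda>\<omega>. ?g p \<omega> * ?g q \<omega>) = 0" if pq: "p \<in> ?S" "q \<in> ?S" "p \<noteq> q" for p q
    proof -
      \<comment> \<open>The product of two different summands splits into a function
        \<open>U\<close> of the counts and a function \<open>V\<close> of the trajectories, which
        are independent. \<open>V\<close> is a product of two independent centred factors, so its
        mean is 0.\<close>
      define U where "U = (\<lambda>e :: 'i \<Rightarrow> nat. of_bool (snd p \<le> e (fst p)) * of_bool (snd q \<le> e (fst q)) :: real)"
      define V where "V = (\<lambda>w :: 'i \<times> nat \<Rightarrow> real. (w p - f (fst p)) * (w q - f (fst q)))"
      have pq': "p \<in> UNIV \<times> {1..}" "q \<in> UNIV \<times> {1..}" using pq by auto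
      have U: "U \<in> borel_measurable (PiM UNIV (\<lambda>_. count_space UNIV))" unfolding U_def by measurable
      have V: "V \<in> borel_measurable (PiM (UNIV \<times> {1..}) (\<lambda>_. borel))"
        unfolding V_def by (intro borel_measurable_times borel_measurable_diff borel_measurable_const measurable_component_singleton pq')
      let ?e = "\<lambda>\<omega> l. \<eta> l \<omega>" and ?w = "\<lambda>\<omega>. \<lambda>p\<in>UNIV \<times> {1..}. F (fst p) (snd p) \<omega>"
      have ind: "indep_var borel (U \<circ> ?e) borel (V \<circ> ?w)"
        unfolding comp_def by (rule cross[OF U V])
      have Vw: "(V \<circ> ?w) \<omega> = (F (fst p) (snd p) \<omega> - f (fst p)) * (F (fst q) (snd q) \<omega> - f (fst q))" for \<omega>
        using pq' by (simp add: V_def)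
      have b: "\<bar>F (fst p) (snd p) \<omega> - f (fst p)\<bar> \<le> 2 * B" if "p \<in> ?S" "\<omega> \<in> space M" for p \<omega>
        using that bound[of "snd p" \<omega> "fst p"] f[of "fst p"] by auto
      have int1: "integrable M (\<lambda>\<omega>. F (fst p) (snd p) \<omega> - f (fst p))"
        and exp1: "expectation (\<lambda>\<omega>. F (fst p) (snd p) \<omega> - f (fst p)) = 0" if "p \<in> ?S" for p
        using intF[of "snd p" "fst p"] that by (auto simp: mean prob_space)
      have indF: "indep_vars (\<lambda>_. borel) (\<lambda>p \<omega>. F (fst p) (snd p) \<omega> - f (fst p)) (UNIV \<times> {1..})"
        using indep_vars_compose2[OF indepF, of "\<lambda>p y. y - f (fst p)" "\<lambda>_. borel"] by (simp add: split_beta')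
      have EV: "expectation (V \<circ> ?w) = 0"
        unfolding Vw[abs_def] comp_def
        using indep_vars_expectation_mult[OF indF pq' pq(3) int1[OF pq(1)] int1[OF pq(2)]] exp1[OF pq(1)] pq'
        by (simp add: V_def)
      have IU: "integrable M (U \<circ> ?e)"
      proof (rule integrable_const_bound[of _ 1])
        show "AE \<omega> in M. norm ((U \<circ> ?e) \<omega>) \<le> 1" by (intro AE_I2) (auto simp: U_def)
        show "(U \<circ> ?e) \<in> borel_measurable M" unfolding U_def comp_def by measurable
      qed
      have IV: "integrable M (V \<circ> ?w)"
      proof (rule integrable_const_bound[of _ "(2 * B) * (2 * B)"])
        show "AE \<omega> in M. norm ((V \<circ> ?w) \<omega>) \<le> (2 * B) * (2 * B)"
          unfolding Vw real_norm_def abs_mult using b[OF pq(1)] b[OF pq(2)] B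
          by (intro AE_I2 mult_mono) auto
        show "(V \<circ> ?w) \<in> borel_measurable M"
          using F[of "snd p" "fst p"] F[of "snd q" "fst q"] pq unfolding Vw[abs_def] by auto
      qed
      have "expectation (\<lambda>\<omega>. (U \<circ> ?e) \<omega> * (V \<circ> ?w) \<omega>) = 0"
        unfolding indep_var_lebesgue_integral[OF ind IU IV] EV by simp
      moreover have "(U \<circ> ?e) \<omega> * (V \<circ> ?w) \<omega> = ?g p \<omega> * ?g q \<omega>" for \<omega>
        unfolding Vw by (simp add: U_def mult_ac)
      ultimately show ?thesis by simp
    qed
    note S = second_moment_orthogonal_sum[OF _ meas sq orth]
    have G2: "integrable M (\<lambda>\<omega>. (G J \<omega>)\<^sup>2)" unfolding G_def by (rule S(1)) (use fin in auto)
    have "expectation (\<lambda>\<omega>. (G J \<omega>)\<^sup>2) = (\<Sum>p\<in>?S. expectation (\<lambda>\<omega>. (?g p \<omega>)\<^sup>2))"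
      unfolding G_def by (rule S(2)) (use fin in auto)
    also have "\<dots> \<le> (\<Sum>p\<in>?S. expectation (\<lambda>\<omega>. 4 * B\<^sup>2 * of_bool (snd p \<le> \<eta> (fst p) \<omega>)))"
    proof (intro sum_mono integral_mono sq le)
      fix p
      show "integrable M (\<lambda>\<omega>. 4 * B\<^sup>2 * of_bool (snd p \<le> \<eta> (fst p) \<omega>) :: real)"
        by (intro integrable_mult_right integrable_const_bound[of _ 1]) auto
    qed
    also have "\<dots> = 4 * B\<^sup>2 * (\<Sum>l\<in>\<Lambda>. \<Sum>j=1..J. expectation (\<lambda>\<omega>. of_bool (j \<le> \<eta> l \<omega>)))"
      by (simp add: sum.cartesian_product sum_distrib_left split_beta')
    also have "\<dots> \<le> 4 * B\<^sup>2 * (\<Sum>l\<in>\<Lambda>. r l)"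
    proof (intro mult_left_mono sum_mono)
      fix l
      have int: "integrable M (\<lambda>\<omega>. of_bool (j \<le> \<eta> l \<omega>) :: real)" for j
        by (rule integrable_const_bound[of _ 1]) auto
      have "(\<Sum>j=1..J. expectation (\<lambda>\<omega>. of_bool (j \<le> \<eta> l \<omega>) :: real)) = expectation (\<lambda>\<omega>. \<Sum>j=1..J. of_bool (j \<le> \<eta> l \<omega>))"
        by (rule Bochner_Integration.integral_sum[symmetric], rule int)
      also have "\<dots> \<le> expectation (\<lambda>\<omega>. real (\<eta> l \<omega>))"
      proof (intro integral_mono poisson_moments(1)[OF pois])
        show "integrable M (\<lambda>\<omega>. \<Sum>j=1..J. of_bool (j \<le> \<eta> l \<omega>) :: real)"
          by (intro Bochner_Integration.integrable_sum int)
        fix \<omega>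
        have "(\<Sum>j=1..J. of_bool (j \<le> \<eta> l \<omega>) :: real) = real (card {j\<in>{1..J}. j \<le> \<eta> l \<omega>})"
          by (simp add: of_bool_def sum.If_cases Int_def)
        also have "card {j\<in>{1..J}. j \<le> \<eta> l \<omega>} \<le> card {1..\<eta> l \<omega>}"
          by (intro card_mono) auto
        finally show "(\<Sum>j=1..J. of_bool (j \<le> \<eta> l \<omega>) :: real) \<le> real (\<eta> l \<omega>)" by simp
      qed
      also have "\<dots> = r l" by (rule poisson_moments(2)[OF pois])
      finally show "(\<Sum>j=1..J. expectation (\<lambda>\<omega>. of_bool (j \<le> \<eta> l \<omega>))) \<le> r l" .
    qed simp
    finally have "expectation (\<lambda>\<omega>. (G J \<omega>)\<^sup>2) / \<epsilon>\<^sup>2 \<le> 4 * B\<^sup>2 * (\<Sum>l\<in>\<Lambda>. r l) / \<epsilon>\<^sup>2"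
      by (intro divide_right_mono) auto
    then show "prob {\<omega> \<in> space M. \<epsilon> \<le> \<bar>G J \<omega>\<bar>} \<le> 4 * B\<^sup>2 * (\<Sum>l\<in>\<Lambda>. r l) / \<epsilon>\<^sup>2"
      using second_moment_method[OF GJ G2 \<epsilon>] by linarith
  qed
  let ?T = "\<lambda>J. {\<omega> \<in> space M. \<exists>l\<in>\<Lambda>. J < \<eta> l \<omega>}"
  let ?D = "\<lambda>\<omega>. (\<Sum>l\<in>\<Lambda>. \<Sum>j=1..\<eta> l \<omega>. F l j \<omega>) - (\<Sum>l\<in>\<Lambda>. r l * f l)"
  have T [measurable]: "?T J \<in> events" for J
    using fin by measurable
  have key: "prob {\<omega> \<in> space M. \<bar>?D \<omega>\<bar> > 2 * \<epsilon>} \<le> prob (?T J) + 5 * B\<^sup>2 * (\<Sum>l\<in>\<Lambda>. r l) / \<epsilon>\<^sup>2" for J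
  proof -
    let ?G = "{\<omega> \<in> space M. \<epsilon> \<le> \<bar>G J \<omega>\<bar>}" and ?H = "{\<omega> \<in> space M. \<epsilon> \<le> \<bar>H \<omega>\<bar>}"
    have sub: "{\<omega> \<in> space M. \<bar>?D \<omega>\<bar> > 2 * \<epsilon>} \<subseteq> ?T J \<union> (?G \<union> ?H)"
    proof
      fix \<omega> assume \<omega>: "\<omega> \<in> {\<omega> \<in> space M. \<bar>?D \<omega>\<bar> > 2 * \<epsilon>}"
      show "\<omega> \<in> ?T J \<union> (?G \<union> ?H)"
      proof (cases "\<omega> \<in> ?T J")
        case False
        then have J: "\<eta> l \<omega> \<le> J" if "l \<in> \<Lambda>" for l using \<omega> that by force
        have "G J \<omega> = (\<Sum>l\<in>\<Lambda>. \<Sum>j=1..J. of_bool (j \<le> \<eta> l \<omega>) * (F l j \<omega> - f l))"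
          unfolding G_def by (subst sum.cartesian_product) (simp only: split_beta')
        also have "\<dots> = (\<Sum>l\<in>\<Lambda>. \<Sum>j=1..\<eta> l \<omega>. F l j \<omega> - f l)"
          using J by (intro sum.cong refl sum.mono_neutral_cong_right) auto
        finally have "?D \<omega> = G J \<omega> + H \<omega>"
          by (simp add: H_def sum_subtractf sum.distrib[symmetric] algebra_simps)
        then show ?thesis using \<omega> by auto
      qed simp
    qed
    have "prob {\<omega> \<in> space M. \<bar>?D \<omega>\<bar> > 2 * \<epsilon>} \<le> prob (?T J \<union> (?G \<union> ?H))"
      by (intro finite_measure_mono sub) (intro sets.Un, auto)
    also have "\<dots> \<le> prob (?T J) + (prob ?G + prob ?H)"
      by (intro order_trans[OF measure_Un_le] add_left_mono measure_Un_le sets.Un) auto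
    also have "prob ?G + prob ?H \<le> 4 * B\<^sup>2 * (\<Sum>l\<in>\<Lambda>. r l) / \<epsilon>\<^sup>2 + B\<^sup>2 * (\<Sum>l\<in>\<Lambda>. r l) / \<epsilon>\<^sup>2"
      by (intro add_mono PG PH)
    finally show ?thesis by (simp add: add_divide_distrib[symmetric] field_simps)
  qed
  \<comment> \<open>For every outcome the finitely many counts are bounded, so the probability that
    the cut at \<open>J\<close> is exceeded tends to 0.\<close>
  have "(\<lambda>J. prob (?T J)) \<longlonglongrightarrow> prob (\<Inter>J. ?T J)"
    by (rule finite_Lim_measure_decseq) (auto simp: decseq_def intro: order.strict_trans1)
  also have "(\<Inter>J. ?T J) = {}"
  proof -
    have "\<omega> \<notin> ?T (Max ((\<lambda>l. \<eta> l \<omega>) ` \<Lambda>))" for \<omega>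
      using fin by (auto simp: not_less)
    then show ?thesis by blast
  qed
  finally have "(\<lambda>J. prob (?T J) + 5 * B\<^sup>2 * (\<Sum>l\<in>\<Lambda>. r l) / \<epsilon>\<^sup>2) \<longlonglongrightarrow> 0 + 5 * B\<^sup>2 * (\<Sum>l\<in>\<Lambda>. r l) / \<epsilon>\<^sup>2"
    by (intro tendsto_intros) simp
  then have "prob {\<omega> \<in> space M. \<bar>?D \<omega>\<bar> > 2 * \<epsilon>} \<le> 0 + 5 * B\<^sup>2 * (\<Sum>l\<in>\<Lambda>. r l) / \<epsilon>\<^sup>2"
    by (rule LIMSEQ_le_const) (use key in blast)
  then show ?thesis by simp
qed

end

section \<open>Particle systems\<close>

text \<open>Evaluating a path along a sequence of countably many times that decreases to \<open>t\<close> is jointly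
  measurable on the product space of paths, and recovers right-continuous paths.\<close>

definition grid_time :: "nat \<Rightarrow> real \<Rightarrow> real" where
  "grid_time m t = max 0 ((of_int \<lfloor>t * real (Suc m)\<rfloor> + 1) / real (Suc m))"

definition path_at :: "(real \<Rightarrow> real) \<Rightarrow> real \<Rightarrow> real" where
  "path_at p t = lim (\<lambda>m. p (grid_time m t))"

lemma grid_time:
  assumes "0 \<le> t"
  shows "t < grid_time m t" "grid_time m t \<le> t + 1 / real (Suc m)" "0 \<le> grid_time m t"
proof -
  let ?m = "real (Suc m)"
  have m: "0 < ?m" by simp
  have "t * ?m < of_int \<lfloor>t * ?m\<rfloor> + 1" by linarith
  then have 1: "t < (of_int \<lfloor>t * ?m\<rfloor> + 1) / ?m" using m by (simp only: pos_less_divide_eq)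
  have "of_int \<lfloor>t * ?m\<rfloor> + 1 \<le> t * ?m + 1" by linarith
  then have "(of_int \<lfloor>t * ?m\<rfloor> + 1) / ?m \<le> (t * ?m + 1) / ?m" using m by (intro divide_right_mono) auto
  also have "\<dots> = t + 1 / ?m" using m by (simp add: add_divide_distrib del: of_nat_Suc)
  finally have 2: "(of_int \<lfloor>t * ?m\<rfloor> + 1) / ?m \<le> t + 1 / ?m" .
  show "t < grid_time m t" "grid_time m t \<le> t + 1 / real (Suc m)" "0 \<le> grid_time m t"
    using 1 2 assms unfolding grid_time_def by auto
qed

lemma path_at_right_continuous:
  assumes t: "0 \<le> t" and p: "(p \<longlongrightarrow> p t) (at_right t)" and q: "\<And>s. 0 \<le> s \<Longrightarrow> q s = p s"
  shows "path_at q t = p t"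
proof -
  have "filterlim (\<lambda>m. grid_time m t) (at_right t) sequentially"
    unfolding filterlim_at
  proof
    show "eventually (\<lambda>m. grid_time m t \<in> {t<..} \<and> grid_time m t \<noteq> t) sequentially"
    proof (intro always_eventually allI conjI)
      show "grid_time m t \<in> {t<..}" "grid_time m t \<noteq> t" for m
        using grid_time(1)[OF t, of m] by auto
    qed
    have "(\<lambda>m. t + 1 / real (Suc m)) \<longlonglongrightarrow> t + 0"
      by (intro tendsto_intros LIMSEQ_Suc[OF lim_1_over_n])
    then show "(\<lambda>m. grid_time m t) \<longlonglongrightarrow> t"
      by (intro tendsto_sandwich[of "\<lambda>_. t" "\<lambda>m. grid_time m t" sequentially "\<lambda>m. t + 1 / real (Suc m)"])
         (auto simp: less_imp_le[OF grid_time(1)[OF t]] grid_time(2)[OF t] simp del: of_nat_Suc)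
  qed
  from filterlim_compose[OF p this] have "(\<lambda>m. p (grid_time m t)) \<longlonglongrightarrow> p t" .
  then show ?thesis unfolding path_at_def using q grid_time(3)[OF t] by (simp add: limI)
qed

lemma measurable_path_at:
  "(\<lambda>(p, t). path_at p t) \<in> borel_measurable (path_space \<Otimes>\<^sub>M borel)"
proof -
  have "(\<lambda>w. fst w (grid_time m (snd w))) \<in> borel_measurable (path_space \<Otimes>\<^sub>M borel)" for m
  proof -
    \<comment> \<open>Given the integer value of the floor, the grid time is a constant and the
      value of the path there a coordinate. Only countably many integers occur, so the pieces
      combine measurably. The maximum with 0 keeps every grid time in the index set of the path
      space.\<close>
    let ?f = "\<lambda>(i::int) w. fst w (max 0 ((of_int i + 1) / real (Suc m)))"
    have "?f i \<in> borel_measurable (path_space \<Otimes>\<^sub>M borel)" for i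
    proof -
      have "(\<lambda>p. p (max 0 ((of_int i + 1) / real (Suc m)))) \<in> borel_measurable path_space"
        unfolding path_space_def by (rule measurable_component_singleton) auto
      then show ?thesis by (rule measurable_compose[OF measurable_fst])
    qed
    moreover have "(\<lambda>w. \<lfloor>snd w * real (Suc m)\<rfloor>) \<in> measurable (path_space \<Otimes>\<^sub>M borel) (count_space UNIV)"
      by measurable
    ultimately have "(\<lambda>w. ?f (\<lfloor>snd w * real (Suc m)\<rfloor>) w) \<in> borel_measurable (path_space \<Otimes>\<^sub>M borel)"
      by (rule measurable_compose_countable)
    then show ?thesis unfolding grid_time_def .
  qed
  then have "(\<lambda>w. lim (\<lambda>m. fst w (grid_time m (snd w)))) \<in> borel_measurable (path_space \<Otimes>\<^sub>M borel)"
    by (rule borel_measurable_lim_metric)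
  then show ?thesis by (simp add: path_at_def split_beta')
qed

lemma measurable_path:
  assumes "\<And>t. 0 \<le> t \<Longrightarrow> Z t \<in> borel_measurable M"
  shows "path Z \<in> measurable M path_space"
  unfolding path_space_def path_def[abs_def] by (rule measurable_restrict) (use assms in auto)

definition path_functional :: "(real \<times> real \<Rightarrow> real) \<Rightarrow> (real \<Rightarrow> real) \<Rightarrow> real" where
  "path_functional g p = (LINT t:{0..}|lborel. g (t, path_at p t))"

lemma measurable_path_at_fun:
  assumes g: "g \<in> borel_measurable borel"
  shows "(\<lambda>(p, t). g (t, path_at p t)) \<in> borel_measurable (path_space \<Otimes>\<^sub>M borel)"
proof -
  have "(\<lambda>w. (snd w, path_at (fst w) (snd w))) \<in> borel_measurable (path_space \<Otimes>\<^sub>M borel)"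
    using measurable_path_at by (intro borel_measurable_Pair) (auto simp: split_beta')
  from measurable_compose[OF this g] show ?thesis by (simp add: split_beta')
qed

lemma measurable_path_functional:
  assumes g: "g \<in> borel_measurable borel"
  shows "path_functional g \<in> borel_measurable path_space"
proof -
  have "(\<lambda>w. indicator {0..} (snd w) *\<^sub>R g (snd w, path_at (fst w) (snd w))) \<in> borel_measurable (path_space \<Otimes>\<^sub>M lborel)"
    using measurable_path_at_fun[OF g] by (intro borel_measurable_scaleR) (auto simp: split_beta' cong: measurable_cong_sets)
  then show ?thesis
    unfolding path_functional_def[abs_def] set_lebesgue_integral_def
    by (intro lborel.borel_measurable_lebesgue_integral) (simp add: split_beta')
qed

lemma path_functional_bound:
  assumes "\<And>p. \<bar>g p\<bar> \<le> B" "\<And>t z. T < t \<Longrightarrow> g (t, z) = 0" "0 \<le> T"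
  shows "\<bar>path_functional g p\<bar> \<le> B * T"
proof (cases "integrable lborel (\<lambda>t. indicator {0..} t *\<^sub>R g (t, path_at p t))")
  case True
  have B: "0 \<le> B" using assms(1)[of undefined] by linarith
  have "\<bar>path_functional g p\<bar> \<le> (LINT t|lborel. B * indicator {0..T} t)"
    unfolding path_functional_def set_lebesgue_integral_def
  proof (rule lint_abs_bound_AE[OF True])
    show "integrable lborel (\<lambda>t::real. B * indicator {0..T} t)"
      by (intro integrable_mult_right) (simp add: integrable_indicator_iff emeasure_lborel_Icc_eq)
    show "AE t in lborel. norm (indicator {0..} t *\<^sub>R g (t, path_at p t)) \<le> B * indicator {0..T} t"
      using assms B by (intro AE_I2) (auto split: split_indicator)
  qed
  also have "\<dots> = B * T" using assms(3) by simp
  finally show ?thesis .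
next
  case False
  have "0 \<le> B" using assms(1)[of undefined] by linarith
  with False show ?thesis using assms(3)
    by (simp add: path_functional_def set_lebesgue_integral_def not_integrable_integral_eq)
qed

lemma has_sum_finite_sum:
  fixes f :: "'i \<Rightarrow> 'a \<Rightarrow> real"
  assumes "finite I" "\<And>i. i \<in> I \<Longrightarrow> (f i has_sum s i) A"
  shows "((\<lambda>a. \<Sum>i\<in>I. f i a) has_sum (\<Sum>i\<in>I. s i)) A"
  using assms by (induction I rule: finite_induct) (auto intro!: has_sum_add)

section \<open>One particle system in a fixed environment\<close>

locale particles = trap_env x y W + prob_space M
  for x y W and M :: "'w measure" +
  fixes \<eta> :: "int \<Rightarrow> 'w \<Rightarrow> nat" and Z :: "int \<Rightarrow> nat \<Rightarrow> real \<Rightarrow> 'w \<Rightarrow> real"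
    and h :: "real \<times> real \<Rightarrow> real" and B L T :: real
  assumes directed: "directed_trap_particles M x y \<eta> Z"
    and \<eta>_meas: "\<And>l. \<eta> l \<in> measurable M (count_space UNIV)"
    and h: "continuous_on UNIV h" and bound: "\<forall>p. \<bar>h p\<bar> \<le> B"
    and supp_z: "\<And>t z. L < \<bar>z\<bar> \<Longrightarrow> h (t, z) = 0" and supp_t: "\<And>t z. T < t \<Longrightarrow> h (t, z) = 0"
    and T: "0 \<le> T"
begin

text \<open>Occupation numbers see a particle only while it is at a trap location, and the
  trajectories, known only in law, need not be there at every time and outcome. With
  \<open>h\<close> cut down to trap locations, the integrated particle density is an exact sum of
  path functionals.\<close>

definition \<psi> :: "real \<times> real \<Rightarrow> real" where "\<psi> p = h p * of_bool (snd p \<in> range x)"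

definition F :: "int \<Rightarrow> nat \<Rightarrow> 'w \<Rightarrow> real" where "F l j \<omega> = path_functional \<psi> (path (Z l j) \<omega>)"

definition total :: "'w \<Rightarrow> real" where
  "total \<omega> = (LINT t:{0..}|lborel. (\<Sum>\<^sub>\<infinity>k. eta x \<eta> Z t k \<omega> * h (t, x k)))"

lemma hm: "h \<in> borel_measurable borel" by (rule borel_measurable_continuous_onI[OF h])

lemma \<psi>_meas: "\<psi> \<in> borel_measurable borel"
proof -
  have "range x \<in> sets borel" by (rule sets.countable) auto
  then have "UNIV \<times> range x \<in> sets (borel :: (real \<times> real) measure)" by (simp add: borel_Times)
  then have "(\<lambda>p. h p * indicator (UNIV \<times> range x) p) \<in> borel_measurable borel" using hm by simp
  then show ?thesis by (simp add: \<psi>_def[abs_def] indicator_def mem_Times_iff of_bool_def)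
qed

lemma \<psi>_bound: "\<bar>\<psi> p\<bar> \<le> B"
  using bound[rule_format, of p] by (auto simp: \<psi>_def)

lemma \<psi>_supp: "T < t \<Longrightarrow> \<psi> (t, z) = 0"
  by (simp add: \<psi>_def supp_t)

lemma path_meas: "1 \<le> j \<Longrightarrow> path (Z l j) \<in> measurable M path_space"
  using directed unfolding directed_trap_particles_def indep_vars_def by fastforce

lemma path_at_Z:
  assumes "1 \<le> j" "\<omega> \<in> space M" "0 \<le> t"
  shows "path_at (path (Z l j) \<omega>) t = Z l j t \<omega>"
proof (rule path_at_right_continuous[where p="\<lambda>t. Z l j t \<omega>"])
  have "continuous (at_right t) (\<lambda>s. Z l j s \<omega>)"
    using directed assms unfolding directed_trap_particles_def by blast
  then show "((\<lambda>s. Z l j s \<omega>) \<longlongrightarrow> Z l j t \<omega>) (at_right t)"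
    by (simp add: continuous_within)
qed (use assms in \<open>auto simp: path_def\<close>)

lemma F_meas: "1 \<le> j \<Longrightarrow> F l j \<in> borel_measurable M"
  unfolding F_def[abs_def] by (rule measurable_compose[OF path_meas measurable_path_functional[OF \<psi>_meas]])

lemma path_functional_\<psi>_bound: "\<bar>path_functional \<psi> p\<bar> \<le> B * T"
  by (rule path_functional_bound) (use \<psi>_bound \<psi>_supp T in auto)

lemma F_bound: "\<bar>F l j \<omega>\<bar> \<le> B * T"
  unfolding F_def by (rule path_functional_\<psi>_bound)

lemma F_eq:
  assumes "1 \<le> j" "\<omega> \<in> space M"
  shows "F l j \<omega> = (LINT t:{0..}|lborel. \<psi> (t, Z l j t \<omega>))"
    and "set_integrable lborel {0..} (\<lambda>t. \<psi> (t, Z l j t \<omega>))"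
proof -
  have eq: "indicator {0..} t *\<^sub>R \<psi> (t, path_at (path (Z l j) \<omega>) t) = indicator {0..} t *\<^sub>R \<psi> (t, Z l j t \<omega>)" for t
    using path_at_Z[OF assms, of t] by (auto split: split_indicator)
  show "F l j \<omega> = (LINT t:{0..}|lborel. \<psi> (t, Z l j t \<omega>))"
    unfolding F_def path_functional_def set_lebesgue_integral_def eq ..
  have w: "path (Z l j) \<omega> \<in> space path_space" using path_meas[OF assms(1)] assms(2) by (rule measurable_space)
  have "(\<lambda>t. \<psi> (t, path_at (path (Z l j) \<omega>) t)) \<in> borel_measurable borel"
    using measurable_compose[OF measurable_Pair1'[OF w] measurable_path_at_fun[OF \<psi>_meas]] by simp
  then have meas: "(\<lambda>t. indicator {0..} t *\<^sub>R \<psi> (t, Z l j t \<omega>)) \<in> borel_measurable lborel"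
    unfolding eq[symmetric] by simp
  show "set_integrable lborel {0..} (\<lambda>t. \<psi> (t, Z l j t \<omega>))"
    unfolding set_integrable_def
  proof (rule Bochner_Integration.integrable_bound[OF _ meas])
    show "integrable lborel (\<lambda>t::real. B * indicator {0..T} t)"
      by (intro integrable_mult_right) (simp add: integrable_indicator_iff emeasure_lborel_Icc_eq)
    show "AE t in lborel. norm (indicator {0..} t *\<^sub>R \<psi> (t, Z l j t \<omega>)) \<le> norm (B * indicator {0..T} t)"
    proof (rule AE_I2)
      fix t
      show "norm (indicator {0..} t *\<^sub>R \<psi> (t, Z l j t \<omega>)) \<le> norm (B * indicator {0..T} t)"
        using \<psi>_bound[of "(t, Z l j t \<omega>)"] \<psi>_supp[of t "Z l j t \<omega>"] by (auto split: split_indicator)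
    qed
  qed
qed

text \<open>With finitely many occupied starts the sum over starts is finite and can be pulled out
  of the sum over traps. Injectivity of \<open>x\<close> ensures that a particle is counted at one
  index only.\<close>

lemma eta_sum_eq:
  assumes fin: "finite S" and S: "\<And>l. l \<notin> S \<Longrightarrow> \<eta> l \<omega> = 0"
  shows "(\<Sum>\<^sub>\<infinity>k. eta x \<eta> Z t k \<omega> * h (t, x k)) = (\<Sum>l\<in>S. \<Sum>j=1..\<eta> l \<omega>. \<psi> (t, Z l j t \<omega>))"
proof -
  have eta: "eta x \<eta> Z t k \<omega> = (\<Sum>l\<in>S. \<Sum>j=1..\<eta> l \<omega>. of_bool (Z l j t \<omega> = x k))" for k
  proof -
    have "eta x \<eta> Z t k \<omega> = (\<Sum>\<^sub>\<infinity>l\<in>S. \<Sum>j=1..\<eta> l \<omega>. of_bool (Z l j t \<omega> = x k))"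
      unfolding eta_def by (rule infsum_cong_neutral) (use S in auto)
    then show ?thesis using fin by simp
  qed
  have one: "((\<lambda>k. of_bool (z = x k) * h (t, x k)) has_sum \<psi> (t, z)) UNIV" for z
  proof (cases "z \<in> range x")
    case True
    then obtain k where k: "z = x k" by blast
    have "((\<lambda>k. of_bool (z = x k) * h (t, x k)) has_sum (\<Sum>k\<in>{k}. of_bool (z = x k) * h (t, x k))) {k}"
      by (rule has_sum_finite) simp
    moreover have "((\<lambda>k. of_bool (z = x k) * h (t, x k)) has_sum s) {k} \<longleftrightarrow>
        ((\<lambda>k. of_bool (z = x k) * h (t, x k)) has_sum s) UNIV" for s
      by (rule has_sum_cong_neutral) (use k inj_x in \<open>auto dest: injD\<close>)
    ultimately have "((\<lambda>k. of_bool (z = x k) * h (t, x k)) has_sum (\<Sum>k\<in>{k}. of_bool (z = x k) * h (t, x k))) UNIV"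
      by simp
    then show ?thesis using k by (simp add: \<psi>_def)
  next
    case False
    then have "((\<lambda>k. of_bool (z = x k) * h (t, x k)) has_sum 0) UNIV"
      by (intro has_sum_0) auto
    then show ?thesis using False by (simp add: \<psi>_def)
  qed
  have "(\<Sum>\<^sub>\<infinity>k. eta x \<eta> Z t k \<omega> * h (t, x k)) = (\<Sum>\<^sub>\<infinity>k. \<Sum>l\<in>S. \<Sum>j=1..\<eta> l \<omega>. of_bool (Z l j t \<omega> = x k) * h (t, x k))"
    by (simp add: eta sum_distrib_right)
  also have "\<dots> = (\<Sum>l\<in>S. \<Sum>j=1..\<eta> l \<omega>. \<psi> (t, Z l j t \<omega>))"
    by (intro infsumI has_sum_finite_sum fin one) auto
  finally show ?thesis .
qed

lemma total_eq:
  assumes \<omega>: "\<omega> \<in> space M" and fin: "finite S" and S: "\<And>l. l \<notin> S \<Longrightarrow> \<eta> l \<omega> = 0"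
  shows "total \<omega> = (\<Sum>l\<in>S. \<Sum>j=1..\<eta> l \<omega>. F l j \<omega>)"
proof -
  have int: "integrable lborel (\<lambda>t. indicator {0..} t *\<^sub>R \<psi> (t, Z l j t \<omega>))" if "1 \<le> j" for l j
    using F_eq(2)[OF that \<omega>, of l] by (simp add: set_integrable_def)
  have "total \<omega> = (LINT t|lborel. (\<Sum>l\<in>S. \<Sum>j=1..\<eta> l \<omega>. indicator {0..} t *\<^sub>R \<psi> (t, Z l j t \<omega>)))"
    unfolding total_def set_lebesgue_integral_def
  proof (intro Bochner_Integration.integral_cong refl)
    fix t
    have "(\<Sum>\<^sub>\<infinity>k. eta x \<eta> Z t k \<omega> * h (t, x k)) = (\<Sum>l\<in>S. \<Sum>j=1..\<eta> l \<omega>. \<psi> (t, Z l j t \<omega>))"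
      by (rule eta_sum_eq[OF fin]) (rule S)
    then show "indicator {0..} t *\<^sub>R (\<Sum>\<^sub>\<infinity>k. eta x \<eta> Z t k \<omega> * h (t, x k)) =
        (\<Sum>l\<in>S. \<Sum>j=1..\<eta> l \<omega>. indicator {0..} t *\<^sub>R \<psi> (t, Z l j t \<omega>))"
      by (simp only: scaleR_sum_right)
  qed
  also have "\<dots> = (\<Sum>l\<in>S. \<Sum>j=1..\<eta> l \<omega>. F l j \<omega>)"
  proof -
    have "(LINT t|lborel. (\<Sum>l\<in>S. \<Sum>j=1..\<eta> l \<omega>. indicator {0..} t *\<^sub>R \<psi> (t, Z l j t \<omega>))) =
        (\<Sum>l\<in>S. (LINT t|lborel. (\<Sum>j=1..\<eta> l \<omega>. indicator {0..} t *\<^sub>R \<psi> (t, Z l j t \<omega>))))"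
      by (rule Bochner_Integration.integral_sum, rule Bochner_Integration.integrable_sum, rule int) simp
    also have "\<dots> = (\<Sum>l\<in>S. \<Sum>j=1..\<eta> l \<omega>. (LINT t|lborel. indicator {0..} t *\<^sub>R \<psi> (t, Z l j t \<omega>)))"
      by (rule sum.cong[OF refl], rule Bochner_Integration.integral_sum, rule int) simp
    also have "\<dots> = (\<Sum>l\<in>S. \<Sum>j=1..\<eta> l \<omega>. F l j \<omega>)"
      by (intro sum.cong refl) (simp only: atLeastAtMost_iff F_eq(1)[OF _ \<omega>] set_lebesgue_integral_def)
    finally show ?thesis .
  qed
  finally show ?thesis .
qed

text \<open>Measurability is claimed for all outcomes, including those with infinitely many
  particles, so it cannot rest on the finite-sum formula. Replacing each trajectory by its grid
  limit \<open>path_at\<close> yields an integrand that is jointly measurable in outcome and time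
  and unchanged at nonnegative times.\<close>

lemma total_measurable: "total \<in> borel_measurable M"
proof -
  define N where "N k w = (\<Sum>\<^sub>\<infinity>l. \<Sum>j=1..\<eta> l (fst w). of_bool (path_at (path (Z l j) (fst w)) (snd w) = x k) :: real)" for k w
  have [measurable]: "(\<lambda>w. path_at (path (Z l j) (fst w)) (snd w)) \<in> borel_measurable (M \<Otimes>\<^sub>M lborel)" if "1 \<le> j" for l j
  proof -
    have "(\<lambda>w. (path (Z l j) (fst w), snd w)) \<in> measurable (M \<Otimes>\<^sub>M lborel) (path_space \<Otimes>\<^sub>M borel)"
      using path_meas[OF that] by (intro measurable_Pair measurable_compose[OF measurable_fst]) auto
    from measurable_compose[OF this measurable_path_at] show ?thesis by simp
  qed
  have N: "N k \<in> borel_measurable (M \<Otimes>\<^sub>M lborel)" for k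
    unfolding N_def
  proof (rule borel_measurable_infsum_real)
    fix l
    let ?f = "\<lambda>m w. \<Sum>j=1..m. of_bool (path_at (path (Z l j) (fst w)) (snd w) = x k) :: real"
    have "?f m \<in> borel_measurable (M \<Otimes>\<^sub>M lborel)" for m
    proof (rule borel_measurable_sum)
      fix j assume "j \<in> {1..m}"
      then have "1 \<le> j" by simp
      then show "(\<lambda>w. of_bool (path_at (path (Z l j) (fst w)) (snd w) = x k) :: real) \<in> borel_measurable (M \<Otimes>\<^sub>M lborel)"
        by measurable
    qed
    moreover have "(\<lambda>w. \<eta> l (fst w)) \<in> measurable (M \<Otimes>\<^sub>M lborel) (count_space UNIV)"
      by (rule measurable_compose[OF measurable_fst \<eta>_meas])
    ultimately show "(\<lambda>w. ?f (\<eta> l (fst w)) w) \<in> borel_measurable (M \<Otimes>\<^sub>M lborel)"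
      by (rule measurable_compose_countable)
  qed simp
  have hk: "(\<lambda>w. h (snd w, x k)) \<in> borel_measurable (M \<Otimes>\<^sub>M lborel)" for k
    by (rule measurable_compose[OF _ hm], rule borel_measurable_Pair) simp_all
  have "(\<lambda>w. indicator {0..} (snd w) *\<^sub>R (\<Sum>\<^sub>\<infinity>k. N k w * h (snd w, x k))) \<in> borel_measurable (M \<Otimes>\<^sub>M lborel)"
    using N hk by (intro borel_measurable_scaleR borel_measurable_infsum_real borel_measurable_times) auto
  then have "(\<lambda>\<omega>. LINT t|lborel. indicator {0..} t *\<^sub>R (\<Sum>\<^sub>\<infinity>k. N k (\<omega>, t) * h (t, x k))) \<in> borel_measurable M"
    by (intro lborel.borel_measurable_lebesgue_integral) (simp add: split_beta')
  moreover have "total \<omega> = (LINT t|lborel. indicator {0..} t *\<^sub>R (\<Sum>\<^sub>\<infinity>k. N k (\<omega>, t) * h (t, x k)))" if \<omega>: "\<omega> \<in> space M" for \<omega>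
    unfolding total_def set_lebesgue_integral_def
  proof (intro Bochner_Integration.integral_cong refl)
    fix t :: real
    have "N k (\<omega>, t) = eta x \<eta> Z t k \<omega>" if "0 \<le> t" for k
      unfolding N_def eta_def using \<omega> that by (intro infsum_cong sum.cong) (auto simp: path_at_Z)
    then show "indicator {0..} t *\<^sub>R (\<Sum>\<^sub>\<infinity>k. eta x \<eta> Z t k \<omega> * h (t, x k)) = indicator {0..} t *\<^sub>R (\<Sum>\<^sub>\<infinity>k. N k (\<omega>, t) * h (t, x k))"
      by (auto split: split_indicator)
  qed
  ultimately show ?thesis by (simp cong: measurable_cong)
qed

definition f :: "int \<Rightarrow> real" where
  "f l = (LINT \<zeta>|exp_clocks. path_functional \<psi> (path (\<lambda>t \<zeta>. Zr \<zeta> l t) \<zeta>))"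

lemma Zr_path_meas: "path (\<lambda>t \<zeta>. Zr \<zeta> l t) \<in> measurable exp_clocks path_space"
  by (rule measurable_path) measurable

lemma F_mean:
  assumes "1 \<le> j"
  shows "expectation (F l j) = f l"
proof -
  have "expectation (F l j) = (LINT p|distr M path_space (path (Z l j)). path_functional \<psi> p)"
    unfolding F_def[abs_def]
    by (rule integral_distr[symmetric, OF path_meas[OF assms] measurable_path_functional[OF \<psi>_meas]])
  also have "distr M path_space (path (Z l j)) = distr exp_clocks path_space (\<lambda>\<zeta>. path (\<lambda>t \<zeta>. Zr \<zeta> l t) \<zeta>)"
    using directed assms unfolding directed_trap_particles_def y_eq[symmetric] by blast
  also have "(LINT p|distr exp_clocks path_space (\<lambda>\<zeta>. path (\<lambda>t \<zeta>. Zr \<zeta> l t) \<zeta>). path_functional \<psi> p) = f l"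
    unfolding f_def by (rule integral_distr[OF Zr_path_meas measurable_path_functional[OF \<psi>_meas]])
  finally show ?thesis .
qed

text \<open>For good clocks the canonical path is right-continuous, hence recovered by
  \<open>path_at\<close>, and at almost every time it sits in a trap, so that the cut-off in
  \<open>\<psi>\<close> does not change the time integral.\<close>

lemma f_eq:
  assumes l: "l \<in> window L"
  shows "f l = (\<Sum>\<^sub>\<infinity>k\<in>window L. mean_occ x d h (window L) l k)"
proof -
  have "f l = (LINT \<zeta>|exp_clocks. (LINT t:{0..}|lborel. h (t, Zr \<zeta> l t)))"
    unfolding f_def
  proof (rule integral_cong_AE)
    show "(\<lambda>\<zeta>. path_functional \<psi> (path (\<lambda>t \<zeta>. Zr \<zeta> l t) \<zeta>)) \<in> borel_measurable exp_clocks"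
      by (rule measurable_compose[OF Zr_path_meas measurable_path_functional[OF \<psi>_meas]])
    have hZ: "(\<lambda>p. h (snd p, Zr (fst p) l (snd p))) \<in> borel_measurable (exp_clocks \<Otimes>\<^sub>M lborel)"
      by (rule measurable_compose[OF _ hm], rule borel_measurable_Pair) measurable
    then show "(\<lambda>\<zeta>. (LINT t:{0..}|lborel. h (t, Zr \<zeta> l t))) \<in> borel_measurable exp_clocks"
      unfolding set_lebesgue_integral_def
      by (intro lborel.borel_measurable_lebesgue_integral) (simp add: split_beta')
    show "AE \<zeta> in exp_clocks. path_functional \<psi> (path (\<lambda>t \<zeta>. Zr \<zeta> l t) \<zeta>) = (LINT t:{0..}|lborel. h (t, Zr \<zeta> l t))"
      using AE_good
    proof eventually_elim
      fix \<zeta> assume g: "good \<zeta>"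
      let ?p = "path (\<lambda>t \<zeta>. Zr \<zeta> l t) \<zeta>"
      have p: "path_at ?p t = Zr \<zeta> l t" if "0 \<le> t" for t
        by (rule path_at_right_continuous[OF that Zr_right_continuous[OF g that]]) (simp add: path_def)
      have w: "?p \<in> space path_space" by (rule measurable_space[OF Zr_path_meas]) simp
      show "path_functional \<psi> ?p = (LINT t:{0..}|lborel. h (t, Zr \<zeta> l t))"
        unfolding path_functional_def set_lebesgue_integral_def
      proof (rule integral_cong_AE)
        have "(\<lambda>t. \<psi> (t, path_at ?p t)) \<in> borel_measurable borel"
          using measurable_compose[OF measurable_Pair1'[OF w] measurable_path_at_fun[OF \<psi>_meas]] by simp
        then show "(\<lambda>t. indicator {0..} t *\<^sub>R \<psi> (t, path_at ?p t)) \<in> borel_measurable lborel" by simp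
        have "(\<lambda>t. h (t, Zr \<zeta> l t)) \<in> borel_measurable lborel"
          using measurable_compose[OF measurable_Pair1' hZ, of \<zeta>] by simp
        then show "(\<lambda>t. indicator {0..} t *\<^sub>R h (t, Zr \<zeta> l t)) \<in> borel_measurable lborel" by simp
        show "AE t in lborel. indicator {0..} t *\<^sub>R \<psi> (t, path_at ?p t) = indicator {0..} t *\<^sub>R h (t, Zr \<zeta> l t)"
          using AE_slot[OF g, of l]
        proof eventually_elim
          fix t assume t: "0 \<le> t \<longrightarrow> (\<exists>k. x l \<le> x k \<and> t \<in> slot \<zeta> l k)"
          show "indicator {0..} t *\<^sub>R \<psi> (t, path_at ?p t) = indicator {0..} t *\<^sub>R h (t, Zr \<zeta> l t)"
          proof (cases "0 \<le> t")
            case True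
            then obtain k where "x l \<le> x k" "t \<in> slot \<zeta> l k" using t by blast
            then have "Zr \<zeta> l t = x k" by (rule Zr_slot[OF g])
            then show ?thesis by (simp add: p[OF True] \<psi>_def)
          qed simp
        qed
      qed
    qed
  qed
  also have "\<dots> = (\<Sum>\<^sub>\<infinity>k\<in>window L. mean_occ x d h (window L) l k)"
    by (rule expected_occupation[OF h bound]) (use supp_z l in auto)
  finally show ?thesis .
qed

lemma f_bound: "\<bar>f l\<bar> \<le> B * T"
proof -
  have "\<bar>f l\<bar> \<le> (LINT \<zeta>|exp_clocks. B * T)"
    unfolding f_def
  proof (rule lint_abs_bound_AE)
    show "integrable exp_clocks (\<lambda>\<zeta>. path_functional \<psi> (path (\<lambda>t \<zeta>. Zr \<zeta> l t) \<zeta>))"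
      by (rule exp_clocks.integrable_const_bound[of _ "B * T"])
         (auto intro: path_functional_\<psi>_bound measurable_compose[OF Zr_path_meas measurable_path_functional[OF \<psi>_meas]])
  qed (auto intro: path_functional_\<psi>_bound)
  then show ?thesis using exp_clocks.prob_space by simp
qed

text \<open>The second-moment bound concerns finitely many traps, whereas the window may hold
  infinitely many. A finite \<open>\<Lambda>\<close> is chosen so large that with probability at
  least \<open>1 - 1 / a\<close> no particle starts outside it and that the flux from outside it is
  at most \<epsilon>.\<close>

lemma deviation:
  fixes a U \<epsilon> :: real and u :: "real \<Rightarrow> real"
  assumes a: "0 < a" and \<epsilon>: "0 < \<epsilon>"
    and u: "\<And>z. 0 \<le> u z" "\<And>z. u z \<le> U" and supp_u: "\<And>z. L < \<bar>z\<bar> \<Longrightarrow> u z = 0"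
    and pois: "\<And>l. poisson_distributed M (\<eta> l) (a * u (x l) * d l)"
    and indep: "indep_vars (\<lambda>_. count_space UNIV) \<eta> UNIV"
  shows "prob {\<omega> \<in> space M. \<bar>1 / a * total \<omega> - flux x d u h (window L)\<bar> > 3 * \<epsilon>} \<le>
    1 / a + 5 * (B * T)\<^sup>2 * U * infsum d (window L) / (\<epsilon>\<^sup>2 * a)"
proof -
  let ?K = "window L"
  have U: "0 \<le> U" using u[of 0] by linarith
  have BT: "0 \<le> B * T" using bound[rule_format, of undefined] T by (intro mult_nonneg_nonneg) linarith+
  define r where "r l = a * u (x l) * d l" for l
  have r: "0 \<le> r l" "r l \<le> a * U * d l" for l
    unfolding r_def using a u d_pos[of l] by (auto intro!: mult_nonneg_nonneg mult_mono simp: less_imp_le)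
  have dS: "d summable_on A" if "A \<subseteq> ?K" for A
    by (rule summable_on_subset_banach[OF d_summable that])
  \<comment> \<open>The first bound makes the expected number of particles starting outside
    \<open>\<Lambda>\<close>, at most \<open>a * U * s\<close>, no larger than \<open>1 / a\<close>;
    the second makes the neglected flux, at most \<open>U * s * (B * T)\<close>, no larger than
    \<epsilon>. The added 1 in both denominators avoids division by 0.\<close>
  define s where "s = min (1 / (a * a * (U + 1))) (\<epsilon> / (U * (B * T) + 1))"
  have s: "0 < s" unfolding s_def using a \<epsilon> U BT by (auto intro!: divide_pos_pos mult_pos_pos add_nonneg_pos)
  have s1: "a * U * s \<le> 1 / a"
  proof -
    have "a * U * s \<le> a * (U + 1) * (1 / (a * a * (U + 1)))"
      unfolding s_def using a U s by (intro mult_mono) (auto simp: s_def)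
    also have "\<dots> = 1 / a" using a U by (simp add: field_simps add_nonneg_eq_0_iff)
    finally show ?thesis .
  qed
  have s2: "U * s * (B * T) \<le> \<epsilon>"
  proof -
    have "U * (B * T) * s \<le> (U * (B * T) + 1) * (\<epsilon> / (U * (B * T) + 1))"
      unfolding s_def using \<epsilon> U BT s by (intro mult_mono) (auto simp: s_def)
    also have "\<dots> = \<epsilon>" using U BT by (simp add: add_nonneg_eq_0_iff)
    finally show ?thesis by (simp add: mult_ac)
  qed
  obtain \<Lambda> where \<Lambda>: "finite \<Lambda>" "\<Lambda> \<subseteq> ?K" "dist (sum d \<Lambda>) (infsum d ?K) \<le> s"
    using has_sum_finite_approximation[OF has_sum_infsum[OF d_summable] s] by blast
  have tail: "infsum d (?K - \<Lambda>) \<le> s"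
  proof -
    have "infsum d (?K - \<Lambda>) = infsum d ?K - infsum d \<Lambda>" using \<Lambda> by (intro infsum_Diff dS) auto
    moreover have "infsum d \<Lambda> = sum d \<Lambda>" using \<Lambda>(1) by simp
    ultimately show ?thesis using \<Lambda>(3) unfolding dist_real_def by linarith
  qed
  let ?O = "{\<omega> \<in> space M. \<exists>l\<in>- \<Lambda>. \<eta> l \<omega> \<noteq> 0}"
  have O_meas: "?O \<in> events" using \<eta>_meas by measurable
  have PO: "prob ?O \<le> 1 / a"
  proof -
    have "emeasure M ?O = (\<integral>\<^sup>+\<omega>. indicator ?O \<omega> \<partial>M)" using O_meas by simp
    \<comment> \<open>The probability of a particle outside \<open>\<Lambda>\<close> is at most the
      expected number of such particles. Traps beyond the window do not contribute, since
      \<open>u\<close> vanishes there.\<close>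
    also have "\<dots> \<le> (\<integral>\<^sup>+\<omega>. (\<integral>\<^sup>+l. ennreal (real (\<eta> l \<omega>)) \<partial>count_space (- \<Lambda>)) \<partial>M)"
    proof (rule nn_integral_mono)
      fix \<omega>
      show "indicator ?O \<omega> \<le> (\<integral>\<^sup>+l. ennreal (real (\<eta> l \<omega>)) \<partial>count_space (- \<Lambda>))"
      proof (cases "\<omega> \<in> ?O")
        case True
        then obtain l where l: "l \<in> - \<Lambda>" "\<eta> l \<omega> \<noteq> 0" by blast
        have "1 \<le> ennreal (real (\<eta> l \<omega>))" using l(2) by (simp add: ennreal_ge_1)
        also have "\<dots> \<le> (\<integral>\<^sup>+l. ennreal (real (\<eta> l \<omega>)) \<partial>count_space (- \<Lambda>))"
          using l(1) by (rule nn_integral_ge_point)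
        finally show ?thesis using True by simp
      qed simp
    qed
    also have "\<dots> = (\<integral>\<^sup>+l. (\<integral>\<^sup>+\<omega>. ennreal (real (\<eta> l \<omega>)) \<partial>M) \<partial>count_space (- \<Lambda>))"
    proof -
      interpret C: sigma_finite_measure "count_space (- \<Lambda>)"
        by (rule sigma_finite_measure_count_space_countable) simp
      interpret p: pair_sigma_finite M "count_space (- \<Lambda>)" ..
      show ?thesis using \<eta>_meas
        by (intro p.Fubini'[symmetric] measurable_split_countable) measurable
    qed
    also have "\<dots> = (\<integral>\<^sup>+l. ennreal (r l) \<partial>count_space (- \<Lambda>))"
      unfolding r_def by (intro nn_integral_cong poisson_factorial_moment(1)[OF pois])
    also have "\<dots> = (\<integral>\<^sup>+l. ennreal (r l) \<partial>count_space (?K - \<Lambda>))"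
      by (subst (1 2) nn_integral_count_space_indicator)
         (auto intro!: nn_integral_cong simp: r_def supp_u not_le split: split_indicator)
    also have "\<dots> \<le> (\<integral>\<^sup>+l. ennreal (a * U * d l) \<partial>count_space (?K - \<Lambda>))"
      using r by (intro nn_integral_mono ennreal_leI)
    also have "\<dots> = ennreal (a * U * infsum d (?K - \<Lambda>))"
      using a U d_pos
      by (subst nn_integral_count_space_infsum)
         (auto simp: less_imp_le infsum_cmult_right[OF dS] intro!: summable_on_cmult_right dS mult_nonneg_nonneg)
    also have "\<dots> \<le> ennreal (a * U * s)"
      using tail a U by (intro ennreal_leI mult_left_mono) auto
    also have "\<dots> \<le> ennreal (1 / a)" using s1 by (rule ennreal_leI)
    finally show ?thesis using a by (simp add: emeasure_eq_measure)
  qed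
  have indF: "indep_vars (\<lambda>_. borel) (\<lambda>(l, j). F l j) (UNIV \<times> {1..})"
  proof -
    have "indep_vars (\<lambda>_. path_space) (\<lambda>(k, j). path (Z k j)) (UNIV \<times> {1..})"
      using directed by (simp add: directed_trap_particles_def)
    from indep_vars_compose2[OF this, of "\<lambda>_. path_functional \<psi>" "\<lambda>_. borel"] measurable_path_functional[OF \<psi>_meas]
    show ?thesis by (simp add: F_def[abs_def] split_beta')
  qed
  have cross: "indep_var borel (\<lambda>\<omega>. A (\<lambda>l. \<eta> l \<omega>) :: real) borel (\<lambda>\<omega>. V (\<lambda>p\<in>UNIV \<times> {1..}. F (fst p) (snd p) \<omega>) :: real)"
    if A: "A \<in> borel_measurable (PiM UNIV (\<lambda>_. count_space UNIV))" and V: "V \<in> borel_measurable (PiM (UNIV \<times> {1..}) (\<lambda>_. borel))"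
    for A V
  proof -
    let ?Y = "\<lambda>\<omega>. \<lambda>(k, j)\<in>UNIV \<times> {1..}. path (Z k j) \<omega>"
    let ?V = "\<lambda>w. V (\<lambda>p\<in>UNIV \<times> {1..}. path_functional \<psi> (w p))"
    have ind: "indep_set (sets (vimage_algebra (space M) (\<lambda>\<omega> k. \<eta> k \<omega>) (PiM UNIV (\<lambda>_. count_space UNIV))))
       (sets (vimage_algebra (space M) ?Y (PiM (UNIV \<times> {1..}) (\<lambda>_. path_space))))"
      using directed by (simp add: directed_trap_particles_def)
    have V': "?V \<in> borel_measurable (PiM (UNIV \<times> {1..}) (\<lambda>_. path_space))"
    proof (rule measurable_compose[OF _ V], rule measurable_restrict)
      fix p :: "int \<times> nat" assume "p \<in> UNIV \<times> {1..}"
      then have "(\<lambda>w. w p) \<in> measurable (PiM (UNIV \<times> {1..}) (\<lambda>_. path_space)) path_space"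
        by (rule measurable_component_singleton)
      from measurable_compose[OF this measurable_path_functional[OF \<psi>_meas]]
      show "(\<lambda>w. path_functional \<psi> (w p)) \<in> borel_measurable (PiM (UNIV \<times> {1..}) (\<lambda>_. path_space))" .
    qed
    have "indep_var borel (\<lambda>\<omega>. A (\<lambda>k. \<eta> k \<omega>)) borel (\<lambda>\<omega>. ?V (?Y \<omega>))"
    proof (rule indep_set_vimage_algebra_indep_var[OF ind _ _ A V'])
      show "(\<lambda>\<omega> k. \<eta> k \<omega>) \<in> space M \<rightarrow> space (PiM UNIV (\<lambda>_. count_space UNIV))" by (simp add: space_PiM)
      show "?Y \<in> space M \<rightarrow> space (PiM (UNIV \<times> {1..}) (\<lambda>_. path_space))"
        using measurable_space[OF path_meas] by (auto simp: space_PiM PiE_def extensional_def)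
    qed
    moreover have "?V (?Y \<omega>) = V (\<lambda>p\<in>UNIV \<times> {1..}. F (fst p) (snd p) \<omega>)" for \<omega>
      by (rule arg_cong[where f=V]) (auto simp: F_def)
    ultimately show ?thesis by simp
  qed
  \<comment> \<open>The level is scaled by \<open>a\<close> because the sum is not yet normalised.
    After division by \<open>a\<close> it is \<open>2 * \<epsilon>\<close>, and a further \<epsilon>
    for the neglected flux makes up \<open>3 * \<epsilon>\<close>.\<close>
  let ?D = "{\<omega> \<in> space M. \<bar>(\<Sum>l\<in>\<Lambda>. \<Sum>j=1..\<eta> l \<omega>. F l j \<omega>) - (\<Sum>l\<in>\<Lambda>. r l * f l)\<bar> > 2 * (\<epsilon> * a)}"
  have PD: "prob ?D \<le> 5 * (B * T)\<^sup>2 * (\<Sum>l\<in>\<Lambda>. r l) / (\<epsilon> * a)\<^sup>2"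
    by (rule compound_poisson_deviation[OF \<Lambda>(1) pois[folded r_def] indep indF cross])
       (use F_bound F_mean \<epsilon> a in auto)
  have D_meas: "?D \<in> events"
  proof -
    have "(\<lambda>\<omega>. \<Sum>j=1..\<eta> l \<omega>. F l j \<omega>) \<in> borel_measurable M" for l
    proof (rule measurable_compose_countable[OF _ \<eta>_meas, where f="\<lambda>m \<omega>. \<Sum>j=1..m. F l j \<omega>"])
      show "(\<lambda>\<omega>. \<Sum>j=1..m. F l j \<omega>) \<in> borel_measurable M" for m
        by (intro borel_measurable_sum F_meas) simp
    qed
    then have [measurable]: "(\<lambda>\<omega>. \<Sum>l\<in>\<Lambda>. \<Sum>j=1..\<eta> l \<omega>. F l j \<omega>) \<in> borel_measurable M"
      by (intro borel_measurable_sum)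
    show ?thesis by measurable
  qed
  have flux_close: "\<bar>1 / a * (\<Sum>l\<in>\<Lambda>. r l * f l) - flux x d u h ?K\<bar> \<le> \<epsilon>"
  proof -
    have fl: "flux x d u h ?K = (\<Sum>\<^sub>\<infinity>l\<in>?K. u (x l) * d l * f l)"
      unfolding flux_def by (intro infsum_cong) (simp add: f_eq)
    have b: "\<bar>u (x l) * d l * f l\<bar> \<le> U * (B * T) * d l" for l
    proof -
      have "\<bar>u (x l) * d l * f l\<bar> \<le> (U * d l) * (B * T)"
        unfolding abs_mult using u d_pos[of l] f_bound[of l] U by (intro mult_mono) (auto simp: less_imp_le)
      then show ?thesis by (simp add: mult_ac)
    qed
    have sm: "(\<lambda>l. u (x l) * d l * f l) summable_on A" "\<bar>\<Sum>\<^sub>\<infinity>l\<in>A. u (x l) * d l * f l\<bar> \<le> (\<Sum>\<^sub>\<infinity>l\<in>A. U * (B * T) * d l)" if "A \<subseteq> ?K" for A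
      using abs_infsum_le[OF summable_on_cmult_right[OF dS[OF that]] b] by auto
    have "(\<Sum>\<^sub>\<infinity>l\<in>?K - \<Lambda>. u (x l) * d l * f l) = flux x d u h ?K - (\<Sum>\<^sub>\<infinity>l\<in>\<Lambda>. u (x l) * d l * f l)"
      unfolding fl using \<Lambda> by (intro infsum_Diff sm) auto
    moreover have "(\<Sum>\<^sub>\<infinity>l\<in>\<Lambda>. u (x l) * d l * f l) = 1 / a * (\<Sum>l\<in>\<Lambda>. r l * f l)"
      using \<Lambda>(1) a by (simp add: r_def sum_distrib_left mult.assoc)
    moreover have "\<bar>\<Sum>\<^sub>\<infinity>l\<in>?K - \<Lambda>. u (x l) * d l * f l\<bar> \<le> \<epsilon>"
    proof -
      have "\<bar>\<Sum>\<^sub>\<infinity>l\<in>?K - \<Lambda>. u (x l) * d l * f l\<bar> \<le> (\<Sum>\<^sub>\<infinity>l\<in>?K - \<Lambda>. U * (B * T) * d l)"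
        by (rule sm(2)) auto
      also have "\<dots> = U * (B * T) * infsum d (?K - \<Lambda>)" by (rule infsum_cmult_right')
      also have "\<dots> \<le> U * (B * T) * s" using tail U BT by (intro mult_left_mono) auto
      also have "\<dots> \<le> \<epsilon>" using s2 by (simp add: mult_ac)
      finally show ?thesis .
    qed
    ultimately show ?thesis by linarith
  qed
  have sub: "{\<omega> \<in> space M. \<bar>1 / a * total \<omega> - flux x d u h ?K\<bar> > 3 * \<epsilon>} \<subseteq> ?O \<union> ?D"
  proof
    fix \<omega> assume \<omega>: "\<omega> \<in> {\<omega> \<in> space M. \<bar>1 / a * total \<omega> - flux x d u h ?K\<bar> > 3 * \<epsilon>}"
    show "\<omega> \<in> ?O \<union> ?D"
    proof (cases "\<omega> \<in> ?O")
      case False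
      then have "total \<omega> = (\<Sum>l\<in>\<Lambda>. \<Sum>j=1..\<eta> l \<omega>. F l j \<omega>)"
        using \<omega> by (intro total_eq \<Lambda>(1)) auto
      moreover have "2 * \<epsilon> < \<bar>1 / a * total \<omega> - 1 / a * (\<Sum>l\<in>\<Lambda>. r l * f l)\<bar>"
        using \<omega> flux_close by auto
      moreover have "\<bar>1 / a * b - 1 / a * c\<bar> = \<bar>b - c\<bar> / a" for b c
        using a by (simp add: abs_div diff_divide_distrib[symmetric])
      ultimately show ?thesis using \<omega> a by (simp add: pos_less_divide_eq mult.assoc)
    qed simp
  qed
  have "prob {\<omega> \<in> space M. \<bar>1 / a * total \<omega> - flux x d u h ?K\<bar> > 3 * \<epsilon>} \<le> prob (?O \<union> ?D)"
    using O_meas D_meas by (intro finite_measure_mono sub) auto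
  also have "\<dots> \<le> prob ?O + prob ?D" using O_meas D_meas by (rule measure_Un_le)
  also have "\<dots> \<le> 1 / a + 5 * (B * T)\<^sup>2 * (a * U * infsum d ?K) / (\<epsilon> * a)\<^sup>2"
  proof (intro add_mono PO order_trans[OF PD] divide_right_mono mult_left_mono)
    have "(\<Sum>l\<in>\<Lambda>. r l) \<le> a * U * sum d \<Lambda>"
      unfolding sum_distrib_left by (intro sum_mono r)
    also have "sum d \<Lambda> = infsum d \<Lambda>" using \<Lambda>(1) by simp
    also have "infsum d \<Lambda> \<le> infsum d ?K"
      using \<Lambda>(2) by (intro infsum_mono_neutral dS) (auto simp: less_imp_le[OF d_pos])
    finally show "(\<Sum>l\<in>\<Lambda>. r l) \<le> a * U * infsum d ?K" using a U by (simp add: mult_left_mono)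
  qed auto
  also have "5 * (B * T)\<^sup>2 * (a * U * infsum d ?K) / (\<epsilon> * a)\<^sup>2 = 5 * (B * T)\<^sup>2 * U * infsum d ?K / (\<epsilon>\<^sup>2 * a)"
    using a \<epsilon> by (simp add: power2_eq_square field_simps)
  finally show ?thesis .
qed

end

section \<open>Convergence\<close>

text \<open>\<phi> is controlled only at nonnegative times. Extending it by its value at time 0
  gives a continuous function on the whole plane with the bounds used throughout; it does not vanish
  for negative times, but these lie outside the time integrals.\<close>

lemma compact_support_test_function:
  fixes \<phi> :: "real \<times> real \<Rightarrow> real"
  assumes cont: "continuous_on ({0..} \<times> UNIV) \<phi>"
    and K: "compact K" "K \<subseteq> {0..} \<times> UNIV" "\<forall>p\<in>{0..} \<times> UNIV - K. \<phi> p = 0"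
    and h_def: "h = (\<lambda>p. \<phi> (max 0 (fst p), snd p))"
  shows "\<exists>B T. 0 \<le> T \<and> continuous_on UNIV h \<and> (\<forall>p. \<bar>h p\<bar> \<le> B) \<and>
    (\<forall>t z. T < t \<longrightarrow> h (t, z) = 0) \<and> (\<forall>t z. T < \<bar>z\<bar> \<longrightarrow> h (t, z) = 0) \<and>
    (\<forall>e>0. \<exists>C\<ge>0. \<forall>s t z. \<bar>h (s, z) - h (t, z)\<bar> \<le> e + C * \<bar>s - t\<bar>)"
proof -
  have h: "continuous_on UNIV h"
    unfolding h_def by (rule continuous_on_compose2[OF cont]) (auto intro!: continuous_intros)
  have "bounded (\<phi> ` K)"
    by (intro compact_imp_bounded compact_continuous_image continuous_on_subset[OF cont] K)
  then obtain B where B: "\<And>p. p \<in> K \<Longrightarrow> \<bar>\<phi> p\<bar> \<le> B" by (auto simp: bounded_iff)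
  have hB: "\<bar>h p\<bar> \<le> max 0 B" for p
    using B[of "(max 0 (fst p), snd p)"] K(3) by (cases "(max 0 (fst p), snd p) \<in> K") (auto simp: h_def)
  obtain b where b: "\<And>p. p \<in> K \<Longrightarrow> norm p \<le> b" using compact_imp_bounded[OF K(1)] by (auto simp: bounded_iff)
  define T where "T = max 0 b"
  have KT: "fst p \<le> T" "\<bar>snd p\<bar> \<le> T" if "p \<in> K" for p
    using b[OF that] norm_fst_le[of "fst p" "snd p"] norm_snd_le[of "snd p" "fst p"] by (auto simp: T_def)
  have ht: "h (t, z) = 0" if "T < t" for t z
    using KT(1)[of "(max 0 t, z)"] K(3) that by (fastforce simp: h_def)
  have hz: "h (t, z) = 0" if "T < \<bar>z\<bar>" for t z
    using KT(2)[of "(max 0 t, z)"] K(3) that by (fastforce simp: h_def)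
  have modulus: "\<exists>C\<ge>0. \<forall>s t z. \<bar>h (s, z) - h (t, z)\<bar> \<le> e + C * \<bar>s - t\<bar>" if e: "0 < e" for e
  proof -
    \<comment> \<open>The margin of 1 in time absorbs a second time that lies beyond
      \<open>T\<close>, as \<delta> is at most 1.\<close>
    let ?C = "{0..T + 1} \<times> {-T..T}"
    have "uniformly_continuous_on ?C \<phi>"
      by (intro compact_uniformly_continuous continuous_on_subset[OF cont] compact_Times compact_Icc) auto
    then obtain \<delta>0 where \<delta>0: "0 < \<delta>0" "\<And>p q. p \<in> ?C \<Longrightarrow> q \<in> ?C \<Longrightarrow> dist q p < \<delta>0 \<Longrightarrow> dist (\<phi> q) (\<phi> p) < e"
      using e unfolding uniformly_continuous_on_def by metis
    define \<delta> where "\<delta> = min \<delta>0 1"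
    have \<delta>: "0 < \<delta>" using \<delta>0 by (simp add: \<delta>_def)
    have small: "\<bar>h (s, z) - h (t, z)\<bar> \<le> e" if st: "\<bar>s - t\<bar> < \<delta>" for s t z
    proof (cases "T < \<bar>z\<bar> \<or> T < s \<and> T < t")
      case True
      then show ?thesis using hz ht e by auto
    next
      case False
      let ?s = "max 0 s" and ?t = "max 0 t"
      have "0 \<le> T" by (simp add: T_def)
      then have C: "(?s, z) \<in> ?C" "(?t, z) \<in> ?C" using False st by (auto simp: \<delta>_def abs_le_iff)
      have "dist (?s, z) (?t, z) < \<delta>0"
        using st by (auto simp: dist_Pair_Pair dist_real_def \<delta>_def max_def)
      from \<delta>0(2)[OF C(2,1) this] show ?thesis by (simp add: h_def dist_real_def)
    qed
    \<comment> \<open>For times at distance at least \<delta> the linear term alone exceeds the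
      trivial bound \<open>2 * max 0 B\<close>; for closer times uniform continuity gives
      \<open>e\<close>.\<close>
    let ?c = "2 * max 0 B / \<delta>"
    have "\<bar>h (s, z) - h (t, z)\<bar> \<le> e + ?c * \<bar>s - t\<bar>" for s t z
    proof (cases "\<bar>s - t\<bar> < \<delta>")
      case True
      have "0 \<le> ?c * \<bar>s - t\<bar>" using \<delta> by (intro mult_nonneg_nonneg divide_nonneg_pos) auto
      then show ?thesis using small[OF True, of z] by linarith
    next
      case False
      then have "2 * max 0 B \<le> ?c * \<bar>s - t\<bar>"
        using \<delta> mult_left_mono[of \<delta> "\<bar>s - t\<bar>" ?c] by simp
      then show ?thesis using hB[of "(s, z)"] hB[of "(t, z)"] e by linarith
    qed
    moreover have "0 \<le> ?c" using \<delta> by (intro divide_nonneg_pos) auto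
    ultimately show ?thesis by blast
  qed
  have "0 \<le> T" by (simp add: T_def)
  then show ?thesis using h hB ht hz modulus by blast
qed

theorem theorem2p8:
  fixes Ws :: "nat \<Rightarrow> (real \<times> ennreal) measure" and W :: "(real \<times> ennreal) measure"
    and xs :: "nat \<Rightarrow> int \<Rightarrow> real" and ys :: "nat \<Rightarrow> int \<Rightarrow> ennreal"
    and x :: "int \<Rightarrow> real" and y :: "int \<Rightarrow> ennreal"
    and a :: "nat \<Rightarrow> real" and u :: "real \<Rightarrow> real"
    and P :: "'w measure"
    and \<eta>\<^sub>0 :: "nat \<Rightarrow> int \<Rightarrow> 'w \<Rightarrow> nat"
    and Z :: "nat \<Rightarrow> int \<Rightarrow> nat \<Rightarrow> real \<Rightarrow> 'w \<Rightarrow> real"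
    and \<phi> :: "real \<times> real \<Rightarrow> real"
  assumes "\<And>n. Ws n \<in> trap_envs"
    and "\<And>n. enumerates (xs n) (ys n) (Ws n)"
    and "W \<in> dense_trap_envs"
    and "enumerates x y W"
    and "vague_conv Ws W"
    and "\<And>L. ((\<lambda>\<epsilon>. limsup (\<lambda>n. truncated_depth (Ws n) L \<epsilon>)) \<longlongrightarrow> 0) (at_right 0)"
    and "filterlim a at_top sequentially"
    and "continuous_on UNIV u" and "\<And>z. 0 \<le> u z" and "compact (closure {z. u z \<noteq> 0})"
    and "prob_space P"
    and "\<And>n. directed_trap_particles P (xs n) (ys n) (\<eta>\<^sub>0 n) (Z n)"
    and "\<And>n. prob_space.indep_vars P (\<lambda>_. count_space UNIV) (\<eta>\<^sub>0 n) UNIV"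
    and "\<And>n k. poisson_distributed P (\<eta>\<^sub>0 n k) (a n * u (xs n k) * enn2real (ys n k))"
    and "continuous_on ({0..} \<times> UNIV) \<phi>"
    and "\<exists>K. compact K \<and> K \<subseteq> {0..} \<times> UNIV \<and> (\<forall>p\<in>{0..} \<times> UNIV - K. \<phi> p = 0)"
  shows "conv_in_prob P
           (\<lambda>n \<omega>. 1 / a n * (LINT t:{0..}|lborel.
              (\<Sum>\<^sub>\<infinity>k. eta (xs n) (\<eta>\<^sub>0 n) (Z n) t k \<omega> * \<phi> (t, xs n k))))
           (LINT t:{0..}|lborel. (LINT z|trap_measure W. \<phi> (t, z) * u_env x y u t z))"
proof -
  interpret P: prob_space P by fact
  have W: "W \<in> trap_envs" using assms(3) by (simp add: dense_trap_envs_def)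
  interpret trap_env_seq x y W xs ys Ws
    by unfold_locales (use assms(1,2,4,5) W in auto)
  obtain K where K: "compact K" "K \<subseteq> {0..} \<times> UNIV" "\<forall>p\<in>{0..} \<times> UNIV - K. \<phi> p = 0"
    using assms(16) by blast
  define h where "h = (\<lambda>p :: real \<times> real. \<phi> (max 0 (fst p), snd p))"
  note test = compact_support_test_function[OF assms(15) K h_def]
  then obtain B T where T: "0 \<le> T" and h: "continuous_on UNIV h" and bound: "\<forall>p. \<bar>h p\<bar> \<le> B"
    and ht': "\<forall>t z. T < t \<longrightarrow> h (t, z) = 0" and hz': "\<forall>t z. T < \<bar>z\<bar> \<longrightarrow> h (t, z) = 0"
    and modulus': "\<forall>e>0. \<exists>C\<ge>0. \<forall>s t z. \<bar>h (s, z) - h (t, z)\<bar> \<le> e + C * \<bar>s - t\<bar>"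
    by (elim exE conjE)
  note ht = ht'[rule_format] and hz = hz'[rule_format] and modulus = modulus'[rule_format]
  have h_eq: "h (t, z) = \<phi> (t, z)" if "0 \<le> t" for t z using that by (simp add: h_def)
  obtain b where b: "\<And>z. u z \<noteq> 0 \<Longrightarrow> \<bar>z\<bar> \<le> b"
    using bounded_subset[OF compact_imp_bounded[OF assms(10)] closure_subset] by (auto simp: bounded_iff)
  have "bounded (u ` closure {z. u z \<noteq> 0})"
    by (intro compact_imp_bounded compact_continuous_image continuous_on_subset[OF assms(8)] assms(10)) simp
  then obtain U0 where U0: "\<And>z. z \<in> closure {z. u z \<noteq> 0} \<Longrightarrow> \<bar>u z\<bar> \<le> U0" by (auto simp: bounded_iff)
  define U where "U = max 0 U0"
  have U: "u z \<le> U" for z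
    using U0[of z] closure_subset[of "{z. u z \<noteq> 0}"] by (cases "u z = 0") (auto simp: U_def)
  \<comment> \<open>The window has to contain the supports of \<open>u\<close> and \<open>h\<close>
    in space and be of positive size, with no limit trap on its boundary. Only countably many sizes
    are forbidden, so one just above \<open>L0\<close> is available.\<close>
  define L0 where "L0 = max 1 (max b T)"
  have "uncountable ({L0<..<L0 + 1} - range (\<lambda>k. \<bar>x k\<bar>))"
    by (intro uncountable_minus_countable) (auto simp: uncountable_open_interval)
  then have "{L0<..<L0 + 1} - range (\<lambda>k. \<bar>x k\<bar>) \<noteq> {}" by (metis countable_empty)
  then obtain L where "L \<in> {L0<..<L0 + 1} - range (\<lambda>k. \<bar>x k\<bar>)" by blast
  then have L: "0 < L" "b < L" "T < L" "\<And>k. \<bar>x k\<bar> \<noteq> L" by (auto simp: L0_def)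
  have hL: "h (t, z) = 0" if "L < \<bar>z\<bar>" for t z using hz[of z t] that L by simp
  have uL: "u z = 0" if "L < \<bar>z\<bar>" for z using b[of z] that L by fastforce
  define c where "c = flux x d u h (lim.window L)"
  have limit: "(LINT t:{0..}|lborel. (LINT z|trap_measure W. \<phi> (t, z) * u_env x y u t z)) = c"
  proof -
    have "(LINT t:{0..}|lborel. (LINT z|trap_measure W. \<phi> (t, z) * u_env x y u t z)) =
        (LINT t:{0..}|lborel. (LINT z|trap_measure W. h (t, z) * u_env x y u t z))"
      by (intro set_lebesgue_integral_cong) (auto simp: h_eq)
    also have "\<dots> = c"
      unfolding c_def by (rule lim.limit_eq_flux[OF h bound _ ht assms(8,9) U]) (use hL uL in auto)
    finally show ?thesis .
  qed
  have part: "particles (xs n) (ys n) (Ws n) P (\<eta>\<^sub>0 n) (Z n) h B L T" for n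
  proof (intro particles.intro particles_axioms.intro)
    show "\<eta>\<^sub>0 n l \<in> measurable P (count_space UNIV)" for l
      using assms(14)[of n l] by (simp add: poisson_distributed_def)
  qed (use seq assms(11,12) h bound hL ht T in auto)
  interpret p: particles "xs n" "ys n" "Ws n" P "\<eta>\<^sub>0 n" "Z n" h B L T for n by (rule part)
  define X where "X n \<omega> = 1 / a n * p.total n \<omega>" for n \<omega>
  have X: "1 / a n * (LINT t:{0..}|lborel. (\<Sum>\<^sub>\<infinity>k. eta (xs n) (\<eta>\<^sub>0 n) (Z n) t k \<omega> * \<phi> (t, xs n k))) = X n \<omega>" for n \<omega>
    unfolding X_def p.total_def by (intro arg_cong[where f="\<lambda>w. 1 / a n * w"] set_lebesgue_integral_cong) (auto simp: h_eq)
  have X_meas [measurable]: "X n \<in> borel_measurable P" for n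
    unfolding X_def using p.total_measurable by measurable
  note fl = flux_limit[OF assms(6) L(1,4) h bound modulus assms(8,9) U]
  obtain M where M: "eventually (\<lambda>n. infsum (ds n) (sq.window n L) \<le> M) sequentially" using fl(2) by blast
  have "(\<lambda>n. measure P {\<omega> \<in> space P. \<bar>X n \<omega> - c\<bar> > \<epsilon>}) \<longlonglongrightarrow> 0" if \<epsilon>: "0 < \<epsilon>" for \<epsilon>
  proof -
    \<comment> \<open>Half of \<epsilon> is reserved for the distance of the flux from its limit.
      The other half is \<open>3 * (\<epsilon> / 6)\<close>, the threshold of
      \<open>deviation\<close> at level \<open>\<epsilon> / 6\<close>, which leaves a bound of order
      \<open>1 / a n\<close>.\<close>
    define q where "q = 5 * (B * T)\<^sup>2 * U * M / (\<epsilon> / 6)\<^sup>2"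
    have "eventually (\<lambda>n. dist (flux (xs n) (ds n) u h (sq.window n L)) c < \<epsilon> / 2) sequentially"
      using fl(1) \<epsilon> unfolding c_def by (intro tendstoD) auto
    moreover have "eventually (\<lambda>n. 0 < a n) sequentially"
      using assms(7) by (rule filterlim_at_top_dense[THEN iffD1, rule_format])
    ultimately have upper: "eventually (\<lambda>n. measure P {\<omega> \<in> space P. \<bar>X n \<omega> - c\<bar> > \<epsilon>} \<le> 1 / a n + q * (1 / a n)) sequentially"
      using M
    proof eventually_elim
      fix n
      assume n: "dist (flux (xs n) (ds n) u h (sq.window n L)) c < \<epsilon> / 2" "0 < a n" "infsum (ds n) (sq.window n L) \<le> M"
      let ?f = "flux (xs n) (ds n) u h (sq.window n L)"
      have U0: "0 \<le> U" by (simp add: U_def)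
      have "measure P {\<omega> \<in> space P. \<bar>X n \<omega> - c\<bar> > \<epsilon>} \<le> measure P {\<omega> \<in> space P. \<bar>X n \<omega> - ?f\<bar> > 3 * (\<epsilon> / 6)}"
      proof (rule P.finite_measure_mono)
        have "3 * (\<epsilon> / 6) < \<bar>X n \<omega> - ?f\<bar>" if "\<epsilon> < \<bar>X n \<omega> - c\<bar>" for \<omega>
          using n(1) that unfolding dist_real_def by linarith
        then show "{\<omega> \<in> space P. \<bar>X n \<omega> - c\<bar> > \<epsilon>} \<subseteq> {\<omega> \<in> space P. \<bar>X n \<omega> - ?f\<bar> > 3 * (\<epsilon> / 6)}"
          by blast
      qed measurable
      also have "\<dots> \<le> 1 / a n + 5 * (B * T)\<^sup>2 * U * infsum (ds n) (sq.window n L) / ((\<epsilon> / 6)\<^sup>2 * a n)"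
        unfolding X_def
        by (rule p.deviation) (use n \<epsilon> assms(9,13,14) U uL in \<open>auto simp: sq.d_def\<close>)
      also have "\<dots> \<le> 1 / a n + 5 * (B * T)\<^sup>2 * U * M / ((\<epsilon> / 6)\<^sup>2 * a n)"
        using n(2,3) U0 by (intro add_left_mono divide_right_mono mult_left_mono) auto
      finally show "measure P {\<omega> \<in> space P. \<bar>X n \<omega> - c\<bar> > \<epsilon>} \<le> 1 / a n + q * (1 / a n)"
        by (simp add: q_def)
    qed
    have "(\<lambda>n. 1 / a n) \<longlonglongrightarrow> 0"
      using assms(7) by (intro tendsto_divide_0[OF tendsto_const] filterlim_at_top_imp_at_infinity)
    then have "(\<lambda>n. 1 / a n + q * (1 / a n)) \<longlonglongrightarrow> 0 + q * 0" by (intro tendsto_intros)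
    then show ?thesis
      by (intro tendsto_sandwich[OF _ upper tendsto_const]) auto
  qed
  then show ?thesis
    unfolding conv_in_prob_def limit X using X_meas by blast
qed

end
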